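(* A Banach space $X$ does not have the Radon-Nikodým property if and only if it admits a bilipschitz embedding of some nonempty thick family of geodesics; that is, if and only if there exist a metric space $M$, points $u,v\in M$, and a nonempty thick family $T$ of $uv$-geodesics in $M$ such that the union of the images of the geodesics in $T$, with the metric inherited from $M$, admits a bilipschitz embedding into $X$.
   Context: Banach spaces are real. Bilipschitz embedding: a map $f:M\to X$ from a metric space $(M,d_M)$ to a Banach space $X$ is a bilipschitz embedding if there are constants $0<c\le C<\infty$ such that $c\,d_M(a,b)\le \|f(a)-f(b)\|\le C\,d_M(a,b)$ for all $a,b\in M$. Geodesics: let $u,v$ be two elements of a metric space $(M,d_M)$. A $uv$-geodesic is a distance-preserving map $g:[0,d_M(u,v)]\to M$ with $g(0)=u$ and $g(d_M(u,v))=v$, where $[0,d_M(u,v)]\subset\mathbb{R}$ carries the usual distance. Thick family: a family $T$ of $uv$-geodesics in $M$ is called thick if there is $\alpha>0$ such that for every $g\in T$ and every finite collection of points $r_1,\dots,r_n$ in the image of $g$, there is another $uv$-geodesic $\widetilde g\in T$ satisfying: - The image of $\widetilde g$ also contains $r_1,\dots,r_n$; therefore there are $t_1,\dots,t_n\in[0,d_M(u,v)]$ with $r_i=g(t_i)=\widetilde g(t_i)$ for all $i$. - There are two finite sequences $\{q_i\}_{i=1}^m$ and $\{s_i\}_{i=1}^{m+1}$ in $[0,d_M(u,v)]$, listed in non-decreasing order, such that: (1) $\{q_i\}_{i=1}^m$ contains $\{t_i\}_{i=1}^n$; (2) $0\le s_1\le q_1\le s_2\le q_2\le\dots\le s_m\le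 q_m\le s_{m+1}\le d_M(u,v)$; (3) $g(q_i)=\widetilde g(q_i)$ for all $i=1,\dots,m$, and $\sum_{i=1}^{m+1}d_M(g(s_i),\widetilde g(s_i))\ge\alpha$. *)

theory Defs
  imports "HOL-Analysis.Analysis"
begin

section \<open>The Radon-Nikodym property\<close>

text \<open>The defining clauses of \<^const>\<open>has_bochner_integral\<close>, without its restriction to second
  countable types, so that non-separable Banach spaces are covered.  The approximating simple
  functions force \<open>f\<close> to be almost everywhere separably valued.\<close>

definition bochner_integral_is ::
  "'w measure \<Rightarrow> ('w \<Rightarrow> 'x::real_normed_vector) \<Rightarrow> 'x \<Rightarrow> bool" where
  "bochner_integral_is M f x \<longleftrightarrow>
     f \<in> borel_measurable M \<and>
     (\<exists>s. (\<forall>i. Bochner_Integration.simple_bochner_integrable M (s i)) \<and>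
          (\<lambda>i. \<integral>\<^sup>+\<omega>. norm (f \<omega> - s i \<omega>) \<partial>M) \<longlonglongrightarrow> 0 \<and>
          (\<lambda>i. Bochner_Integration.simple_bochner_integral M (s i)) \<longlonglongrightarrow> x)"

definition vector_measure :: "'w measure \<Rightarrow> ('w set \<Rightarrow> 'x::real_normed_vector) \<Rightarrow> bool" where
  "vector_measure M G \<longleftrightarrow>
     (\<forall>A::nat \<Rightarrow> 'w set. range A \<subseteq> sets M \<longrightarrow> disjoint_family A \<longrightarrow>
        (\<lambda>i. G (A i)) sums G (\<Union>i. A i))"

definition bounded_variation :: "'w measure \<Rightarrow> ('w set \<Rightarrow> 'x::real_normed_vector) \<Rightarrow> bool" where
  "bounded_variation M G \<longleftrightarrow>
     (\<exists>B::real. \<forall>P. finite P \<longrightarrow> P \<subseteq> sets M \<longrightarrow> partition_on (space M) P \<longrightarrow>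
        (\<Sum>A\<in>P. norm (G A)) \<le> B)"

definition continuous_wrt :: "'w measure \<Rightarrow> ('w set \<Rightarrow> 'x::real_normed_vector) \<Rightarrow> bool" where
  "continuous_wrt M G \<longleftrightarrow>
     (\<forall>\<epsilon>>0. \<exists>\<delta>>0. \<forall>A\<in>sets M. measure M A < \<delta> \<longrightarrow> norm (G A) < \<epsilon>)"

text \<open>The first argument is the type on which the finite measure spaces live: HOL cannot quantify
  over all measure spaces inside a formula.\<close>

definition radon_nikodym_property :: "'w itself \<Rightarrow> 'x::banach itself \<Rightarrow> bool" where
  "radon_nikodym_property W X \<longleftrightarrow>
     (\<forall>(M::'w measure) (G::'w set \<Rightarrow> 'x).
        finite_measure M \<longrightarrow> vector_measure M G \<longrightarrow> bounded_variation M G \<longrightarrow>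
        continuous_wrt M G \<longrightarrow>
        (\<exists>f. \<forall>A\<in>sets M. bochner_integral_is M (\<lambda>\<omega>. indicator A \<omega> *\<^sub>R f \<omega>) (G A)))"


section \<open>Thick families of geodesics\<close>

text \<open>Only the values of \<open>g\<close> on \<open>{0..d u v}\<close> matter, here and below.\<close>

definition uv_geodesic ::
  "'m set \<Rightarrow> ('m \<Rightarrow> 'm \<Rightarrow> real) \<Rightarrow> 'm \<Rightarrow> 'm \<Rightarrow> (real \<Rightarrow> 'm) \<Rightarrow> bool" where
  "uv_geodesic M d u v g \<longleftrightarrow>
     g ` {0..d u v} \<subseteq> M \<and>
     (\<forall>s\<in>{0..d u v}. \<forall>t\<in>{0..d u v}. d (g s) (g t) = \<bar>s - t\<bar>) \<and>
     g 0 = u \<and> g (d u v) = v"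

text \<open>The inequality on the sum forces \<open>g'\<close> to differ from \<open>g\<close> on \<open>{0..d u v}\<close>, and the chain of
  inequalities makes \<open>q\<close> and \<open>s\<close> non-decreasing.\<close>

definition thick_family ::
  "'m set \<Rightarrow> ('m \<Rightarrow> 'm \<Rightarrow> real) \<Rightarrow> 'm \<Rightarrow> 'm \<Rightarrow> (real \<Rightarrow> 'm) set \<Rightarrow> bool" where
  "thick_family M d u v T \<longleftrightarrow>
     (\<forall>g\<in>T. uv_geodesic M d u v g) \<and>
     (\<exists>\<alpha>>0. \<forall>g\<in>T. \<forall>(n::nat) (r::nat \<Rightarrow> 'm).
        (\<forall>i\<in>{1..n}. r i \<in> g ` {0..d u v}) \<longrightarrow>
        (\<exists>g'\<in>T. g' \<noteq> g \<and>
           (\<exists>t::nat \<Rightarrow> real.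
              (\<forall>i\<in>{1..n}. t i \<in> {0..d u v} \<and> r i = g (t i) \<and> r i = g' (t i)) \<and>
              (\<exists>(m::nat) (q::nat \<Rightarrow> real) (s::nat \<Rightarrow> real).
                 t ` {1..n} \<subseteq> q ` {1..m} \<and>
                 0 \<le> s 1 \<and> (\<forall>i\<in>{1..m}. s i \<le> q i \<and> q i \<le> s (i + 1)) \<and> s (m + 1) \<le> d u v \<and>
                 (\<forall>i\<in>{1..m}. g (q i) = g' (q i)) \<and>
                 (\<Sum>i=1..m+1. d (g (s i)) (g' (s i))) \<ge> \<alpha>))))"

definition bilipschitz_embedding ::
  "'m set \<Rightarrow> ('m \<Rightarrow> 'm \<Rightarrow> real) \<Rightarrow> ('m \<Rightarrow> 'x::real_normed_vector) \<Rightarrow> bool" where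
  "bilipschitz_embedding M d f \<longleftrightarrow>
     (\<exists>c C. 0 < c \<and> c \<le> C \<and>
        (\<forall>a\<in>M. \<forall>b\<in>M. c * d a b \<le> norm (f a - f b) \<and> norm (f a - f b) \<le> C * d a b))"

text \<open>The first argument is the type on which the metric spaces live.\<close>

definition admits_thick_family :: "'m itself \<Rightarrow> 'x::banach itself \<Rightarrow> bool" where
  "admits_thick_family W X \<longleftrightarrow>
     (\<exists>(M::'m set) d u v T (f::'m \<Rightarrow> 'x).
        Metric_space M d \<and> u \<in> M \<and> v \<in> M \<and> T \<noteq> {} \<and> thick_family M d u v T \<and>
        bilipschitz_embedding (\<Union>g\<in>T. g ` {0..d u v}) d f)"

text \<open>How the quantifiers over all measure spaces and all metric spaces are rendered: an
  equivalence \<open>\<not> radon_nikodym_property TYPE(real) TYPE('x) \<longleftrightarrow> admits_thick_family TYPE('x) TYPE('x)\<close>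
  at fixed types leaves open whether measure spaces or metric spaces on other (larger) types would
  matter.  It is therefore to be accompanied by
  \<open>radon_nikodym_property TYPE(real) TYPE('x) \<longrightarrow> radon_nikodym_property TYPE('w) TYPE('x)\<close> and
  \<open>admits_thick_family TYPE('m) TYPE('x) \<longrightarrow> admits_thick_family TYPE('x) TYPE('x)\<close> for arbitrary
  types \<open>'w\<close> and \<open>'m\<close>.\<close>

end

theory Submission
  imports Defs
begin

text \<open>
  Let \<open>G\<close> be a vector measure without a Bochner density.  On a suitable set \<open>A\<close> its averages
  \<open>G C / \<mu> C\<close> are bounded and never settle down: every \<open>C \<subseteq> A\<close> contains an \<open>E\<close> which splits into
  two parts of comparable measure whose averages are uniformly far apart, and by exhaustion the average
  over \<open>C\<close> is, up to a small error, a convex combination of averages over such sets \<open>E\<close>.  After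
  normalising a functional \<open>\<phi>\<close> to the value 1 on all averages, every curve whose velocities are averages
  is a geodesic for the equivalent metric \<open>max \<bar>\<phi> (x - y)\<bar> (h * norm (x - y))\<close>.  The broken lines whose
  velocities are averages over splitting sets more than half of the time are thick: a segment with the
  velocity of \<open>E\<close> can be replaced by two detours along the averages of the two parts.

  Conversely, in a thick family one can choose geodesics \<open>g\<^sub>k\<close> and finite sets \<open>P\<^sub>k\<close> of parameters such
  that \<open>g\<^sub>k\<^sub>+\<^sub>1\<close> agrees with \<open>g\<^sub>k\<close> on \<open>P\<^sub>k\<close> and its image in \<open>X\<close> deviates by a fixed amount, in
  variation over intervals with end points in \<open>P\<^sub>k\<^sub>+\<^sub>1\<close>, from the interpolation of the image of \<open>g\<^sub>k\<close>.  The increments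
  of the images define a Lipschitz vector measure on the sigma-algebra generated by these intervals.  If it
  had a density, its conditional expectations would converge to it in variation, contradicting the
  deviation.
\<close>

section \<open>The Hahn-Banach theorem\<close>

text \<open>A thick family needs one \<open>\<alpha>\<close> that serves every member and every
  choice of prescribed points, while each modification of a broken line may lose some of the time
  spent in splitting directions. A strict lower bound of one half for that time leaves each line a
  surplus of its own; a modification uses up only part of it, so the new line is again in the family
  and the deviation stays bounded below uniformly. In the other direction there need not be a limit
  curve on the whole parameter interval, since the finite parameter sets may fail to become dense.
  This is why the measure lives on a possibly coarse sigma-algebra: there the step densities
  converge to any density whatsoever, and the convergence follows from approximation by simple
  functions, with no pointwise martingale theorem. The Banach space may be non-separable, where the
  difference of two Borel functions can fail to be Borel. Measurability is therefore always reduced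
  to functions with finitely or countably many values and to limits of these.\<close>

definition sublinear :: "('x::real_vector \<Rightarrow> real) \<Rightarrow> bool" where
  "sublinear q \<longleftrightarrow> (\<forall>x y. q (x + y) \<le> q x + q y) \<and> (\<forall>t\<ge>0. \<forall>x. q (t *\<^sub>R x) = t * q x)"

lemma sublinearD:
  assumes "sublinear q"
  shows "q (x + y) \<le> q x + q y" "t \<ge> 0 \<Longrightarrow> q (t *\<^sub>R x) = t * q x" "q 0 = 0" "- q (- x) \<le> q x"
proof -
  show 1: "q (x + y) \<le> q x + q y" for x y using assms by (auto simp: sublinear_def)
  show "t \<ge> 0 \<Longrightarrow> q (t *\<^sub>R x) = t * q x" for t x using assms by (auto simp: sublinear_def)
  from this[of 0 0] show 0: "q 0 = 0" by simp
  show "- q (- x) \<le> q x" using 1[of x "- x"] 0 by simp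
qed

text \<open>The family only has to be directed downwards with respect to sums and positive
  multiples. This covers both the one-parameter family in \<open>sublinear_lower_at\<close> and the
  chains in the application of Zorn's lemma.\<close>

lemma sublinear_INF:
  fixes q :: "'i \<Rightarrow> 'x::real_vector \<Rightarrow> real"
  assumes ne: "I \<noteq> {}" and bdd: "\<And>x. bdd_below ((\<lambda>i. q i x) ` I)"
    and add: "\<And>i j x y. i \<in> I \<Longrightarrow> j \<in> I \<Longrightarrow> \<exists>k\<in>I. q k (x + y) \<le> q i x + q j y"
    and scale: "\<And>i t x. i \<in> I \<Longrightarrow> t > 0 \<Longrightarrow> \<exists>k\<in>I. q k (t *\<^sub>R x) \<le> t * q i x"
    and zero: "\<And>i. i \<in> I \<Longrightarrow> q i 0 = 0"
  shows "sublinear (\<lambda>x. INF i\<in>I. q i x)"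
  unfolding sublinear_def
proof (intro conjI allI impI)
  let ?Q = "\<lambda>x. INF i\<in>I. q i x"
  have le: "?Q x \<le> q i x" if "i \<in> I" for i x
    using cINF_lower[OF bdd that] .
  have approx: "\<exists>i\<in>I. q i x < ?Q x + e" if "e > 0" for e x
  proof (rule ccontr)
    assume "\<not> ?thesis"
    then have "?Q x + e \<le> ?Q x" by (intro cINF_greatest[OF ne]) (auto simp: not_less)
    with that show False by simp
  qed
  show "?Q (x + y) \<le> ?Q x + ?Q y" for x y
  proof (rule field_le_epsilon)
    fix e :: real assume "e > 0"
    then obtain i j where "i \<in> I" "j \<in> I" "q i x < ?Q x + e/2" "q j y < ?Q y + e/2"
      using approx[of "e/2"] by (meson half_gt_zero)
    moreover then obtain k where "k \<in> I" "q k (x + y) \<le> q i x + q j y" using add by blast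
    ultimately show "?Q (x + y) \<le> ?Q x + ?Q y + e" using le[of k "x + y"] by linarith
  qed
  have pos: "?Q (t *\<^sub>R x) \<le> t * ?Q x" if t: "t > 0" for t x
  proof -
    have "?Q (t *\<^sub>R x) / t \<le> ?Q x"
    proof (rule cINF_greatest[OF ne])
      fix i assume "i \<in> I"
      then obtain k where "k \<in> I" "q k (t *\<^sub>R x) \<le> t * q i x" using scale t by blast
      with le[of k "t *\<^sub>R x"] t show "?Q (t *\<^sub>R x) / t \<le> q i x" by (simp add: field_simps)
    qed
    with t show ?thesis by (simp add: field_simps)
  qed
  show "?Q (t *\<^sub>R x) = t * ?Q x" if "0 \<le> t" for t x
  proof (cases "t = 0")
    case True
    have "?Q 0 = (INF i\<in>I. 0)" using zero by (intro INF_cong) auto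
    then show ?thesis using True ne by simp
  next
    case False
    with that have t: "t > 0" by simp
    from pos[of "1/t" "t *\<^sub>R x"] t have "t * ?Q x \<le> ?Q (t *\<^sub>R x)" by (simp add: field_simps)
    with pos[OF t, of x] show ?thesis by linarith
  qed
qed

text \<open>The witness is the largest possible one: any such \<open>q'\<close> satisfies \<open>q'
  x \<le> q' (x + t *\<^sub>R y) + t * q' (- y) \<le> q (x + t *\<^sub>R y) - t * q y\<close> for
  \<open>t \<ge> 0\<close>, so the infimum over \<open>t\<close> is taken. The values
  \<open>t = 0\<close> and \<open>t = 1\<close> give the two bounds.\<close>

lemma sublinear_lower_at:
  fixes q :: "'x::real_vector \<Rightarrow> real"
  assumes q: "sublinear q"
  obtains q' where "sublinear q'" "\<And>x. q' x \<le> q x" "q' (- y) \<le> - q y"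
proof
  let ?f = "\<lambda>t x. q (x + t *\<^sub>R y) - t * q y"
  let ?Q = "\<lambda>x. INF t\<in>{0::real..}. ?f t x"
  note s = sublinearD[OF q]
  have bdd: "bdd_below ((\<lambda>t. ?f t x) ` {0..})" for x
  proof (rule bdd_belowI2[where m = "- q (- x)"])
    fix t :: real assume "t \<in> {0..}"
    then have "t * q y = q ((x + t *\<^sub>R y) + (- x))" using s(2)[of t y] by simp
    with s(1)[of "x + t *\<^sub>R y" "- x"] show "- q (- x) \<le> ?f t x" by linarith
  qed
  show "sublinear ?Q"
  proof (rule sublinear_INF[OF _ bdd])
    show "\<exists>k\<in>{0..}. ?f k (x + z) \<le> ?f i x + ?f j z" if "i \<in> {0..}" "j \<in> {0..}" for i j :: real and x z
      using that s(1)[of "x + i *\<^sub>R y" "z + j *\<^sub>R y"]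
      by (intro bexI[of _ "i + j"]) (auto simp: algebra_simps)
    show "\<exists>k\<in>{0..}. ?f k (t *\<^sub>R x) \<le> t * ?f i x" if "i \<in> {0..}" "t > 0" for i t :: real and x
      using that s(2)[of t "x + i *\<^sub>R y"]
      by (intro bexI[of _ "t * i"]) (auto simp: algebra_simps)
    show "?f i 0 = 0" if "i \<in> {0..}" for i using that s(2)[of i y] by simp
  qed auto
  show "?Q x \<le> q x" for x using cINF_lower[OF bdd, of 0 x] by simp
  show "?Q (- y) \<le> - q y" using cINF_lower[OF bdd, of 1 "- y"] s(3) by simp
qed

text \<open>A sublinear functional that is minimal in the pointwise order is odd, since
  \<open>sublinear_lower_at\<close> cannot lower it any further, and hence linear.\<close>

theorem Hahn_Banach_norm:
  fixes v :: "'x::real_normed_vector"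
  obtains f where "bounded_linear f" "f v = norm v" "\<And>x. \<bar>f x\<bar> \<le> norm x"
proof -
  have n: "sublinear (norm :: 'x \<Rightarrow> real)" by (auto simp: sublinear_def norm_triangle_ineq)
  \<comment> \<open>The norm is lowered at \<open>v\<close> beforehand: a linear \<open>f\<close>
    below \<open>p\<close> has \<open>- f v = f (- v) \<le> - norm v\<close>, so it norms
    \<open>v\<close>.\<close>
  obtain p where p: "sublinear p" "\<And>x. p x \<le> norm x" "p (- v) \<le> - norm v"
    using sublinear_lower_at[OF n, of v] by blast
  define S where "S = {q. sublinear q \<and> (\<forall>x. q x \<le> p x)}"
  have "\<exists>m\<in>S. \<forall>a\<in>S. m \<ge> a \<longrightarrow> a = m"
  proof (rule predicate_Zorn)
    show "partial_order_on S (relation_of (\<ge>) S)"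
      by (rule partial_order_on_relation_ofI) auto
    fix C assume C: "C \<in> Chains (relation_of (\<ge>) S)"
    then have CS: "C \<subseteq> S" by (auto simp: Chains_def relation_of_def)
    show "\<exists>u\<in>S. \<forall>a\<in>C. u \<le> a"
    proof (cases "C = {}")
      case True
      then show ?thesis using p by (auto simp: S_def)
    next
      case False
      have bdd: "bdd_below ((\<lambda>q. q x) ` C)" for x
      proof (rule bdd_belowI2[where m = "- p (- x)"])
        fix q assume "q \<in> C"
        then have q: "sublinear q" "q (- x) \<le> p (- x)" using CS by (auto simp: S_def)
        then show "- p (- x) \<le> q x" using sublinearD(4)[OF q(1), of x] by linarith
      qed
      have sub: "sublinear (\<lambda>x. INF q\<in>C. q x)"
      proof (rule sublinear_INF[OF False bdd])
        fix i j x y assume ij: "i \<in> C" "j \<in> C"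
        then have "i \<le> j \<or> j \<le> i" using C by (auto simp: Chains_def relation_of_def)
        then obtain k where k: "k \<in> C" "k \<le> i" "k \<le> j" using ij by blast
        then have "sublinear k" using CS by (auto simp: S_def)
        from sublinearD(1)[OF this, of x y] le_funD[OF k(2), of x] le_funD[OF k(3), of y]
        have "k (x + y) \<le> i x + j y" by linarith
        with k show "\<exists>k\<in>C. k (x + y) \<le> i x + j y" by blast
      next
        fix i t x assume "i \<in> C" "(t::real) > 0"
        then show "\<exists>k\<in>C. k (t *\<^sub>R x) \<le> t * i x"
          using CS sublinearD(2)[of i t x] by (intro bexI[of _ i]) (auto simp: S_def)
      next
        fix i assume "i \<in> C"
        then show "i 0 = 0" using CS sublinearD(3)[of i] by (auto simp: S_def)
      qed
      have le: "(INF q\<in>C. q x) \<le> q x" if "q \<in> C" for q x using cINF_lower[OF bdd that] .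
      obtain r where r: "r \<in> C" using False by blast
      then have "r x \<le> p x" for x using CS by (auto simp: S_def)
      with le[OF r] have "(INF q\<in>C. q x) \<le> p x" for x by (rule order_trans)
      then have "(\<lambda>x. INF q\<in>C. q x) \<in> S" using sub by (simp add: S_def)
      with le show ?thesis by (intro bexI[of _ "\<lambda>x. INF q\<in>C. q x"]) (auto simp: le_fun_def)
    qed
  qed
  then obtain f where f: "f \<in> S" and min: "\<And>a. a \<in> S \<Longrightarrow> a \<le> f \<Longrightarrow> a = f" by blast
  from f have sf: "sublinear f" and fp: "\<And>x. f x \<le> p x" by (auto simp: S_def)
  note s = sublinearD[OF sf]
  have odd: "f (- y) = - f y" for y
  proof -
    obtain q where q: "sublinear q" "\<And>x. q x \<le> f x" "q (- y) \<le> - f y"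
      using sublinear_lower_at[OF sf, of y] by blast
    have "q x \<le> p x" for x using q(2) fp by (rule order_trans)
    then have "q = f" using q by (intro min) (auto simp: S_def le_fun_def)
    with q(3) s(4)[of y] show ?thesis by simp
  qed
  have add: "f (x + y) = f x + f y" for x y
    using s(1)[of x y] s(1)[of "- x" "- y"] odd[of "x + y"] odd[of x] odd[of y] by simp
  have scale: "f (t *\<^sub>R x) = t *\<^sub>R f x" for t x
    using s(2)[of t x] s(2)[of "- t" x] odd[of "t *\<^sub>R x"] by (cases "t \<ge> 0") auto
  have fn: "f x \<le> norm x" for x using fp p(2) by (rule order_trans)
  have abs: "\<bar>f x\<bar> \<le> norm x" for x using fn[of x] fn[of "- x"] odd[of x] by simp
  have "bounded_linear f"
    by (rule bounded_linear_intro[where K = 1]) (use add scale abs in auto)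
  moreover have "f v = norm v" using fp[of "- v"] p(3) odd[of v] fn[of v] by linarith
  ultimately show thesis using abs that by blast
qed


section \<open>Exhaustion and vector measures\<close>

text \<open>Greedy choice: each \<open>D n\<close> has at least half of the largest measure
  available among the sets with \<open>Q\<close> in the current remainder, and is empty if none of
  positive measure is left. A final remainder of positive measure would contain a set with
  \<open>Q\<close> whose measure is at most twice that of every \<open>D n\<close>, although these
  measures are summable and tend to 0.\<close>

lemma (in finite_measure) exhaustion:
  assumes A: "A \<in> sets M"
    and step: "\<And>C. C \<in> sets M \<Longrightarrow> C \<subseteq> A \<Longrightarrow> 0 < measure M C \<Longrightarrow>
                 \<exists>D\<in>sets M. D \<subseteq> C \<and> 0 < measure M D \<and> Q D"
  obtains D :: "nat \<Rightarrow> 'a set" where "\<And>i. D i \<in> sets M" "disjoint_family D" "\<And>i. D i \<subseteq> A"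
    "\<And>i. D i = {} \<or> 0 < measure M (D i) \<and> Q (D i)" "measure M (A - (\<Union>i. D i)) = 0"
proof -
  define ok where "ok R D \<longleftrightarrow> D \<in> sets M \<and> D \<subseteq> R \<and> (D = {} \<or> 0 < measure M D \<and> Q D) \<and>
    (\<forall>F\<in>sets M. F \<subseteq> R \<longrightarrow> Q F \<longrightarrow> measure M F \<le> 2 * measure M D)" for R D
  have ex: "\<exists>D. ok R D" if "R \<in> sets M" for R
  proof (cases "\<exists>F\<in>sets M. F \<subseteq> R \<and> 0 < measure M F \<and> Q F")
    case False
    then show ?thesis by (intro exI[of _ "{}"]) (force simp: ok_def not_less)
  next
    case True
    define S where "S = {measure M F | F. F \<in> sets M \<and> F \<subseteq> R \<and> 0 < measure M F \<and> Q F}"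
    have ne: "S \<noteq> {}" using True by (auto simp: S_def)
    have bdd: "bdd_above S" using finite_measure_mono[OF _ that] by (auto simp: S_def bdd_above_def)
    obtain s where "s \<in> S" using ne by blast
    then have "Sup S > 0" using cSup_upper[OF _ bdd, of s] by (auto simp: S_def)
    then have "Sup S / 2 < Sup S" by simp
    then obtain r where "r \<in> S" and r: "Sup S / 2 < r" using less_cSup_iff[OF ne bdd] by blast
    then obtain D where D: "D \<in> sets M" "D \<subseteq> R" "0 < measure M D" "Q D" "r = measure M D"
      by (auto simp: S_def)
    have "measure M F \<le> 2 * measure M D" if "F \<in> sets M" "F \<subseteq> R" "Q F" for F
    proof (cases "0 < measure M F")
      case True
      then have "measure M F \<in> S" using that by (auto simp: S_def)
      then show ?thesis using cSup_upper[OF _ bdd] r D(5) by fastforce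
    next
      case False
      then show ?thesis using D(3) by linarith
    qed
    then show ?thesis using D by (intro exI[of _ D]) (auto simp: ok_def)
  qed
  define pick where "pick R = (SOME D. ok R D)" for R
  have pick: "ok R (pick R)" if "R \<in> sets M" for R
    unfolding pick_def using ex[OF that] by (rule someI_ex)
  define R where "R = rec_nat A (\<lambda>_ r. r - pick r)"
  have R0: "R 0 = A" and RS: "R (Suc n) = R n - pick (R n)" for n by (simp_all add: R_def)
  define D where "D n = pick (R n)" for n
  have Rm: "R n \<in> sets M" for n
  proof (induction n)
    case 0
    then show ?case using A by (simp add: R0)
  next
    case (Suc n)
    then show ?case using pick[OF Suc] by (auto simp: RS ok_def)
  qed
  have ok: "ok (R n) (D n)" for n using pick[OF Rm] by (simp add: D_def)
  have Rdec: "R n \<subseteq> R m" if "m \<le> n" for m n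
    using that by (induction rule: dec_induct) (auto simp: RS)
  have RA: "R n \<subseteq> A" for n using Rdec[of 0 n] R0 by simp
  have Dm: "D n \<in> sets M" for n using ok by (auto simp: ok_def)
  have DR: "D n \<subseteq> R n" for n using ok by (auto simp: ok_def)
  have DRS: "D n \<inter> R (Suc n) = {}" for n by (auto simp: RS D_def)
  have disj: "disjoint_family D"
  proof -
    have "D m \<inter> D n = {}" if "m < n" for m n
      using DRS[of m] Rdec[of "Suc m" n] DR[of n] that by auto
    then show ?thesis by (auto simp: disjoint_family_on_def) (metis disjoint_iff linorder_neqE_nat)
  qed
  have sm: "(\<lambda>n. measure M (D n)) sums measure M (\<Union>n. D n)"
    using Dm disj by (intro finite_measure_UNION) auto
  define F where "F = A - (\<Union>i. D i)"
  have Fm: "F \<in> sets M" using A Dm by (auto simp: F_def)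
  have FR: "F \<subseteq> R n" for n by (induction n) (auto simp: R0 RS F_def D_def)
  have "measure M F = 0"
  proof (rule ccontr)
    assume "measure M F \<noteq> 0"
    then have "0 < measure M F" using measure_nonneg[of M F] by linarith
    then obtain E where E: "E \<in> sets M" "E \<subseteq> F" "0 < measure M E" "Q E"
      using step[of F] Fm by (auto simp: F_def)
    then have le: "measure M E \<le> 2 * measure M (D n)" for n using ok[of n] FR[of n] by (auto simp: ok_def)
    have "(\<lambda>n. 2 * measure M (D n)) \<longlonglongrightarrow> 2 * 0"
      using sm by (intro tendsto_mult_left summable_LIMSEQ_zero) (auto simp: sums_iff)
    from LIMSEQ_le_const[OF this, of "measure M E"] le have "measure M E \<le> 0" by simp
    with E(3) show False by simp
  qed
  moreover have "D i = {} \<or> 0 < measure M (D i) \<and> Q (D i)" for i using ok by (auto simp: ok_def)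
  ultimately show thesis using that[of D] Dm disj DR RA unfolding F_def by blast
qed

text \<open>Absolute continuity enters in the form of vanishing on null sets. This form passes to
  images under functionals and to shifts by multiples of the scalar measure, which is how real
  measures with prescribed signs are produced below.\<close>

locale ac_vector_measure = finite_measure M for M :: "'w measure" +
  fixes G :: "'w set \<Rightarrow> 'x::real_normed_vector"
  assumes vector_measure: "vector_measure M G"
    and null: "A \<in> sets M \<Longrightarrow> measure M A = 0 \<Longrightarrow> G A = 0"
begin

lemma empty: "G {} = 0"
  using null[of "{}"] by simp

lemma sums: "(\<And>i. D i \<in> sets M) \<Longrightarrow> disjoint_family D \<Longrightarrow> (\<lambda>i::nat. G (D i)) sums G (\<Union>i. D i)"
  using vector_measure by (auto simp: vector_measure_def)

lemma additive: "A \<in> sets M \<Longrightarrow> B \<in> sets M \<Longrightarrow> A \<inter> B = {} \<Longrightarrow> G (A \<union> B) = G A + G B"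
proof -
  assume AB: "A \<in> sets M" "B \<in> sets M" "A \<inter> B = {}"
  have "disjoint_family (binaryset A B)"
    using AB(3) by (auto simp: disjoint_family_on_def binaryset_def)
  with AB have "(\<lambda>i. G (binaryset A B i)) sums G (A \<union> B)"
    using sums[of "binaryset A B"] by (auto simp: binaryset_def UN_binaryset_eq)
  moreover have "(\<lambda>i. G (binaryset A B i)) sums (G A + G B)"
    using empty by (rule binaryset_sums)
  ultimately show ?thesis by (rule sums_unique2)
qed

lemma Diff: "A \<in> sets M \<Longrightarrow> B \<in> sets M \<Longrightarrow> B \<subseteq> A \<Longrightarrow> G (A - B) = G A - G B"
  using additive[of "A - B" B] by (simp add: Un_absorb2 sets.Diff Int_commute Diff_Int_distrib)

lemma UN_finite:
  "finite I \<Longrightarrow> (\<And>i. i \<in> I \<Longrightarrow> D i \<in> sets M) \<Longrightarrow> disjoint_family_on D I \<Longrightarrow> G (\<Union>i\<in>I. D i) = (\<Sum>i\<in>I. G (D i))"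
proof (induction I rule: finite_induct)
  case empty
  show ?case using null[of "{}"] by simp
next
  case (insert i I)
  have "D i \<inter> (\<Union>j\<in>I. D j) = {}" using insert.hyps(2) insert.prems(2) by (fastforce simp: disjoint_family_on_def)
  then have "G (D i \<union> (\<Union>j\<in>I. D j)) = G (D i) + G (\<Union>j\<in>I. D j)"
    using insert.hyps insert.prems by (intro additive) auto
  then show ?case using insert by (auto simp: disjoint_family_on_def)
qed

lemma sums_exhaustion:
  assumes "A \<in> sets M" "\<And>i. D i \<in> sets M" "disjoint_family D" "\<And>i::nat. D i \<subseteq> A" "measure M (A - (\<Union>i. D i)) = 0"
  shows "(\<lambda>i. G (D i)) sums G A"
proof -
  have "(\<Union>i. D i) \<in> sets M" "(\<Union>i. D i) \<subseteq> A" using assms by auto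
  then have "G A = G (\<Union>i. D i)" using Diff[of A "\<Union>i. D i"] null[of "A - (\<Union>i. D i)"] assms(1,5) by simp
  with sums[OF assms(2,3)] show ?thesis by simp
qed

lemma bounded_linear_image:
  assumes "bounded_linear T"
  shows "ac_vector_measure M (\<lambda>A. T (G A))"
proof
  interpret T: bounded_linear T by fact
  show "vector_measure M (\<lambda>A. T (G A))"
    using sums T.sums by (auto simp: vector_measure_def)
  show "T (G A) = 0" if "A \<in> sets M" "measure M A = 0" for A using null[OF that] T.zero by simp
qed

text \<open>For real-valued measures the shift turns a comparison with a multiple of
  \<open>measure M\<close> into a statement about signs.\<close>

lemma add_density:
  "ac_vector_measure M (\<lambda>A. G A + measure M A *\<^sub>R x)"
proof
  show "vector_measure M (\<lambda>A. G A + measure M A *\<^sub>R x)"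
    unfolding vector_measure_def
  proof safe
    fix A :: "nat \<Rightarrow> 'w set" assume A: "range A \<subseteq> sets M" "disjoint_family A"
    from finite_measure_UNION[OF this] sums[of A] A
    show "(\<lambda>i. G (A i) + measure M (A i) *\<^sub>R x) sums (G (\<Union>i. A i) + measure M (\<Union>i. A i) *\<^sub>R x)"
      by (intro sums_add sums_scaleR_left) auto
  qed
  show "G A + measure M A *\<^sub>R x = 0" if "A \<in> sets M" "measure M A = 0" for A
    using null[OF that] that by simp
qed

end

lemma ac_vector_measure_add:
  assumes "ac_vector_measure M G" "ac_vector_measure M H"
  shows "ac_vector_measure M (\<lambda>A. G A + H A)"
proof -
  interpret G: ac_vector_measure M G by fact
  interpret H: ac_vector_measure M H by fact
  show ?thesis
    by unfold_locales (use G.null H.null G.sums H.sums in \<open>auto simp: vector_measure_def intro!: sums_add\<close>)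
qed

lemma (in finite_measure) ac_vector_measure_measure: "ac_vector_measure M (measure M)"
  by unfold_locales (auto simp: vector_measure_def intro: finite_measure_UNION)


section \<open>Existence of Bochner densities\<close>

text \<open>The two constants are hidden by the library.\<close>

abbreviation "simple_bochner_integrable \<equiv> Bochner_Integration.simple_bochner_integrable"
abbreviation "simple_bochner_integral \<equiv> Bochner_Integration.simple_bochner_integral"

text \<open>Without second countability a difference of Borel functions need not be Borel. Here
  \<open>s\<close> has finitely many values, and for a fixed value the function is a continuous
  function of \<open>f\<close>.\<close>

lemma borel_measurable_norm_diff_simple:
  fixes f s :: "'a \<Rightarrow> 'x::real_normed_vector"
  assumes f: "f \<in> borel_measurable M" and s: "simple_function M s"
  shows "(\<lambda>z. norm (f z - s z)) \<in> borel_measurable M"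
proof (rule measurable_compose_countable'[where f = "\<lambda>y z. norm (f z - y)" and I = "s ` space M"])
  show "(\<lambda>z. norm (f z - y)) \<in> borel_measurable M" for y
    by (rule measurable_compose[OF f]) (intro borel_measurable_continuous_onI continuous_intros)
  show "s \<in> measurable M (count_space (s ` space M))"
    using s by (subst measurable_count_space_eq2) (auto simp: simple_function_def)
  show "countable (s ` space M)" using s by (auto simp: simple_function_def countable_finite)
qed

text \<open>For simple functions this is the triangle inequality for the integral. Inserting the
  approximants \<open>t i\<close> of \<open>f\<close> costs their distance to \<open>f\<close> in
  mean, which tends to 0.\<close>

lemma bochner_integral_is_dist_simple:
  fixes f s :: "'a \<Rightarrow> 'x::real_normed_vector"
  assumes f: "bochner_integral_is M f x" and s: "simple_bochner_integrable M s"
  shows "ennreal (norm (x - simple_bochner_integral M s)) \<le> (\<integral>\<^sup>+z. norm (f z - s z) \<partial>M)"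
proof -
  obtain t where fm: "f \<in> borel_measurable M"
    and t: "\<And>i. simple_bochner_integrable M (t i)"
    and t0: "(\<lambda>i. \<integral>\<^sup>+z. norm (f z - t i z) \<partial>M) \<longlonglongrightarrow> 0"
    and tx: "(\<lambda>i. simple_bochner_integral M (t i)) \<longlonglongrightarrow> x"
    using f by (auto simp: bochner_integral_is_def)
  have [measurable]: "(\<lambda>z. norm (f z - u z)) \<in> borel_measurable M"
    if "simple_bochner_integrable M u" for u
    using that fm by (auto intro: borel_measurable_norm_diff_simple elim: simple_bochner_integrable.cases)
  have le: "ennreal (norm (simple_bochner_integral M (t i) - simple_bochner_integral M s))
      \<le> (\<integral>\<^sup>+z. norm (f z - t i z) \<partial>M) + (\<integral>\<^sup>+z. norm (f z - s z) \<partial>M)" for i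
  proof -
    have sb: "simple_bochner_integrable M (\<lambda>z. t i z - s z)"
      "simple_bochner_integrable M (\<lambda>z. norm (t i z - s z))"
      using t[of i] s by (auto intro: simple_bochner_integrable_compose2[where p = "(-)"]
          simple_bochner_integrable_compose2[where p = "\<lambda>x y. norm (x - y)"])
    have "ennreal (norm (simple_bochner_integral M (t i) - simple_bochner_integral M s))
      = norm (simple_bochner_integral M (\<lambda>z. t i z - s z))"
      using t s by (subst simple_bochner_integral_diff) auto
    also have "\<dots> \<le> simple_bochner_integral M (\<lambda>z. norm (t i z - s z))"
      using sb by (auto intro!: simple_bochner_integral_norm_bound)
    also have "\<dots> = (\<integral>\<^sup>+z. norm (t i z - s z) \<partial>M)"
      using sb by (intro simple_bochner_integral_eq_nn_integral) auto
    also have "\<dots> \<le> (\<integral>\<^sup>+z. ennreal (norm (f z - t i z)) + ennreal (norm (f z - s z)) \<partial>M)"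
    proof (intro nn_integral_mono)
      fix z
      have "norm (t i z - s z) \<le> norm (f z - t i z) + norm (f z - s z)"
        using norm_triangle_ineq4[of "f z - s z" "f z - t i z"] by (simp add: algebra_simps)
      then show "ennreal (norm (t i z - s z)) \<le> ennreal (norm (f z - t i z)) + ennreal (norm (f z - s z))"
        by (simp flip: ennreal_plus)
    qed
    also have "\<dots> = (\<integral>\<^sup>+z. norm (f z - t i z) \<partial>M) + (\<integral>\<^sup>+z. norm (f z - s z) \<partial>M)"
      using t s by (intro nn_integral_add) auto
    finally show ?thesis .
  qed
  have "(\<lambda>i. ennreal (norm (simple_bochner_integral M (t i) - simple_bochner_integral M s)))
      \<longlonglongrightarrow> ennreal (norm (x - simple_bochner_integral M s))"
    using tx by (intro tendsto_intros)
  moreover have "(\<lambda>i. (\<integral>\<^sup>+z. norm (f z - t i z) \<partial>M) + (\<integral>\<^sup>+z. norm (f z - s z) \<partial>M))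
      \<longlonglongrightarrow> 0 + (\<integral>\<^sup>+z. norm (f z - s z) \<partial>M)"
    using t0 by (intro tendsto_add tendsto_const)
  ultimately have "ennreal (norm (x - simple_bochner_integral M s)) \<le> 0 + (\<integral>\<^sup>+z. norm (f z - s z) \<partial>M)"
    by (rule LIMSEQ_le) (use le in blast)
  then show ?thesis by simp
qed

lemma (in finite_measure) simple_bochner_indicator:
  assumes A: "A \<in> sets M"
  shows "simple_bochner_integrable M (\<lambda>z. indicator A z *\<^sub>R x)"
    and "simple_bochner_integral M (\<lambda>z. indicator A z *\<^sub>R x) = measure M A *\<^sub>R x"
proof -
  have sf: "simple_function M (indicator A :: 'a \<Rightarrow> real)" using A by (rule simple_function_indicator)
  have i: "simple_bochner_integrable M (indicator A :: 'a \<Rightarrow> real)"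
    using sf by (intro simple_bochner_integrable.intros) auto
  show "simple_bochner_integrable M (\<lambda>z. indicator A z *\<^sub>R x)"
    using simple_bochner_integrable_compose2[OF _ i i, of "\<lambda>a b. a *\<^sub>R x"] by simp
  have "ennreal (simple_bochner_integral M (indicator A :: 'a \<Rightarrow> real)) = (\<integral>\<^sup>+z. ennreal (indicator A z) \<partial>M)"
    by (rule simple_bochner_integral_eq_nn_integral[OF i]) auto
  also have "\<dots> = emeasure M A" using A by (simp add: ennreal_indicator)
  finally have "simple_bochner_integral M (indicator A :: 'a \<Rightarrow> real) = measure M A"
    by (simp add: emeasure_eq_measure)
  moreover have "linear (\<lambda>a. a *\<^sub>R x)" by (intro linearI) (auto simp: algebra_simps)
  ultimately show "simple_bochner_integral M (\<lambda>z. indicator A z *\<^sub>R x) = measure M A *\<^sub>R x"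
    using simple_bochner_integral_linear[OF _ i, of "\<lambda>a. a *\<^sub>R x"] by simp
qed

lemma (in finite_measure) simple_bochner_indicator_sum:
  assumes "finite I" "\<And>i. i \<in> I \<Longrightarrow> B i \<in> sets M"
  shows "simple_bochner_integrable M (\<lambda>z. \<Sum>i\<in>I. indicator (B i) z *\<^sub>R x i) \<and>
    simple_bochner_integral M (\<lambda>z. \<Sum>i\<in>I. indicator (B i) z *\<^sub>R x i) = (\<Sum>i\<in>I. measure M (B i) *\<^sub>R x i)"
  using assms
proof (induction I rule: finite_induct)
  case empty
  show ?case using simple_bochner_indicator[of "{}" 0] by simp
next
  case (insert i I)
  note i = simple_bochner_indicator[of "B i" "x i"]
  have I: "simple_bochner_integrable M (\<lambda>z. \<Sum>i\<in>I. indicator (B i) z *\<^sub>R x i)"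
    "simple_bochner_integral M (\<lambda>z. \<Sum>i\<in>I. indicator (B i) z *\<^sub>R x i) = (\<Sum>i\<in>I. measure M (B i) *\<^sub>R x i)"
    using insert by blast+
  show ?case
    unfolding sum.insert[OF insert.hyps(1,2)]
  proof
    show "simple_bochner_integrable M
        (\<lambda>z. indicator (B i) z *\<^sub>R x i + (\<Sum>i\<in>I. indicator (B i) z *\<^sub>R x i))"
      by (rule simple_bochner_integrable_compose2[where p = "(+)"]) (use i(1) I(1) insert.prems in auto)
    show "simple_bochner_integral M
        (\<lambda>z. indicator (B i) z *\<^sub>R x i + (\<Sum>i\<in>I. indicator (B i) z *\<^sub>R x i)) =
      measure M (B i) *\<^sub>R x i + (\<Sum>i\<in>I. measure M (B i) *\<^sub>R x i)"
      using simple_bochner_integral_add[OF i(1) I(1)] i(2) I(2) insert.prems by (simp only: insertI1)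
  qed
qed

section \<open>Densities from hereditarily small oscillation\<close>

context ac_vector_measure
begin

text \<open>A disjoint family becomes a partition of the space by dropping empty members, which also
  makes the indexing injective, and by adding the complement of its union.\<close>

lemma bounded_variation_sum:
  assumes "bounded_variation M G"
  obtains B where "\<And>I D. finite I \<Longrightarrow> (\<And>i. i \<in> I \<Longrightarrow> D i \<in> sets M) \<Longrightarrow> disjoint_family_on D I \<Longrightarrow>
    (\<Sum>i\<in>(I::nat set). norm (G (D i))) \<le> B"
proof -
  obtain B where B: "\<And>P. finite P \<Longrightarrow> P \<subseteq> sets M \<Longrightarrow> partition_on (space M) P \<Longrightarrow> (\<Sum>A\<in>P. norm (G A)) \<le> B"
    using assms by (auto simp: bounded_variation_def)
  have "(\<Sum>i\<in>I. norm (G (D i))) \<le> B" if I: "finite I" and D: "\<And>i. i \<in> I \<Longrightarrow> D i \<in> sets M"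
    and disj: "disjoint_family_on D I" for I :: "nat set" and D
  proof -
    define J where "J = {i\<in>I. D i \<noteq> {}}"
    define R where "R = space M - (\<Union>i\<in>I. D i)"
    define P where "P = D ` J \<union> ({R} - {{}})"
    have inj: "inj_on D J"
      using disj by (fastforce simp: inj_on_def J_def disjoint_family_on_def)
    have sub: "D i \<subseteq> space M" if "i \<in> I" for i using D[OF that] sets.sets_into_space by blast
    have "partition_on (space M) P"
    proof (rule partition_onI)
      have "\<Union>P = (\<Union>i\<in>I. D i) \<union> R" by (auto simp: P_def J_def)
      then show "\<Union>P = space M" using sub by (auto simp: R_def)
      have "disjnt (D i) (D j)" if "i \<in> J" "j \<in> J" "D i \<noteq> D j" for i j
      proof -
        have "i \<noteq> j" using that(3) by auto
        then show ?thesis using disj that(1,2) by (simp add: J_def disjoint_family_on_def disjnt_def)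
      qed
      moreover have "disjnt (D i) R" "disjnt R (D i)" if "i \<in> J" for i
        using that by (auto simp: J_def R_def disjnt_def)
      ultimately show "disjnt p q" if "p \<in> P" "q \<in> P" "p \<noteq> q" for p q
        using that unfolding P_def by blast
      show "{} \<notin> P" by (auto simp: P_def J_def)
    qed
    moreover have "P \<subseteq> sets M" using D I by (auto simp: P_def J_def R_def)
    moreover have fin: "finite P" using I by (auto simp: P_def J_def)
    ultimately have "(\<Sum>A\<in>P. norm (G A)) \<le> B" by (intro B)
    moreover have "(\<Sum>A\<in>D ` J. norm (G A)) \<le> (\<Sum>A\<in>P. norm (G A))"
      using fin by (intro sum_mono2) (auto simp: P_def)
    moreover have "(\<Sum>A\<in>D ` J. norm (G A)) = (\<Sum>i\<in>J. norm (G (D i)))"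
      using inj by (simp add: sum.reindex)
    moreover have "(\<Sum>i\<in>J. norm (G (D i))) = (\<Sum>i\<in>I. norm (G (D i)))"
      using I empty by (intro sum.mono_neutral_left) (auto simp: J_def)
    ultimately show ?thesis by linarith
  qed
  then show thesis by (rule that)
qed

end

text \<open>For each precision \<open>r n\<close> the space is exhausted by sets on which
  \<open>G\<close> is nearly a constant multiple \<open>x n i\<close> of the measure, and
  \<open>F n\<close> is the function with these countably many values. Two such functions are
  compared on a common cell of positive measure, where both approximate the same averages of
  \<open>G\<close>; so they are uniformly Cauchy off a null set, and the limit is the density.
  Bounded variation makes the tails of the countable decompositions summable.\<close>

theorem ac_vector_measure_density:
  fixes M :: "'w measure" and G :: "'w set \<Rightarrow> 'x::banach"
  assumes "ac_vector_measure M G"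
  assumes bv: "bounded_variation M G"
    and osc: "\<And>A e. A \<in> sets M \<Longrightarrow> 0 < measure M A \<Longrightarrow> (0::real) < e \<Longrightarrow>
      \<exists>C\<in>sets M. C \<subseteq> A \<and> 0 < measure M C \<and>
        (\<exists>x. \<forall>D\<in>sets M. D \<subseteq> C \<longrightarrow> norm (G D - measure M D *\<^sub>R x) \<le> e * measure M D)"
  shows "\<exists>f. \<forall>A\<in>sets M. bochner_integral_is M (\<lambda>z. indicator A z *\<^sub>R f z) (G A)"
proof -
  interpret ac_vector_measure M G by fact
  define r :: "nat \<Rightarrow> real" where "r n = (1/2) ^ n" for n
  have r0: "r n > 0" "r n \<le> 1" for n by (auto simp: r_def power_le_one)
  have rlim: "r \<longlonglongrightarrow> 0" unfolding r_def by (intro LIMSEQ_power_zero) auto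
  have "\<exists>D x. (\<forall>i::nat. D i \<in> sets M) \<and> disjoint_family D \<and> measure M (space M - (\<Union>i. D i)) = 0 \<and>
      (\<forall>i. \<forall>E\<in>sets M. E \<subseteq> D i \<longrightarrow> norm (G E - measure M E *\<^sub>R x i) \<le> r n * measure M E)" for n
  proof -
    obtain D where D: "\<And>i. D i \<in> sets M" "disjoint_family D" "\<And>i. D i \<subseteq> space M"
      "\<And>i::nat. D i = {} \<or> 0 < measure M (D i) \<and>
        (\<exists>x. \<forall>E\<in>sets M. E \<subseteq> D i \<longrightarrow> norm (G E - measure M E *\<^sub>R x) \<le> r n * measure M E)"
      "measure M (space M - (\<Union>i. D i)) = 0"
      using exhaustion[of "space M" "\<lambda>C. \<exists>x. \<forall>E\<in>sets M. E \<subseteq> C \<longrightarrow> norm (G E - measure M E *\<^sub>R x) \<le> r n * measure M E"]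
        osc[OF _ _ r0(1)[of n]] by (metis sets.top)
    have "\<exists>x. \<forall>E\<in>sets M. E \<subseteq> D i \<longrightarrow> norm (G E - measure M E *\<^sub>R x) \<le> r n * measure M E" for i
    proof (cases "D i = {}")
      case True
      then show ?thesis using empty by simp
    next
      case False
      then show ?thesis using D(4) by blast
    qed
    then show ?thesis using D by metis
  qed
  then obtain D x where Dm: "\<And>n i::nat. D n i \<in> sets M" and disj: "\<And>n. disjoint_family (D n)"
    and cov: "\<And>n. measure M (space M - (\<Union>i. D n i)) = 0"
    and x: "\<And>n i E. E \<in> sets M \<Longrightarrow> E \<subseteq> D n i \<Longrightarrow> norm (G E - measure M E *\<^sub>R x n i) \<le> r n * measure M E"
    by metis
  note [measurable] = Dm
  \<comment> \<open>Besides the uncovered points, \<open>Z\<close> absorbs all null intersections of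
    cells. Off \<open>Z\<close> the common cell of a point therefore has positive measure, by which
    the comparison of \<open>F n\<close> and \<open>F m\<close> can be divided.\<close>
  define Z where "Z = (\<Union>n. space M - (\<Union>i. D n i)) \<union>
    (\<Union>(n, m, i, j)\<in>{(n, m, i, j). measure M (D n i \<inter> D m j) = 0}. D n i \<inter> D m j)"
  have Zcov: "space M - (\<Union>i. D n i) \<subseteq> Z" for n unfolding Z_def by blast
  have Zint: "D n i \<inter> D m j \<subseteq> Z" if "measure M (D n i \<inter> D m j) = 0" for n m i j
    unfolding Z_def using that by blast
  have Zn: "Z \<in> null_sets M"
    unfolding Z_def using cov
    by (intro null_sets.Un null_sets_UN null_sets_UN') (auto intro!: null_setsI simp: emeasure_eq_measure)
  then have Zm[measurable]: "Z \<in> sets M" by auto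
  define idx where "idx n z = (LEAST i. z \<in> D n i)" for n z
  have idxm[measurable]: "idx n \<in> measurable M (count_space UNIV)" for n
    unfolding idx_def by measurable
  have idx: "z \<in> D n (idx n z)" if "z \<in> space M" "z \<notin> Z" for n z
  proof -
    have "\<exists>i. z \<in> D n i" using that Zcov[of n] by blast
    then show ?thesis unfolding idx_def by (rule LeastI_ex)
  qed
  have idx_unique: "z \<in> D n i \<longleftrightarrow> i = idx n z" if "z \<in> space M" "z \<notin> Z" for n i z
    using idx[OF that, of n] disj[of n] by (auto simp: disjoint_family_on_def)
  define F where "F n z = (if z \<in> Z then 0 else x n (idx n z))" for n z
  have Fm[measurable]: "F n \<in> borel_measurable M" for n
  proof -
    have "(\<lambda>z. x n (idx n z)) \<in> borel_measurable M"
      by (rule measurable_compose[OF idxm]) simp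
    then show ?thesis unfolding F_def by measurable
  qed
  have Fdist: "norm (F n z - F m z) \<le> r n + r m" if "z \<in> space M" for n m z
  proof (cases "z \<in> Z")
    case True
    then show ?thesis using r0(1)[of n] r0(1)[of m] by (simp add: F_def)
  next
    case False
    define E where "E = D n (idx n z) \<inter> D m (idx m z)"
    have Em: "E \<in> sets M" by (auto simp: E_def)
    have "z \<in> E" using idx[OF that False] by (auto simp: E_def)
    then have "measure M E \<noteq> 0" using False Zint[of n _ m] unfolding E_def by blast
    then have pos: "measure M E > 0" using measure_nonneg[of M E] by linarith
    have "norm (G E - measure M E *\<^sub>R F n z) \<le> r n * measure M E"
      "norm (G E - measure M E *\<^sub>R F m z) \<le> r m * measure M E"
      using x[OF Em] False by (auto simp: F_def E_def)
    then have "norm (measure M E *\<^sub>R F n z - measure M E *\<^sub>R F m z) \<le> (r n + r m) * measure M E"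
      using norm_triangle_ineq4[of "G E - measure M E *\<^sub>R F m z" "G E - measure M E *\<^sub>R F n z"]
      by (simp add: algebra_simps)
    then have "measure M E * norm (F n z - F m z) \<le> measure M E * (r n + r m)"
      by (simp add: mult.commute flip: scaleR_diff_right)
    with pos show ?thesis by simp
  qed
  have Cau: "Cauchy (\<lambda>n. F n z)" if "z \<in> space M" for z
  proof (rule CauchyI)
    fix e :: real assume "e > 0"
    then have "eventually (\<lambda>n. r n < e/2) sequentially" using rlim by (intro order_tendstoD(2)) auto
    then obtain N where N: "\<And>n. n \<ge> N \<Longrightarrow> r n < e/2" unfolding eventually_sequentially by blast
    show "\<exists>N. \<forall>m\<ge>N. \<forall>n\<ge>N. norm (F m z - F n z) < e"
    proof (intro exI allI impI)
      fix m n assume "m \<ge> N" "n \<ge> N"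
      then show "norm (F m z - F n z) < e" using N[of m] N[of n] Fdist[OF that, of m n] by linarith
    qed
  qed
  define f where "f z = lim (\<lambda>n. F n z)" for z
  have flim: "(\<lambda>n. F n z) \<longlonglongrightarrow> f z" if "z \<in> space M" for z
    using Cauchy_convergent[OF Cau[OF that]] by (simp add: f_def convergent_LIMSEQ_iff)
  have fm[measurable]: "f \<in> borel_measurable M"
    using flim by (rule borel_measurable_LIMSEQ_metric[OF Fm])
  have fF: "norm (f z - F n z) \<le> r n" if "z \<in> space M" for n z
  proof (rule LIMSEQ_le)
    show "(\<lambda>m. norm (F m z - F n z)) \<longlonglongrightarrow> norm (f z - F n z)"
      using flim[OF that] by (intro tendsto_intros)
    show "(\<lambda>m. r m + r n) \<longlonglongrightarrow> r n" using tendsto_add[OF rlim tendsto_const[of "r n"]] by simp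
    show "\<exists>N. \<forall>m\<ge>N. norm (F m z - F n z) \<le> r m + r n" using Fdist[OF that] by blast
  qed
  have fZ: "f z = 0" if "z \<in> Z" for z
    using that by (simp add: f_def F_def)
  \<comment> \<open>Since \<open>r n \<le> 1\<close>, this weight dominates
    \<open>norm (x n i) * measure M (D n i)\<close> as well as
    \<open>norm (G (A \<inter> D n i))\<close> for every measurable \<open>A\<close>; the second
    bound costs the factor 2.\<close>
  define w where "w n i = norm (G (D n i)) + 2 * measure M (D n i)" for n i
  obtain B where B: "\<And>I C. finite I \<Longrightarrow> (\<And>i. i \<in> I \<Longrightarrow> C i \<in> sets M) \<Longrightarrow> disjoint_family_on C I \<Longrightarrow>
    (\<Sum>i\<in>(I::nat set). norm (G (C i))) \<le> B" using bounded_variation_sum[OF bv] by blast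
  have wsum: "summable (w n)" for n
  proof -
    have "summable (\<lambda>i. norm (G (D n i)))"
      using B disj[of n] by (intro bounded_imp_summable[where B = B]) (auto simp: disjoint_family_on_def)
    moreover have "summable (\<lambda>i. measure M (D n i))"
      using Dm by (intro sums_summable[OF finite_measure_UNION[OF _ disj]]) auto
    ultimately show ?thesis unfolding w_def by (intro summable_add summable_mult)
  qed
  have w0: "0 \<le> w n i" for n i by (auto simp: w_def)
  \<comment> \<open>Simple functions have finitely many values, so the decomposition is cut off
    where the remaining weight is at most \<open>r n\<close>.\<close>
  have "\<exists>N. (\<Sum>i. w n (i + N)) \<le> r n" for n
  proof -
    obtain N where "norm (\<Sum>i. w n (i + N)) < r n" using suminf_exist_split[OF r0(1)[of n] wsum[of n]] by blast
    then show ?thesis by (intro exI[of _ N]) auto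
  qed
  then obtain N where N: "\<And>n. (\<Sum>i. w n (i + N n)) \<le> r n" by metis
  have xw: "norm (x n i) * measure M (D n i) \<le> w n i" for n i
  proof -
    have "r n * measure M (D n i) \<le> measure M (D n i)" using r0[of n] by (simp add: mult_left_le_one_le)
    then show ?thesis
      using x[OF Dm order_refl, of n i] norm_triangle_ineq2[of "measure M (D n i) *\<^sub>R x n i" "G (D n i)"]
      by (simp add: w_def norm_minus_commute mult.commute) (smt (verit) measure_nonneg)
  qed
  have Gw: "norm (G (A \<inter> D n i)) \<le> w n i" if "A \<in> sets M" for A n i
  proof -
    have le: "measure M (A \<inter> D n i) \<le> measure M (D n i)" using that by (intro finite_measure_mono) auto
    have "r n * measure M C \<le> measure M C" for C using r0[of n] by (simp add: mult_left_le_one_le)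
    moreover have "norm (x n i) * measure M (A \<inter> D n i) \<le> norm (x n i) * measure M (D n i)"
      using le by (intro mult_left_mono) auto
    ultimately show ?thesis
      using x[of "A \<inter> D n i" n i] x[OF Dm order_refl, of n i] that le
        norm_triangle_ineq2[of "measure M (D n i) *\<^sub>R x n i" "G (D n i)"]
        norm_triangle_sub[of "G (A \<inter> D n i)" "measure M (A \<inter> D n i) *\<^sub>R x n i"]
      by (simp add: w_def norm_minus_commute mult.commute) (smt (verit))
  qed
  have "bochner_integral_is M (\<lambda>z. indicator A z *\<^sub>R f z) (G A)" if A[measurable]: "A \<in> sets M" for A
  proof -
    define s where "s n z = (\<Sum>i<N n. indicator (A \<inter> D n i - Z) z *\<^sub>R x n i)" for n z
    have s: "simple_bochner_integrable M (s n)"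
      and si: "simple_bochner_integral M (s n) = (\<Sum>i<N n. measure M (A \<inter> D n i - Z) *\<^sub>R x n i)" for n
      using simple_bochner_indicator_sum[of "{..<N n}" "\<lambda>i. A \<inter> D n i - Z" "x n"] by (auto simp: s_def[abs_def])
    have meas: "(\<lambda>z. indicator A z *\<^sub>R f z) \<in> borel_measurable M"
    proof -
      have "(\<lambda>z. if z \<in> A then f z else 0) \<in> borel_measurable M" by measurable
      then show ?thesis by (rule measurable_cong[THEN iffD1, rotated]) auto
    qed
    \<comment> \<open>Off \<open>Z\<close>, a point lies in exactly one cell. If its index is below
      \<open>N n\<close>, then \<open>s n\<close> agrees with \<open>F n\<close> on
      \<open>A\<close>, within \<open>r n\<close> of \<open>f\<close>; otherwise \<open>s n\<close>
      is 0 and \<open>f\<close> is bounded by \<open>r n\<close> plus the norm of the value on that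
      cell.\<close>
    have pt: "ennreal (norm (indicator A z *\<^sub>R f z - s n z)) \<le>
        ennreal (r n) + (\<Sum>i. ennreal (norm (x n (i + N n))) * indicator (D n (i + N n)) z)"
      if "z \<in> space M" for n z
    proof (cases "z \<in> A - Z")
      case False
      then have "indicator A z *\<^sub>R f z - s n z = 0" using fZ by (auto simp: s_def indicator_def)
      then show ?thesis by simp
    next
      case True
      have Fx: "F n z = x n (idx n z)" using True by (simp add: F_def)
      have s_eq: "s n z = (\<Sum>i<N n. if i = idx n z then x n i else 0)"
        unfolding s_def using True idx_unique[OF that] by (intro sum.cong) (auto simp: indicator_def)
      show ?thesis
      proof (cases "idx n z < N n")
        case True
        then have "s n z = F n z" by (simp add: s_eq Fx)
        then have "norm (indicator A z *\<^sub>R f z - s n z) \<le> r n" using fF[OF that] \<open>z \<in> A - Z\<close> by simp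
        then have "ennreal (norm (indicator A z *\<^sub>R f z - s n z)) \<le> ennreal (r n) + 0"
          by (simp add: ennreal_leI)
        also have "\<dots> \<le> ennreal (r n) + (\<Sum>i. ennreal (norm (x n (i + N n))) * indicator (D n (i + N n)) z)"
          by (intro add_left_mono zero_le)
        finally show ?thesis .
      next
        case False
        then have "s n z = 0" by (simp add: s_eq)
        then have "norm (indicator A z *\<^sub>R f z - s n z) \<le> r n + norm (x n (idx n z))"
          using fF[OF that, of n] True norm_triangle_sub[of "f z" "F n z"] by (simp add: Fx)
        then have "ennreal (norm (indicator A z *\<^sub>R f z - s n z)) \<le> ennreal (r n) + ennreal (norm (x n (idx n z)))"
          using r0(1)[of n] by (simp add: ennreal_leI flip: ennreal_plus)
        also have "ennreal (norm (x n (idx n z))) \<le> (\<Sum>i. ennreal (norm (x n (i + N n))) * indicator (D n (i + N n)) z)"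
        proof -
          have "ennreal (norm (x n (idx n z))) = (\<Sum>i\<in>{idx n z - N n}. ennreal (norm (x n (i + N n))) * indicator (D n (i + N n)) z)"
            using False idx[OF that, of n] True by simp
          also have "\<dots> \<le> (\<Sum>i. ennreal (norm (x n (i + N n))) * indicator (D n (i + N n)) z)"
            by (rule sum_le_suminf) auto
          finally show ?thesis .
        qed
        finally show ?thesis by (simp add: add_left_mono)
      qed
    qed
    have L1: "(\<integral>\<^sup>+z. norm (indicator A z *\<^sub>R f z - s n z) \<partial>M) \<le> ennreal (r n * (measure M (space M) + 1))" for n
    proof -
      have sm: "summable (\<lambda>i. w n (i + N n))" using wsum summable_ignore_initial_segment by blast
      have "(\<integral>\<^sup>+z. norm (indicator A z *\<^sub>R f z - s n z) \<partial>M)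
        \<le> (\<integral>\<^sup>+z. ennreal (r n) + (\<Sum>i. ennreal (norm (x n (i + N n))) * indicator (D n (i + N n)) z) \<partial>M)"
        by (intro nn_integral_mono pt)
      also have "\<dots> = ennreal (r n) * emeasure M (space M) + (\<Sum>i. ennreal (norm (x n (i + N n))) * emeasure M (D n (i + N n)))"
        by (simp add: nn_integral_add nn_integral_suminf nn_integral_cmult_indicator)
      also have "(\<Sum>i. ennreal (norm (x n (i + N n))) * emeasure M (D n (i + N n))) \<le> (\<Sum>i. ennreal (w n (i + N n)))"
        using xw by (intro suminf_le) (auto simp: emeasure_eq_measure simp flip: ennreal_mult intro!: ennreal_leI)
      also have "\<dots> = ennreal (\<Sum>i. w n (i + N n))"
        using sm w0 by (intro suminf_ennreal2) auto
      also have "\<dots> \<le> ennreal (r n)" by (intro ennreal_leI N)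
      also have "ennreal (r n) * emeasure M (space M) + ennreal (r n) = ennreal (r n * (measure M (space M) + 1))"
        using r0(1)[of n] by (simp add: emeasure_eq_measure algebra_simps ennreal_mult flip: ennreal_plus ennreal_mult)
      finally show ?thesis by (simp add: add_left_mono)
    qed
    have lim1: "(\<lambda>n. \<integral>\<^sup>+z. norm (indicator A z *\<^sub>R f z - s n z) \<partial>M) \<longlonglongrightarrow> 0"
    proof (rule tendsto_sandwich[OF _ _ tendsto_const])
      have "(\<lambda>n. ennreal (r n * (measure M (space M) + 1))) \<longlonglongrightarrow> ennreal (0 * (measure M (space M) + 1))"
        by (intro tendsto_ennrealI tendsto_mult_right rlim)
      then show "(\<lambda>n. ennreal (r n * (measure M (space M) + 1))) \<longlonglongrightarrow> 0" by simp
    qed (use L1 in auto)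
    have est: "norm (simple_bochner_integral M (s n) - G A) \<le> r n * (measure M (space M) + 1)" for n
    proof -
      have sG: "(\<lambda>i. G (A \<inter> D n i)) sums G A"
      proof (rule sums_exhaustion)
        show "disjoint_family (\<lambda>i. A \<inter> D n i)" using disj[of n] by (auto simp: disjoint_family_on_def)
        have "A - (\<Union>i. A \<inter> D n i) \<subseteq> space M - (\<Union>i. D n i)" using sets.sets_into_space[OF A] by auto
        then have "measure M (A - (\<Union>i. A \<inter> D n i)) \<le> measure M (space M - (\<Union>i. D n i))"
          by (intro finite_measure_mono) auto
        then show "measure M (A - (\<Union>i. A \<inter> D n i)) = 0" using cov[of n] measure_nonneg[of M] by (simp add: antisym)
      qed auto
      then have sG': "(\<lambda>i. G (A \<inter> D n (i + N n))) sums (G A - (\<Sum>i<N n. G (A \<inter> D n i)))"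
        by (rule sums_split_initial_segment)
      have sm: "summable (\<lambda>i. w n (i + N n))" using wsum summable_ignore_initial_segment by blast
      have sn: "summable (\<lambda>i. norm (G (A \<inter> D n (i + N n))))"
        by (rule summable_comparison_test'[OF sm, where N = 0]) (use Gw[OF A] in auto)
      have "norm (G A - (\<Sum>i<N n. G (A \<inter> D n i))) \<le> (\<Sum>i. norm (G (A \<inter> D n (i + N n))))"
        using sG' summable_norm[OF sn] by (simp add: sums_iff)
      also have "\<dots> \<le> (\<Sum>i. w n (i + N n))" using sn sm Gw[OF A] by (intro suminf_le) auto
      finally have 1: "norm (G A - (\<Sum>i<N n. G (A \<inter> D n i))) \<le> r n" using N[of n] by linarith
      have mZ: "measure M (A \<inter> D n i - Z) = measure M (A \<inter> D n i)" for i
        using Zn by (intro measure_Diff_null_set) auto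
      have "norm ((\<Sum>i<N n. measure M (A \<inter> D n i) *\<^sub>R x n i) - (\<Sum>i<N n. G (A \<inter> D n i))) \<le>
          (\<Sum>i<N n. r n * measure M (A \<inter> D n i))"
        unfolding sum_subtractf[symmetric]
        by (rule order_trans[OF norm_sum]) (use x in \<open>auto intro!: sum_mono simp: norm_minus_commute\<close>)
      also have "\<dots> = r n * measure M (\<Union>i<N n. A \<inter> D n i)"
        using disj[of n] by (subst finite_measure_finite_Union) (auto simp: sum_distrib_left disjoint_family_on_def)
      also have "\<dots> \<le> r n * measure M (space M)" using r0(1)[of n] by (intro mult_left_mono bounded_measure) auto
      finally show ?thesis
        using 1 norm_triangle_ineq4[of "(\<Sum>i<N n. measure M (A \<inter> D n i) *\<^sub>R x n i) - (\<Sum>i<N n. G (A \<inter> D n i))"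
          "G A - (\<Sum>i<N n. G (A \<inter> D n i))"]
        by (simp add: si mZ algebra_simps)
    qed
    have "(\<lambda>n. simple_bochner_integral M (s n)) \<longlonglongrightarrow> G A"
    proof (rule LIM_zero_cancel, rule tendsto_norm_zero_cancel, rule tendsto_sandwich[OF _ _ tendsto_const])
      have "(\<lambda>n. r n * (measure M (space M) + 1)) \<longlonglongrightarrow> 0 * (measure M (space M) + 1)"
        by (intro tendsto_mult_right rlim)
      then show "(\<lambda>n. r n * (measure M (space M) + 1)) \<longlonglongrightarrow> 0" by simp
    qed (use est in auto)
    then show ?thesis unfolding bochner_integral_is_def using meas s lim1 by blast
  qed
  then show ?thesis by blast
qed


section \<open>Splitting measures\<close>

text \<open>If every subset of \<open>A\<close> of positive measure contained a piece with
  \<open>c * measure M D \<le> norm (G D)\<close>, such pieces would exhaust \<open>A\<close> and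
  have total variation at least \<open>c * measure M A\<close>. The choice of \<open>c\<close> makes
  this \<open>B + 1\<close>, beyond the bound \<open>B\<close> on the variation.\<close>

lemma (in ac_vector_measure) hereditarily_bounded:
  assumes bv: "bounded_variation M G" and A: "A \<in> sets M" "0 < measure M A"
  obtains C c where "C \<in> sets M" "C \<subseteq> A" "0 < measure M C"
    "\<And>D. D \<in> sets M \<Longrightarrow> D \<subseteq> C \<Longrightarrow> norm (G D) \<le> c * measure M D"
proof (rule ccontr)
  assume no: "\<not> thesis"
  note found = that
  have neg: "\<exists>D\<in>sets M. D \<subseteq> C \<and> \<not> norm (G D) \<le> c * measure M D"
    if C: "C \<in> sets M" "C \<subseteq> A" "0 < measure M C" for C c
    using found[OF C] no by blast
  obtain B where B: "\<And>I D. finite I \<Longrightarrow> (\<And>i. i \<in> I \<Longrightarrow> D i \<in> sets M) \<Longrightarrow> disjoint_family_on D I \<Longrightarrow>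
    (\<Sum>i\<in>(I::nat set). norm (G (D i))) \<le> B" using bounded_variation_sum[OF bv] by blast
  define c where "c = (B + 1) / measure M A"
  have step: "\<exists>D\<in>sets M. D \<subseteq> C \<and> 0 < measure M D \<and> c * measure M D \<le> norm (G D)"
    if C: "C \<in> sets M" "C \<subseteq> A" "0 < measure M C" for C
  proof -
    obtain D where D: "D \<in> sets M" "D \<subseteq> C" "c * measure M D < norm (G D)"
      using neg[OF C, of c] by (auto simp: not_le)
    then have "measure M D \<noteq> 0" using null[of D] by auto
    then have "0 < measure M D" using measure_nonneg[of M D] by linarith
    then show ?thesis using D by (intro bexI[of _ D]) auto
  qed
  obtain D where D: "\<And>i. D i \<in> sets M" "disjoint_family D" "\<And>i. D i \<subseteq> A"
    "\<And>i::nat. D i = {} \<or> 0 < measure M (D i) \<and> c * measure M (D i) \<le> norm (G (D i))"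
    "measure M (A - (\<Union>i. D i)) = 0"
    using exhaustion[OF A(1) step] by blast
  have D4: "c * measure M (D i) \<le> norm (G (D i))" for i using D(4)[of i] by auto
  interpret m: ac_vector_measure M "measure M" by (rule ac_vector_measure_measure)
  have "(\<lambda>i. c * measure M (D i)) sums (c * measure M A)"
    by (intro sums_mult m.sums_exhaustion A D)
  then have "(\<lambda>n. \<Sum>i<n. c * measure M (D i)) \<longlonglongrightarrow> c * measure M A" by (simp add: sums_def)
  moreover have "(\<Sum>i<n. c * measure M (D i)) \<le> B" for n
  proof -
    have "(\<Sum>i<n. c * measure M (D i)) \<le> (\<Sum>i<n. norm (G (D i)))" by (intro sum_mono D4)
    also have "\<dots> \<le> B" using D(1,2) by (intro B) (auto simp: disjoint_family_on_def)
    finally show ?thesis .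
  qed
  ultimately have "c * measure M A \<le> B" by (intro LIMSEQ_le_const2) auto
  then show False using A(2) by (simp add: c_def)
qed

text \<open>The part of the Hahn decomposition that is used. If it failed, \<open>C\<close> could be
  exhausted by sets on which \<open>\<nu>\<close> is at most 0, and countable additivity would give
  \<open>\<nu> C \<le> 0\<close>.\<close>

lemma ac_real_measure_hereditarily_nonneg:
  fixes \<nu> :: "'w set \<Rightarrow> real"
  assumes "ac_vector_measure M \<nu>" and C: "C \<in> sets M" "0 < \<nu> C"
  obtains C' where "C' \<in> sets M" "C' \<subseteq> C" "0 < measure M C'" "\<And>D. D \<in> sets M \<Longrightarrow> D \<subseteq> C' \<Longrightarrow> 0 \<le> \<nu> D"
proof (rule ccontr)
  interpret ac_vector_measure M \<nu> by fact
  assume no: "\<not> thesis"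
  note found = that
  have step: "\<exists>D\<in>sets M. D \<subseteq> C' \<and> 0 < measure M D \<and> \<nu> D \<le> 0"
    if C': "C' \<in> sets M" "C' \<subseteq> C" "0 < measure M C'" for C'
  proof -
    obtain D where D: "D \<in> sets M" "D \<subseteq> C'" "\<nu> D < 0"
      using found[OF C'] no by (meson not_le)
    then have "measure M D \<noteq> 0" using null[of D] by auto
    then have "0 < measure M D" using measure_nonneg[of M D] by linarith
    then show ?thesis using D by (intro bexI[of _ D]) auto
  qed
  obtain D where D: "\<And>i. D i \<in> sets M" "disjoint_family D" "\<And>i. D i \<subseteq> C"
    "\<And>i::nat. D i = {} \<or> 0 < measure M (D i) \<and> \<nu> (D i) \<le> 0"
    "measure M (C - (\<Union>i. D i)) = 0"
    using exhaustion[OF C(1) step] by blast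
  have "\<nu> (D i) \<le> 0" for i using D(4)[of i] empty by auto
  moreover have "(\<lambda>i. \<nu> (D i)) sums \<nu> C" by (intro sums_exhaustion C D)
  ultimately have "\<nu> C \<le> 0" using sums_le[of "\<lambda>i. \<nu> (D i)" "\<lambda>_. 0" "\<nu> C" 0] by auto
  with C(2) show False by simp
qed

text \<open>The number \<open>\<kappa>\<close> plays the role of the essential supremum of the
  density on \<open>C\<close>: the supremum of all \<open>r\<close> with
  \<open>\<nu> \<ge> r * measure M\<close> hereditarily on some part of positive measure. A part
  belonging to a nearly maximal \<open>r\<close> gives the lower estimate. A violation of the upper
  one would, after a shift, yield a part that belongs to \<open>Sup S + \<rho>\<close>.\<close>

lemma ac_real_measure_density_oscillation:
  fixes \<nu> :: "'w set \<Rightarrow> real"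
  assumes "ac_vector_measure M \<nu>" and C: "C \<in> sets M" "0 < measure M C"
    and bound: "\<And>D. D \<in> sets M \<Longrightarrow> D \<subseteq> C \<Longrightarrow> \<bar>\<nu> D\<bar> \<le> b * measure M D" and "0 < \<rho>"
  obtains C' \<kappa> where "C' \<in> sets M" "C' \<subseteq> C" "0 < measure M C'"
    "\<And>D. D \<in> sets M \<Longrightarrow> D \<subseteq> C' \<Longrightarrow> \<bar>\<nu> D - \<kappa> * measure M D\<bar> \<le> \<rho> * measure M D"
proof -
  interpret ac_vector_measure M \<nu> by fact
  define S where "S = {r. \<exists>C'\<in>sets M. C' \<subseteq> C \<and> 0 < measure M C' \<and>
    (\<forall>D\<in>sets M. D \<subseteq> C' \<longrightarrow> r * measure M D \<le> \<nu> D)}"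
  have SI: "r \<in> S" if "C' \<in> sets M" "C' \<subseteq> C" "0 < measure M C'"
    "\<forall>D\<in>sets M. D \<subseteq> C' \<longrightarrow> r * measure M D \<le> \<nu> D" for r C'
    using that unfolding S_def by blast
  have "- b \<in> S"
    unfolding S_def using C bound by (fastforce intro!: bexI[of _ C] simp: abs_le_iff)
  then have ne: "S \<noteq> {}" by blast
  have "r \<le> b" if rS: "r \<in> S" for r
  proof -
    obtain C' where C': "C' \<in> sets M" "C' \<subseteq> C" "0 < measure M C'"
      and r: "\<forall>D\<in>sets M. D \<subseteq> C' \<longrightarrow> r * measure M D \<le> \<nu> D"
      using rS by (auto simp: S_def)
    from r C'(1) have "r * measure M C' \<le> \<nu> C'" by simp
    then have "r * measure M C' \<le> b * measure M C'" using bound[OF C'(1,2)] by linarith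
    with C'(3) show ?thesis by simp
  qed
  then have bdd: "bdd_above S" by (auto simp: bdd_above_def)
  have "Sup S - \<rho> < Sup S" using \<open>0 < \<rho>\<close> by simp
  then obtain r where r: "r \<in> S" "Sup S - \<rho> < r" using less_cSup_iff[OF ne bdd] by blast
  then obtain C' where C': "C' \<in> sets M" "C' \<subseteq> C" "0 < measure M C'"
    and low: "\<And>D. D \<in> sets M \<Longrightarrow> D \<subseteq> C' \<Longrightarrow> r * measure M D \<le> \<nu> D"
    by (auto simp: S_def)
  have "\<bar>\<nu> D - Sup S * measure M D\<bar> \<le> \<rho> * measure M D" if D: "D \<in> sets M" "D \<subseteq> C'" for D
  proof -
    have "\<nu> D \<le> (Sup S + \<rho>) * measure M D"
    proof (rule ccontr)
      assume neg: "\<not> ?thesis"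
      have am: "ac_vector_measure M (\<lambda>A. \<nu> A + measure M A *\<^sub>R - (Sup S + \<rho>))" by (rule add_density)
      obtain F where F: "F \<in> sets M" "F \<subseteq> D" "0 < measure M F"
        "\<And>E. E \<in> sets M \<Longrightarrow> E \<subseteq> F \<Longrightarrow> 0 \<le> \<nu> E + measure M E *\<^sub>R - (Sup S + \<rho>)"
        using ac_real_measure_hereditarily_nonneg[OF am D(1)] neg by (auto simp: algebra_simps)
      have "F \<subseteq> C" using F D C' by blast
      moreover have "\<forall>E\<in>sets M. E \<subseteq> F \<longrightarrow> (Sup S + \<rho>) * measure M E \<le> \<nu> E"
        using F(4) by (auto simp: algebra_simps)
      ultimately have "Sup S + \<rho> \<in> S" using F(1,3) by (intro SI)
      then show False using cSup_upper[OF _ bdd] \<open>0 < \<rho>\<close> by fastforce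
    qed
    moreover have "(Sup S - \<rho>) * measure M D \<le> r * measure M D"
      using r(2) by (intro mult_right_mono) auto
    ultimately show ?thesis using low[OF D] by (simp add: abs_le_iff algebra_simps)
  qed
  with C' show thesis by (rule that)
qed

text \<open>Repeated halving produces pieces of measure at most \<open>\<eta> / 2\<close>
  everywhere, and these exhaust \<open>Z\<close>. The first partial union to reach
  \<open>\<eta> / 2\<close> exceeds it by at most one piece.\<close>

lemma (in finite_measure) atomless_subset:
  assumes atomless: "\<And>C. C \<in> sets M \<Longrightarrow> C \<subseteq> A \<Longrightarrow> 0 < measure M C \<Longrightarrow>
      \<exists>D\<in>sets M. D \<subseteq> C \<and> 0 < measure M D \<and> measure M D < measure M C"
    and Z: "Z \<in> sets M" "Z \<subseteq> A" and \<eta>: "0 < \<eta>" "\<eta> \<le> measure M Z"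
  obtains Z' where "Z' \<in> sets M" "Z' \<subseteq> Z" "\<eta> / 2 \<le> measure M Z'" "measure M Z' \<le> \<eta>"
proof -
  have half: "\<exists>D\<in>sets M. D \<subseteq> C \<and> 0 < measure M D \<and> measure M D \<le> measure M C / 2"
    if C: "C \<in> sets M" "C \<subseteq> A" "0 < measure M C" for C
  proof -
    obtain D where D: "D \<in> sets M" "D \<subseteq> C" "0 < measure M D" "measure M D < measure M C"
      using atomless[OF C] by blast
    have "measure M (C - D) = measure M C - measure M D" using finite_measure_Diff C D by blast
    then show ?thesis using D C
      by (cases "measure M D \<le> measure M C / 2") (auto intro: bexI[of _ D] bexI[of _ "C - D"])
  qed
  have small: "\<exists>D\<in>sets M. D \<subseteq> C \<and> 0 < measure M D \<and> measure M D \<le> measure M C / 2 ^ n"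
    if C: "C \<in> sets M" "C \<subseteq> A" "0 < measure M C" for C n
  proof (induction n)
    case 0
    then show ?case using C by auto
  next
    case (Suc n)
    then obtain D where D: "D \<in> sets M" "D \<subseteq> C" "0 < measure M D" "measure M D \<le> measure M C / 2 ^ n" by blast
    then obtain D' where "D' \<in> sets M" "D' \<subseteq> D" "0 < measure M D'" "measure M D' \<le> measure M D / 2"
      using half[of D] C by blast
    moreover from this(4) D(4) have "measure M D' \<le> measure M C / 2 ^ Suc n" by simp
    ultimately show ?case using D by blast
  qed
  have step: "\<exists>D\<in>sets M. D \<subseteq> C \<and> 0 < measure M D \<and> measure M D \<le> \<eta> / 2"
    if C: "C \<in> sets M" "C \<subseteq> Z" "0 < measure M C" for C
  proof -
    obtain n where "measure M C / (\<eta> / 2) < 2 ^ n" using real_arch_pow[of 2 "measure M C / (\<eta> / 2)"] by auto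
    then have "measure M C / 2 ^ n \<le> \<eta> / 2" using \<eta>(1) by (simp add: field_simps)
    then show ?thesis using small[of C n] C Z by (meson order_trans)
  qed
  obtain D where D: "\<And>i. D i \<in> sets M" "disjoint_family D" "\<And>i. D i \<subseteq> Z"
    "\<And>i::nat. D i = {} \<or> 0 < measure M (D i) \<and> measure M (D i) \<le> \<eta> / 2"
    "measure M (Z - (\<Union>i. D i)) = 0"
    using exhaustion[OF Z(1) step] by blast
  have D4: "measure M (D i) \<le> \<eta> / 2" for i using D(4)[of i] \<eta>(1) by auto
  interpret m: ac_vector_measure M "measure M" by (rule ac_vector_measure_measure)
  have sum_eq: "measure M (\<Union>i<n. D i) = (\<Sum>i<n. measure M (D i))" for n
    using D(1,2) by (intro m.UN_finite) (auto simp: disjoint_family_on_def)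
  have "(\<lambda>i. measure M (D i)) sums measure M Z" by (intro m.sums_exhaustion Z D)
  then have lim: "(\<lambda>n. \<Sum>i<n. measure M (D i)) \<longlonglongrightarrow> measure M Z" by (simp add: sums_def)
  have "\<eta> / 2 < measure M Z" using \<eta> by simp
  from order_tendstoD(1)[OF lim this] have "\<exists>n. \<eta> / 2 \<le> (\<Sum>i<n. measure M (D i))"
    unfolding eventually_sequentially by (meson less_imp_le order_refl)
  define n where "n = (LEAST n. \<eta> / 2 \<le> (\<Sum>i<n. measure M (D i)))"
  have n: "\<eta> / 2 \<le> (\<Sum>i<n. measure M (D i))"
    unfolding n_def using \<open>\<exists>n. _\<close> by (rule LeastI_ex)
  then have "n \<noteq> 0" using \<eta>(1) by (intro notI) simp
  then obtain m where m: "n = Suc m" by (cases n) auto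
  then have "\<not> \<eta> / 2 \<le> (\<Sum>i<m. measure M (D i))" unfolding n_def by (intro not_less_Least) simp
  then have "(\<Sum>i<n. measure M (D i)) \<le> \<eta>" using D4[of m] m by simp
  with n D sum_eq[of n] show thesis by (intro that[of "\<Union>i<n. D i"]) auto
qed

text \<open>The negation of the near-constancy in \<open>ac_vector_measure_density\<close>. For
  measures that vanish on null sets the strict inequality forces \<open>D\<close> to have positive
  measure.\<close>

definition oscillates :: "'w measure \<Rightarrow> ('w set \<Rightarrow> 'x::real_normed_vector) \<Rightarrow> real \<Rightarrow> 'w set \<Rightarrow> bool" where
  "oscillates M G \<epsilon> C \<longleftrightarrow>
    (\<forall>x. \<exists>D\<in>sets M. D \<subseteq> C \<and> \<epsilon> * measure M D < norm (G D - measure M D *\<^sub>R x))"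

lemma oscillatesE:
  assumes "oscillates M G \<epsilon> C"
  obtains D where "D \<in> sets M" "D \<subseteq> C" "\<epsilon> * measure M D < norm (G D - measure M D *\<^sub>R x)"
  using assms unfolding oscillates_def by blast

text \<open>Subtracting \<open>\<phi> \<circ> G\<close> in a fixed direction and adding the scalar measure normalises \<open>\<phi> \<circ> G\<close> to
  the scalar measure; a set on which the density of \<open>\<phi> \<circ> G\<close> oscillates little shows that this
  does not create a density for \<open>G\<close>.\<close>

lemma (in ac_vector_measure) normalise_functional:
  assumes C: "C \<in> sets M" "0 < measure M C" and "0 < \<epsilon>"
    and bound: "\<And>D. D \<in> sets M \<Longrightarrow> D \<subseteq> C \<Longrightarrow> norm (G D) \<le> c * measure M D"
    and osc: "\<And>C'. C' \<in> sets M \<Longrightarrow> C' \<subseteq> C \<Longrightarrow> 0 < measure M C' \<Longrightarrow> oscillates M G \<epsilon> C'"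
  shows "\<exists>(H :: 'w set \<Rightarrow> 'x) \<phi> c'. ac_vector_measure M H \<and> bounded_linear \<phi> \<and>
    (\<forall>D\<in>sets M. \<phi> (H D) = measure M D) \<and>
    (\<forall>D\<in>sets M. D \<subseteq> C \<longrightarrow> norm (H D) \<le> c' * measure M D) \<and>
    (\<forall>C'\<in>sets M. C' \<subseteq> C \<longrightarrow> 0 < measure M C' \<longrightarrow>
      (\<exists>C''\<in>sets M. C'' \<subseteq> C' \<and> 0 < measure M C'' \<and> oscillates M H (\<epsilon> / 2) C''))"
proof -
  obtain D0 where "D0 \<in> sets M" "\<epsilon> * measure M D0 < norm (G D0)"
    using oscillatesE[OF osc[OF C(1) order_refl C(2)], of 0] by auto
  then have "0 < norm (G D0)" using \<open>0 < \<epsilon>\<close> by (smt (verit) measure_nonneg mult_nonneg_nonneg)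
  then have "G D0 \<noteq> 0" by simp
  obtain \<phi> where \<phi>: "bounded_linear \<phi>" "\<phi> (G D0) = norm (G D0)" "\<And>x. \<bar>\<phi> x\<bar> \<le> norm x"
    using Hahn_Banach_norm[of "G D0"] by blast
  interpret \<phi>: bounded_linear \<phi> by fact
  define e where "e = G D0 /\<^sub>R norm (G D0)"
  have e: "\<phi> e = 1" "norm e = 1" using \<phi>(2) \<open>G D0 \<noteq> 0\<close> by (auto simp: e_def \<phi>.scaleR)
  define H where "H D = (G D + (- \<phi> (G D)) *\<^sub>R e) + measure M D *\<^sub>R e" for D
  have lin: "bounded_linear (\<lambda>x. (- \<phi> x) *\<^sub>R e)"
    by (intro bounded_linear_scaleR_const bounded_linear_minus \<phi>(1))
  have acH: "ac_vector_measure M H"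
    unfolding H_def[abs_def]
    by (intro ac_vector_measure.add_density ac_vector_measure_add ac_vector_measure_axioms
        bounded_linear_image[OF lin])
  have \<phi>H: "\<phi> (H D) = measure M D" for D
    by (simp add: H_def \<phi>.add \<phi>.diff \<phi>.scaleR e(1))
  have bH: "norm (H D) \<le> (2 * c + 1) * measure M D" if "D \<in> sets M" "D \<subseteq> C" for D
  proof -
    have "norm (H D) \<le> norm (G D) + \<bar>\<phi> (G D)\<bar> + measure M D"
      unfolding H_def using norm_triangle_ineq[of "G D + (- \<phi> (G D)) *\<^sub>R e" "measure M D *\<^sub>R e"]
        norm_triangle_ineq[of "G D" "(- \<phi> (G D)) *\<^sub>R e"] e(2) by simp
    then show ?thesis using bound[OF that] \<phi>(3)[of "G D"] by (simp add: algebra_simps)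
  qed
  have ac\<nu>: "ac_vector_measure M (\<lambda>D. \<phi> (G D))" by (rule bounded_linear_image[OF \<phi>(1)])
  have "\<exists>C''\<in>sets M. C'' \<subseteq> C' \<and> 0 < measure M C'' \<and> oscillates M H (\<epsilon> / 2) C''"
    if C': "C' \<in> sets M" "C' \<subseteq> C" "0 < measure M C'" for C'
  proof -
    have "\<bar>\<phi> (G D)\<bar> \<le> c * measure M D" if "D \<in> sets M" "D \<subseteq> C'" for D
      using bound[of D] \<phi>(3)[of "G D"] that C' by force
    then obtain C'' \<kappa> where C'': "C'' \<in> sets M" "C'' \<subseteq> C'" "0 < measure M C''"
      and \<kappa>: "\<And>D. D \<in> sets M \<Longrightarrow> D \<subseteq> C'' \<Longrightarrow> \<bar>\<phi> (G D) - \<kappa> * measure M D\<bar> \<le> \<epsilon> / 2 * measure M D"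
      using ac_real_measure_density_oscillation[OF ac\<nu> C'(1,3), of c "\<epsilon> / 2"] half_gt_zero[OF \<open>0 < \<epsilon>\<close>] by blast
    have "\<exists>D\<in>sets M. D \<subseteq> C'' \<and> \<epsilon> / 2 * measure M D < norm (H D - measure M D *\<^sub>R x)" for x
    proof -
      \<comment> \<open>The test vector is shifted so that passing from \<open>G\<close> to
        \<open>H\<close> leaves only the error \<open>\<phi> (G D) - \<kappa> * measure M D\<close>
        in direction \<open>e\<close>. It consumes at most half of the oscillation.\<close>
      obtain D where D: "D \<in> sets M" "D \<subseteq> C''" "\<epsilon> * measure M D < norm (G D - measure M D *\<^sub>R (x + \<kappa> *\<^sub>R e - e))"
        using oscillatesE[OF osc[OF C''(1) order_trans[OF C''(2) C'(2)] C''(3)]] by blast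
      have "G D - measure M D *\<^sub>R (x + \<kappa> *\<^sub>R e - e) = (H D - measure M D *\<^sub>R x) + (\<phi> (G D) - \<kappa> * measure M D) *\<^sub>R e"
        by (simp add: H_def algebra_simps)
      then have "norm (G D - measure M D *\<^sub>R (x + \<kappa> *\<^sub>R e - e)) \<le> norm (H D - measure M D *\<^sub>R x) + \<bar>\<phi> (G D) - \<kappa> * measure M D\<bar>"
        using norm_triangle_ineq[of "H D - measure M D *\<^sub>R x" "(\<phi> (G D) - \<kappa> * measure M D) *\<^sub>R e"] e(2) by simp
      with D(3) \<kappa>[OF D(1,2)] have "\<epsilon> / 2 * measure M D < norm (H D - measure M D *\<^sub>R x)"
        by (simp add: field_simps)
      with D show ?thesis by blast
    qed
    then have "oscillates M H (\<epsilon> / 2) C''" by (simp add: oscillates_def)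
    with C'' show ?thesis by blast
  qed
  then show ?thesis
    by (intro exI[of _ H] exI[of _ \<phi>] exI[of _ "2 * c + 1"] conjI ballI impI acH \<phi>(1) \<phi>H bH)
qed

text \<open>Here \<open>a\<close>, \<open>b\<close> are the measures of two parts and
  \<open>t\<close>, \<open>t'\<close> the values of a real measure on them, with densities at least
  \<open>2 * \<epsilon>\<close> and at most \<open>\<epsilon>\<close>. The right-hand side equals
  \<open>(b * t - a * t') / (a + b)\<close>, which is at least
  \<open>\<epsilon> * (a * b) / (a + b)\<close>. Since \<open>a\<close> and \<open>b\<close> differ
  by at most a factor 2, \<open>a * b\<close> is at least a ninth of
  \<open>(a + b)\<^sup>2\<close>.\<close>

lemma balanced_split_estimate:
  fixes a b t t' \<epsilon> \<eta> :: real
  assumes "0 < \<eta>" "\<eta> / 2 \<le> a" "a \<le> \<eta>" "\<eta> / 2 \<le> b" "b \<le> \<eta>" "0 < \<epsilon>" "2 * \<epsilon> * a \<le> t" "t' \<le> \<epsilon> * b"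
  shows "\<epsilon> / 9 * (a + b) \<le> t - a / (a + b) * (t + t')"
proof -
  have s: "0 < a + b" using assms by linarith
  have "t - a / (a + b) * (t + t') = (b * t - a * t') / (a + b)" using s by (simp add: field_simps)
  moreover have "b * (2 * \<epsilon> * a) \<le> b * t" using assms by (intro mult_left_mono) auto
  moreover have "a * t' \<le> a * (\<epsilon> * b)" using assms by (intro mult_left_mono) auto
  ultimately have "\<epsilon> * (a * b) / (a + b) \<le> t - a / (a + b) * (t + t')"
    using s by (simp add: divide_right_mono mult.assoc mult.left_commute mult.commute)
  moreover have "\<epsilon> / 9 * (a + b) \<le> \<epsilon> * (a * b) / (a + b)"
  proof -
    have "(a + b)\<^sup>2 \<le> 9 * (a * b)"
    proof -
      have "0 \<le> (2 * a - b) * (2 * b - a)" using assms by (intro mult_nonneg_nonneg) auto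
      moreover have "0 \<le> a * b" using assms by (intro mult_nonneg_nonneg) auto
      ultimately show ?thesis by (simp add: power2_eq_square algebra_simps)
    qed
    then have "\<epsilon> * (a + b)\<^sup>2 \<le> \<epsilon> * (9 * (a * b))" using assms by (intro mult_left_mono) auto
    then show ?thesis using s by (simp add: field_simps power2_eq_square)
  qed
  ultimately show ?thesis by linarith
qed

text \<open>A functional norming the oscillation separates two sets hereditarily; since the measure has no
  atoms there, they can be shrunk to comparable measures.\<close>

lemma (in ac_vector_measure) balanced_split:
  assumes C: "C \<in> sets M" "0 < measure M C" and "0 < \<epsilon>"
    and osc0: "\<And>C' x. C' \<in> sets M \<Longrightarrow> C' \<subseteq> C \<Longrightarrow> 0 < measure M C' \<Longrightarrow>
      \<exists>D\<in>sets M. D \<subseteq> C' \<and> 0 < measure M D \<and> measure M D < measure M C'"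
    and osc: "oscillates M G \<epsilon> C"
  shows "\<exists>E\<in>sets M. E \<subseteq> C \<and> 0 < measure M E \<and> (\<exists>F\<in>sets M. F \<subseteq> E \<and>
    \<epsilon> / 18 * measure M E \<le> norm (G F - (measure M F / measure M E) *\<^sub>R G E))"
proof -
  \<comment> \<open>With the average over \<open>C\<close> as reference vector,
    \<open>\<theta>\<close> below vanishes on \<open>C\<close>. Hence besides \<open>Z\<close>,
    where its density is at least \<open>\<epsilon>\<close>, there is a part \<open>Y\<close> of
    \<open>C\<close> where its density is at most \<open>\<epsilon> / 2\<close>.\<close>
  define x where "x = G C /\<^sub>R measure M C"
  have xC: "G C = measure M C *\<^sub>R x" using C(2) by (simp add: x_def)
  obtain D where D: "D \<in> sets M" "D \<subseteq> C" "\<epsilon> * measure M D < norm (G D - measure M D *\<^sub>R x)"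
    using oscillatesE[OF osc] by blast
  obtain \<psi> where \<psi>: "bounded_linear \<psi>" "\<psi> (G D - measure M D *\<^sub>R x) = norm (G D - measure M D *\<^sub>R x)"
    "\<And>y. \<bar>\<psi> y\<bar> \<le> norm y" using Hahn_Banach_norm by blast
  interpret \<psi>: bounded_linear \<psi> by fact
  define \<theta> where "\<theta> E = \<psi> (G E) + measure M E *\<^sub>R - \<psi> x" for E
  interpret p: ac_vector_measure M "\<lambda>E. \<psi> (G E)" by (rule bounded_linear_image[OF \<psi>(1)])
  interpret \<theta>: ac_vector_measure M \<theta> unfolding \<theta>_def[abs_def] by (rule p.add_density)
  have \<theta>D: "\<theta> D = norm (G D - measure M D *\<^sub>R x)"
    using \<psi>(2) by (simp add: \<theta>_def \<psi>.diff \<psi>.scaleR)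
  have \<theta>C: "\<theta> C = 0" by (simp add: \<theta>_def xC \<psi>.scaleR)
  have "ac_vector_measure M (\<lambda>E. \<theta> E + measure M E *\<^sub>R - \<epsilon>)" by (rule \<theta>.add_density)
  then obtain Z where Z: "Z \<in> sets M" "Z \<subseteq> D" "0 < measure M Z"
    and hZ: "\<And>E. E \<in> sets M \<Longrightarrow> E \<subseteq> Z \<Longrightarrow> 0 \<le> \<theta> E + measure M E *\<^sub>R - \<epsilon>"
    using ac_real_measure_hereditarily_nonneg[of M "\<lambda>E. \<theta> E + measure M E *\<^sub>R - \<epsilon>" D] D \<theta>D
    by (auto simp: algebra_simps)
  interpret u: ac_vector_measure M "\<lambda>E. - \<theta> E"
    by (rule \<theta>.bounded_linear_image) (intro bounded_linear_minus bounded_linear_ident)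
  have "ac_vector_measure M (\<lambda>E. - \<theta> E + measure M E *\<^sub>R (\<epsilon> / 2))" by (rule u.add_density)
  then obtain Y where Y: "Y \<in> sets M" "Y \<subseteq> C" "0 < measure M Y"
    and hY: "\<And>E. E \<in> sets M \<Longrightarrow> E \<subseteq> Y \<Longrightarrow> 0 \<le> - \<theta> E + measure M E *\<^sub>R (\<epsilon> / 2)"
    using ac_real_measure_hereditarily_nonneg[of M "\<lambda>E. - \<theta> E + measure M E *\<^sub>R (\<epsilon> / 2)" C] C \<theta>C \<open>0 < \<epsilon>\<close>
    by auto
  \<comment> \<open>On the intersection both bounds on the density of \<open>\<theta>\<close> would
    hold at once.\<close>
  have "measure M (Y \<inter> Z) * (\<epsilon> / 2) \<le> 0"
    using hZ[of "Y \<inter> Z"] hY[of "Y \<inter> Z"] Y Z by (simp add: field_simps)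
  then have "measure M (Y \<inter> Z) = 0" using \<open>0 < \<epsilon>\<close> measure_nonneg[of M "Y \<inter> Z"]
    by (simp add: mult_le_0_iff)
  then have mYZ: "measure M (Y - Z) = measure M Y" using finite_measure_Diff'[of Y Z] Y Z by simp
  define \<eta> where "\<eta> = min (measure M (Y - Z)) (measure M Z)"
  have \<eta>: "0 < \<eta>" "\<eta> \<le> measure M (Y - Z)" "\<eta> \<le> measure M Z" using Y Z mYZ by (auto simp: \<eta>_def)
  obtain Z' where Z': "Z' \<in> sets M" "Z' \<subseteq> Z" "\<eta> / 2 \<le> measure M Z'" "measure M Z' \<le> \<eta>"
    using atomless_subset[OF osc0 Z(1) _ \<eta>(1,3)] Z D by blast
  have "Y - Z \<in> sets M" "Y - Z \<subseteq> C" using Y Z by auto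
  then obtain Y' where Y': "Y' \<in> sets M" "Y' \<subseteq> Y - Z" "\<eta> / 2 \<le> measure M Y'" "measure M Y' \<le> \<eta>"
    using atomless_subset[OF osc0 _ _ \<eta>(1,2)] by blast
  define E where "E = Z' \<union> Y'"
  have E: "E \<in> sets M" "E \<subseteq> C" "Z' \<subseteq> E" using Z' Y' Z Y D by (auto simp: E_def)
  have disj: "Z' \<inter> Y' = {}" using Z' Y' by auto
  have mE: "measure M E = measure M Z' + measure M Y'" and \<theta>E: "\<theta> E = \<theta> Z' + \<theta> Y'"
    unfolding E_def using finite_measure_Union[OF Z'(1) Y'(1) disj] \<theta>.additive[OF Z'(1) Y'(1) disj] by auto
  have E0: "0 < measure M E" using mE Z' Y' \<eta>(1) by linarith
  \<comment> \<open>The density bounds are \<open>\<epsilon>\<close> and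
    \<open>\<epsilon> / 2\<close>, so the estimate is applied with \<open>\<epsilon> / 2\<close>;
    this is the origin of the constant 18.\<close>
  have "\<epsilon> / 2 / 9 * (measure M Z' + measure M Y') \<le> \<theta> Z' - measure M Z' / (measure M Z' + measure M Y') * (\<theta> Z' + \<theta> Y')"
    using hZ[OF Z'(1,2)] hY[OF Y'(1)] Z' Y' \<eta>(1) \<open>0 < \<epsilon>\<close>
    by (intro balanced_split_estimate[where \<eta> = \<eta>]) (auto simp: field_simps)
  then have "\<epsilon> / 18 * measure M E \<le> \<theta> Z' - measure M Z' / measure M E * \<theta> E" by (simp add: mE \<theta>E)
  also have "\<dots> = \<psi> (G Z' - (measure M Z' / measure M E) *\<^sub>R G E)"
    using E0 by (simp add: \<theta>_def \<psi>.diff \<psi>.scaleR field_simps)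
  also have "\<dots> \<le> norm (G Z' - (measure M Z' / measure M E) *\<^sub>R G E)" using \<psi>(3) abs_le_D1 by blast
  finally show ?thesis using E E0 Z'(1) by blast
qed

text \<open>Oscillation, bounded averages and absence of atoms are all inherited by subsets of
  positive measure, so one may keep shrinking the set. The averages must be bounded before the
  normalisation, because the density of \<open>\<phi> \<circ> G\<close> is made nearly constant with
  the help of that bound.\<close>

theorem not_radon_nikodym_imp_splitting_measure:
  assumes "\<not> radon_nikodym_property TYPE('w) TYPE('x::banach)"
  obtains M :: "'w measure" and G :: "'w set \<Rightarrow> 'x::banach" and A \<phi> c \<delta>
  where "ac_vector_measure M G" "A \<in> sets M" "0 < measure M A" "bounded_linear \<phi>" "0 < \<delta>"
    "\<And>D. D \<in> sets M \<Longrightarrow> \<phi> (G D) = measure M D"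
    "\<And>D. D \<in> sets M \<Longrightarrow> D \<subseteq> A \<Longrightarrow> norm (G D) \<le> c * measure M D"
    "\<And>C. C \<in> sets M \<Longrightarrow> C \<subseteq> A \<Longrightarrow> 0 < measure M C \<Longrightarrow>
      \<exists>E\<in>sets M. E \<subseteq> C \<and> 0 < measure M E \<and> (\<exists>F\<in>sets M. F \<subseteq> E \<and>
        \<delta> * measure M E \<le> norm (G F - (measure M F / measure M E) *\<^sub>R G E))"
proof -
  obtain M :: "'w measure" and G :: "'w set \<Rightarrow> 'x" where fm: "finite_measure M" and vm: "vector_measure M G"
    and bv: "bounded_variation M G" and ac: "continuous_wrt M G"
    and nd: "\<not> (\<exists>f. \<forall>A\<in>sets M. bochner_integral_is M (\<lambda>z. indicator A z *\<^sub>R f z) (G A))"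
    using assms unfolding radon_nikodym_property_def by blast
  interpret finite_measure M by fact
  have null: "G A = 0" if "A \<in> sets M" "measure M A = 0" for A
  proof (rule ccontr)
    assume "G A \<noteq> 0"
    then have "0 < norm (G A)" by simp
    then obtain d where "d > 0" "\<And>B. B \<in> sets M \<Longrightarrow> measure M B < d \<Longrightarrow> norm (G B) < norm (G A)"
      using ac unfolding continuous_wrt_def by blast
    then show False using that by fastforce
  qed
  have acG: "ac_vector_measure M G" by unfold_locales (use vm null in auto)
  interpret G: ac_vector_measure M G by fact
  have "\<exists>A\<in>sets M. \<exists>e>0. 0 < measure M A \<and> \<not> (\<exists>C\<in>sets M. C \<subseteq> A \<and> 0 < measure M C \<and>
      (\<exists>x. \<forall>D\<in>sets M. D \<subseteq> C \<longrightarrow> norm (G D - measure M D *\<^sub>R x) \<le> e * measure M D))"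
  proof (rule ccontr)
    assume neg: "\<not> ?thesis"
    have "\<exists>f. \<forall>A\<in>sets M. bochner_integral_is M (\<lambda>z. indicator A z *\<^sub>R f z) (G A)"
      by (rule ac_vector_measure_density[OF acG bv]) (use neg in blast)
    with nd show False by blast
  qed
  then obtain A0 \<epsilon> where A0: "A0 \<in> sets M" "0 < measure M A0" "(0::real) < \<epsilon>"
    and neg: "\<not> (\<exists>C\<in>sets M. C \<subseteq> A0 \<and> 0 < measure M C \<and>
      (\<exists>x. \<forall>D\<in>sets M. D \<subseteq> C \<longrightarrow> norm (G D - measure M D *\<^sub>R x) \<le> \<epsilon> * measure M D))"
    by blast
  have osc: "oscillates M G \<epsilon> C" if "C \<in> sets M" "C \<subseteq> A0" "0 < measure M C" for C
  proof (rule ccontr)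
    assume "\<not> ?thesis"
    then obtain x where "\<forall>D\<in>sets M. D \<subseteq> C \<longrightarrow> norm (G D - measure M D *\<^sub>R x) \<le> \<epsilon> * measure M D"
      by (auto simp: oscillates_def not_less)
    with neg that show False by blast
  qed
  obtain A c where A: "A \<in> sets M" "A \<subseteq> A0" "0 < measure M A"
    and bound: "\<And>D. D \<in> sets M \<Longrightarrow> D \<subseteq> A \<Longrightarrow> norm (G D) \<le> c * measure M D"
    using G.hereditarily_bounded[OF bv A0(1,2)] by blast
  have oscA: "oscillates M G \<epsilon> C" if "C \<in> sets M" "C \<subseteq> A" "0 < measure M C" for C
    using osc[of C] that A by blast
  \<comment> \<open>In an atom every \<open>D\<close> is null or of full measure, and in both cases
    \<open>G D\<close> is \<open>measure M D\<close> times the average over the atom. This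
    contradicts oscillation around that average.\<close>
  have atomless: "\<exists>D\<in>sets M. D \<subseteq> C \<and> 0 < measure M D \<and> measure M D < measure M C"
    if C: "C \<in> sets M" "C \<subseteq> A" "0 < measure M C" for C
  proof -
    define x where "x = G C /\<^sub>R measure M C"
    have x: "G C = measure M C *\<^sub>R x" using C by (simp add: x_def)
    obtain D where D: "D \<in> sets M" "D \<subseteq> C" "\<epsilon> * measure M D < norm (G D - measure M D *\<^sub>R x)"
      using oscillatesE[OF oscA[OF C], of x] by blast
    have "0 \<le> \<epsilon> * measure M D" using A0(3) by simp
    then have n0: "G D - measure M D *\<^sub>R x \<noteq> 0" using D(3) by auto
    have "measure M D \<noteq> 0" using n0 null[OF D(1)] by auto
    moreover have "measure M D \<noteq> measure M C"
    proof
      assume eq: "measure M D = measure M C"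
      then have "measure M (C - D) = 0" using finite_measure_Diff C(1) D by simp
      then have "G C = G D" using G.Diff[OF C(1) D(1,2)] null[of "C - D"] C D by simp
      with n0 x eq show False by simp
    qed
    moreover have "measure M D \<le> measure M C" using finite_measure_mono[OF D(2) C(1)] .
    ultimately have "0 < measure M D" "measure M D < measure M C" using measure_nonneg[of M D] by linarith+
    then show ?thesis using D by blast
  qed
  have "\<exists>(H :: 'w set \<Rightarrow> 'x) \<phi> c'. ac_vector_measure M H \<and> bounded_linear \<phi> \<and>
    (\<forall>D\<in>sets M. \<phi> (H D) = measure M D) \<and>
    (\<forall>D\<in>sets M. D \<subseteq> A \<longrightarrow> norm (H D) \<le> c' * measure M D) \<and>
    (\<forall>C'\<in>sets M. C' \<subseteq> A \<longrightarrow> 0 < measure M C' \<longrightarrow>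
      (\<exists>C''\<in>sets M. C'' \<subseteq> C' \<and> 0 < measure M C'' \<and> oscillates M H (\<epsilon> / 2) C''))"
    by (rule G.normalise_functional[OF A(1,3) A0(3) bound oscA])
  then obtain H :: "'w set \<Rightarrow> 'x" and \<phi> c' where H: "ac_vector_measure M H" "bounded_linear \<phi>"
    "\<forall>D\<in>sets M. \<phi> (H D) = measure M D"
    "\<forall>D\<in>sets M. D \<subseteq> A \<longrightarrow> norm (H D) \<le> c' * measure M D"
    and Hosc: "\<forall>C'\<in>sets M. C' \<subseteq> A \<longrightarrow> 0 < measure M C' \<longrightarrow>
      (\<exists>C''\<in>sets M. C'' \<subseteq> C' \<and> 0 < measure M C'' \<and> oscillates M H (\<epsilon> / 2) C'')"
    by (elim exE conjE) (rule that)
  \<comment> \<open>The normalisation halves \<open>\<epsilon>\<close>, and the balanced splitting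
    divides it by 18.\<close>
  have "\<exists>E\<in>sets M. E \<subseteq> C \<and> 0 < measure M E \<and> (\<exists>F\<in>sets M. F \<subseteq> E \<and>
      \<epsilon> / 2 / 18 * measure M E \<le> norm (H F - (measure M F / measure M E) *\<^sub>R H E))"
    if C: "C \<in> sets M" "C \<subseteq> A" "0 < measure M C" for C
  proof -
    obtain C' where C': "C' \<in> sets M" "C' \<subseteq> C" "0 < measure M C'"
      "oscillates M H (\<epsilon> / 2) C'"
      using Hosc C by blast
    have at: "\<exists>D\<in>sets M. D \<subseteq> B \<and> 0 < measure M D \<and> measure M D < measure M B"
      if "B \<in> sets M" "B \<subseteq> C'" "0 < measure M B" for B
      using atomless[of B] that C'(2) C(2) by blast
    show ?thesis
      using ac_vector_measure.balanced_split[OF H(1) C'(1,3) half_gt_zero[OF A0(3)] at C'(4)] C'(2)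
      by (blast intro: order_trans)
  qed
  then show thesis
    using H A A0(3) by (intro that[of M H A \<phi> "\<epsilon> / 2 / 18" c']) auto
qed


section \<open>Broken lines\<close>

text \<open>For \<open>0 \<le> l\<close>: the time spent up to time \<open>t\<close> in a segment of
  duration \<open>l\<close> that starts at time 0.\<close>

definition clamp :: "real \<Rightarrow> real \<Rightarrow> real" where
  "clamp l t = max 0 (min l t)"

text \<open>A list of pairs \<open>(l, x)\<close> encodes a broken line which moves in direction \<open>x\<close> for time \<open>l\<close>.\<close>

fun walk :: "(real \<times> 'x::real_vector) list \<Rightarrow> real \<Rightarrow> 'x" where
  "walk [] t = 0"
| "walk ((l, x) # L) t = clamp l t *\<^sub>R x + walk L (t - l)"

fun len :: "(real \<times> 'x) list \<Rightarrow> real" where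
  "len [] = 0"
| "len ((l, x) # L) = l + len L"

fun disp :: "(real \<times> 'x::real_vector) list \<Rightarrow> 'x" where
  "disp [] = 0"
| "disp ((l, x) # L) = l *\<^sub>R x + disp L"

fun len_in :: "'x set \<Rightarrow> (real \<times> 'x) list \<Rightarrow> real" where
  "len_in P [] = 0"
| "len_in P ((l, x) # L) = (if x \<in> P then l else 0) + len_in P L"

text \<open>Only end points of segments are collected. With nonnegative durations, 0 is a break
  exactly when the line begins with a segment of duration 0.\<close>

fun breaks :: "(real \<times> 'x) list \<Rightarrow> real set" where
  "breaks [] = {}"
| "breaks ((l, x) # L) = insert l ((+) l ` breaks L)"

definition broken_line :: "'x set \<Rightarrow> (real \<times> 'x) list \<Rightarrow> bool" where
  "broken_line K L \<longleftrightarrow> (\<forall>(l, x)\<in>set L. 0 \<le> l \<and> x \<in> K)"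

definition scale :: "real \<Rightarrow> (real \<times> 'x) list \<Rightarrow> (real \<times> 'x) list" where
  "scale r L = map (\<lambda>(l, x). (r * l, x)) L"

definition refine :: "('x \<Rightarrow> (real \<times> 'x) list) \<Rightarrow> (real \<times> 'x) list \<Rightarrow> (real \<times> 'x) list" where
  "refine \<rho> L = concat (map (\<lambda>(l, x). scale l (\<rho> x)) L)"

lemma broken_line_simps [simp]:
  "broken_line K []"
  "broken_line K ((l, x) # L) \<longleftrightarrow> 0 \<le> l \<and> x \<in> K \<and> broken_line K L"
  "broken_line K (A @ B) \<longleftrightarrow> broken_line K A \<and> broken_line K B"
  by (auto simp: broken_line_def)

lemma len_append [simp]:
  "len (A @ B) = len A + len B"
  "len_in P (A @ B) = len_in P A + len_in P B"
  by (induction A) auto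

lemma walk_append [simp]:
  "disp (A @ B) = disp A + disp B"
  "walk (A @ B) t = walk A t + walk B (t - len A)"
  by (induction A arbitrary: t) (auto simp: algebra_simps)

lemma refine_simps [simp]:
  "refine \<rho> [] = []" "refine \<rho> ((l, x) # L) = scale l (\<rho> x) @ refine \<rho> L"
  by (simp_all add: refine_def)

lemma len_nonneg: "broken_line K L \<Longrightarrow> 0 \<le> len L"
  by (induction L rule: len.induct) auto

lemma walk_nonpos: "broken_line K L \<Longrightarrow> t \<le> 0 \<Longrightarrow> walk L t = 0"
  by (induction L t rule: walk.induct) (auto simp: clamp_def)

lemma walk_end: "broken_line K L \<Longrightarrow> len L \<le> t \<Longrightarrow> walk L t = disp L"
proof (induction L t rule: walk.induct)
  case (2 l x L t)
  then show ?case using len_nonneg[of K L] by (auto simp: clamp_def)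
qed auto

lemma scale_simps [simp]:
  "scale r [] = []" "scale r ((l, x) # L) = (r * l, x) # scale r L"
  by (simp_all add: scale_def)

lemma len_scale [simp]:
  "len (scale r L) = r * len L"
  "len_in P (scale r L) = r * len_in P L"
  by (induction L) (auto simp: algebra_simps)

lemma disp_scale [simp]: "disp (scale r L) = r *\<^sub>R disp L"
  by (induction L) (auto simp: algebra_simps)

lemma broken_line_scale: "broken_line K L \<Longrightarrow> 0 \<le> r \<Longrightarrow> broken_line K (scale r L)"
  by (auto simp: broken_line_def scale_def)

lemma walk_scale: "0 \<le> r \<Longrightarrow> walk (scale r L) (r * t) = r *\<^sub>R walk L t"
proof (induction L t rule: walk.induct)
  case (2 l x L t)
  have "clamp (r * l) (r * t) = r * clamp l t"
    using 2(2) by (simp add: clamp_def max_mult_distrib_left min_mult_distrib_left)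
  moreover have "r * t - r * l = r * (t - l)" by (simp add: algebra_simps)
  ultimately show ?case using 2 by (simp add: algebra_simps)
qed simp

text \<open>All velocities have \<open>\<phi>\<close>-value 1, so \<open>\<phi>\<close> acts as a
  clock along the line. This makes the lines isometric for a metric in which \<open>\<phi>\<close>
  dominates.\<close>

lemma functional_walk:
  assumes "linear \<phi>" "\<And>x. x \<in> K \<Longrightarrow> \<phi> x = (1::real)" "broken_line K L"
  shows "\<phi> (walk L t) = clamp (len L) t"
  using assms(3)
proof (induction L t rule: walk.induct)
  case (1 t)
  then show ?case using linear_0[OF assms(1)] by (simp add: clamp_def)
next
  case (2 l x L t)
  then show ?case using assms(1,2) len_nonneg[of K L]
    by (auto simp: linear_add linear_scale clamp_def)
qed

lemma norm_walk_diff: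
  assumes "\<And>x. x \<in> K \<Longrightarrow> norm (x::'x::real_normed_vector) \<le> c" "broken_line K L" "s \<le> t"
  shows "norm (walk L t - walk L s) \<le> c * (clamp (len L) t - clamp (len L) s)"
  using assms(2,3)
proof (induction L t arbitrary: s rule: walk.induct)
  case (1 t)
  then show ?case by (simp add: clamp_def)
next
  case (2 l x L t)
  have l: "0 \<le> l" "x \<in> K" "0 \<le> len L" using 2 len_nonneg[of K L] by auto
  have cl: "clamp l r + clamp (len L) (r - l) = clamp (l + len L) r" for r
    using l by (auto simp: clamp_def)
  have mono: "clamp l s \<le> clamp l t" using 2(3) by (auto simp: clamp_def)
  have "walk ((l, x) # L) t - walk ((l, x) # L) s = (clamp l t - clamp l s) *\<^sub>R x + (walk L (t - l) - walk L (s - l))"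
    by (simp add: algebra_simps)
  also have "norm \<dots> \<le> (clamp l t - clamp l s) * norm x + norm (walk L (t - l) - walk L (s - l))"
    using mono by (intro order_trans[OF norm_triangle_ineq]) simp
  also have "\<dots> \<le> (clamp l t - clamp l s) * c + c * (clamp (len L) (t - l) - clamp (len L) (s - l))"
    using 2 mono assms(1)[OF l(2)] by (intro add_mono mult_left_mono 2(1)) auto
  also have "\<dots> = c * ((clamp l t + clamp (len L) (t - l)) - (clamp l s + clamp (len L) (s - l)))"
    by (simp add: algebra_simps)
  also have "\<dots> = c * (clamp (l + len L) t - clamp (l + len L) s)" by (simp only: cl)
  finally show ?case by simp
qed

text \<open>Admissible detours: \<open>\<rho> x\<close> takes unit time and has the displacement of
  the straight segment with velocity \<open>x\<close>. Hence \<open>refine \<rho> L\<close> is back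
  on the original line at every break.\<close>

definition unit_lines :: "'x::real_vector set \<Rightarrow> ('x \<Rightarrow> (real \<times> 'x) list) \<Rightarrow> bool" where
  "unit_lines K \<rho> \<longleftrightarrow> (\<forall>x\<in>K. broken_line K (\<rho> x) \<and> len (\<rho> x) = 1 \<and> disp (\<rho> x) = x)"

lemma refine_measures:
  assumes "unit_lines K \<rho>"
    and "broken_line K L"
  shows "broken_line K (refine \<rho> L)" "len (refine \<rho> L) = len L" "disp (refine \<rho> L) = disp L"
  using assms(2)
  using assms(1) by (induction L rule: len.induct) (auto simp: unit_lines_def intro: broken_line_scale)

lemma len_in_refine:
  assumes "\<And>x. x \<in> P \<Longrightarrow> 1 - \<eta> \<le> len_in P (\<rho> x)" "\<And>x. x \<in> K - P \<Longrightarrow> 0 \<le> len_in P (\<rho> x)"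
    and "broken_line K L"
  shows "(1 - \<eta>) * len_in P L \<le> len_in P (refine \<rho> L)"
  using assms(3)
proof (induction L rule: len.induct)
  case (2 l x L)
  show ?case
  proof (cases "x \<in> P")
    case True
    then have "l * (1 - \<eta>) \<le> l * len_in P (\<rho> x)" using 2 assms(1) by (intro mult_left_mono) auto
    then show ?thesis using 2 True by (simp add: algebra_simps)
  next
    case False
    then have "0 \<le> l * len_in P (\<rho> x)" using 2 assms(2) by (intro mult_nonneg_nonneg) auto
    then show ?thesis using 2 False by (simp add: algebra_simps)
  qed
qed simp

lemma len_in_bounds: "broken_line K L \<Longrightarrow> 0 \<le> len_in P L \<and> len_in P L \<le> len L"
  by (induction L rule: len.induct) auto

lemma breaks_eq: "breaks L = (\<lambda>i. len (take i L)) ` {1..length L}"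
proof (induction L rule: len.induct)
  case (2 l x L)
  have "{1..length ((l, x) # L)} = insert 1 (Suc ` {1..length L})"
    by (auto simp: image_iff)
  moreover have "(\<lambda>i. len (take i ((l, x) # L))) ` insert 1 (Suc ` {1..length L}) =
      insert l ((+) l ` (\<lambda>i. len (take i L)) ` {1..length L})"
    by (simp add: image_image del: image_Suc_atLeastAtMost)
  ultimately show ?case using 2 by (simp only: breaks.simps)
qed simp

text \<open>Cutting a segment into two with the same velocity changes only the encoding. Segments of
  duration 0 are allowed, so \<open>t = 0\<close> can become a break too. This makes prescribed
  points of a geodesic immune to refinement.\<close>

lemma insert_break:
  assumes "broken_line K L" "L \<noteq> []" "0 \<le> t" "t \<le> len L"
  shows "\<exists>L'. broken_line K L' \<and> walk L' = walk L \<and> len L' = len L \<and> disp L' = disp L \<and>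
    len_in P L' = len_in P L \<and> insert t (breaks L) \<subseteq> breaks L'"
  using assms
proof (induction L arbitrary: t rule: len.induct)
  case (2 l x L)
  show ?case
  proof (cases "t \<le> l")
    case True
    let ?L = "(t, x) # (l - t, x) # L"
    have c: "clamp t r + clamp (l - t) (r - t) = clamp l r" for r using True 2(4) by (auto simp: clamp_def)
    have "walk ?L r = walk ((l, x) # L) r" for r
      by (simp add: c[of r, symmetric] algebra_simps)
    then show ?thesis using True 2 by (intro exI[of _ ?L]) (auto simp: fun_eq_iff algebra_simps image_iff)
  next
    case False
    then have pr: "broken_line K L" "L \<noteq> []" "0 \<le> t - l" "t - l \<le> len L" using 2(2,5) by auto
    obtain L' where L': "broken_line K L'" "walk L' = walk L" "len L' = len L" "disp L' = disp L"
      "len_in P L' = len_in P L" "insert (t - l) (breaks L) \<subseteq> breaks L'"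
      using 2(1)[OF pr] by blast
    then have "t \<in> (+) l ` breaks L'" by (auto simp: image_iff intro!: bexI[of _ "t - l"])
    then show ?thesis using L' 2 by (intro exI[of _ "(l, x) # L'"]) (auto simp: fun_eq_iff)
  qed
qed simp

lemma insert_breaks:
  assumes "finite F" "broken_line K L" "L \<noteq> []" "F \<subseteq> {0..len L}"
  shows "\<exists>L'. broken_line K L' \<and> walk L' = walk L \<and> len L' = len L \<and> disp L' = disp L \<and>
    len_in P L' = len_in P L \<and> F \<subseteq> breaks L' \<and> L' \<noteq> []"
  using assms(1,4)
proof (induction F rule: finite_induct)
  case empty
  then show ?case using assms by auto
next
  case (insert t F)
  then obtain L' where L': "broken_line K L'" "walk L' = walk L" "len L' = len L" "disp L' = disp L"
    "len_in P L' = len_in P L" "F \<subseteq> breaks L'" "L' \<noteq> []" by auto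
  obtain L'' where L'': "broken_line K L''" "walk L'' = walk L'" "len L'' = len L'" "disp L'' = disp L'"
    "len_in P L'' = len_in P L'" "insert t (breaks L') \<subseteq> breaks L''"
    using insert_break[OF L'(1,7), of t P] insert.prems L'(3) by auto
  then have "L'' \<noteq> []" by auto
  with L' L'' show ?case by (intro exI[of _ L'']) auto
qed

lemma len_in_sum:
  "len_in P L = (\<Sum>i<length L. if snd (L ! i) \<in> P then fst (L ! i) else 0)"
proof (induction L rule: len.induct)
  case (2 l x L)
  then show ?case by (simp add: lessThan_Suc_eq_insert_0 sum.reindex del: sum.lessThan_Suc cong: if_cong)
qed simp

text \<open>Before segment \<open>i\<close> both lines have made the same displacement, and the
  later segments have not begun. What remains is the deviation of the detour, scaled by the duration
  of the segment.\<close>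

lemma walk_refine_deviation:
  assumes \<rho>: "unit_lines K \<rho>"
    and L: "broken_line K L" and i: "i < length L" and \<sigma>: "0 \<le> \<sigma>" "\<sigma> \<le> 1"
  shows "walk (refine \<rho> L) (len (take i L) + fst (L ! i) * \<sigma>) - walk L (len (take i L) + fst (L ! i) * \<sigma>) =
    fst (L ! i) *\<^sub>R (walk (\<rho> (snd (L ! i))) \<sigma> - \<sigma> *\<^sub>R snd (L ! i))"
proof -
  obtain l x where lx: "L ! i = (l, x)" by fastforce
  define A B where "A = take i L" and "B = drop (Suc i) L"
  have L_eq: "L = A @ (l, x) # B" using id_take_nth_drop[OF i] lx by (simp add: A_def B_def)
  have bl: "broken_line K A" "0 \<le> l" "x \<in> K" "broken_line K B" using L unfolding L_eq by auto
  note r = refine_measures[OF \<rho>]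
  have ls: "l * \<sigma> \<le> l" "0 \<le> l * \<sigma>" using \<sigma> bl(2) by (auto simp: mult_left_le)
  have rf: "refine \<rho> L = refine \<rho> A @ scale l (\<rho> x) @ refine \<rho> B"
    unfolding L_eq by (simp add: refine_def)
  have "walk (refine \<rho> L) (len A + l * \<sigma>) = disp A + l *\<^sub>R walk (\<rho> x) \<sigma>"
    unfolding rf using r[OF bl(1)] r(1)[OF bl(4)] \<rho>[unfolded unit_lines_def, rule_format, OF bl(3)] ls walk_end[OF r(1)[OF bl(1)], of "len A + l * \<sigma>"]
      walk_scale[OF bl(2), of "\<rho> x" \<sigma>] walk_nonpos[OF r(1)[OF bl(4)], of "l * \<sigma> - l"] by simp
  moreover have "walk L (len A + l * \<sigma>) = disp A + (l * \<sigma>) *\<^sub>R x"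
    unfolding L_eq using bl ls walk_end[OF bl(1), of "len A + l * \<sigma>"] walk_nonpos[OF bl(4), of "l * \<sigma> - l"]
    by (simp add: clamp_def)
  ultimately show ?thesis by (simp add: lx A_def[symmetric] algebra_simps)
qed

lemma walk_refine_take:
  assumes \<rho>: "unit_lines K \<rho>"
    and L: "broken_line K L"
  shows "walk (refine \<rho> L) (len (take i L)) = disp (take i L)" "walk L (len (take i L)) = disp (take i L)"
proof -
  have bl: "broken_line K (take i L)" "broken_line K (drop i L)"
    using L by (auto simp: broken_line_def dest: in_set_takeD in_set_dropD)
  note r = refine_measures[OF \<rho>]
  have "refine \<rho> L = refine \<rho> (take i L) @ refine \<rho> (drop i L)"
    unfolding refine_def map_append[symmetric] concat_append[symmetric] append_take_drop_id ..
  then show "walk (refine \<rho> L) (len (take i L)) = disp (take i L)"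
    using r[OF bl(1)] r(1)[OF bl(2)] walk_end[OF r(1)[OF bl(1)], of "len (take i L)"]
      walk_nonpos[OF r(1)[OF bl(2)], of 0] by simp
  show "walk L (len (take i L)) = disp (take i L)"
    using walk_append(2)[of "take i L" "drop i L" "len (take i L)"]
      walk_end[OF bl(1), of "len (take i L)"] walk_nonpos[OF bl(2), of 0] by simp
qed

theorem broken_lines_admit_thick_family:
  fixes \<phi> :: "'x::banach \<Rightarrow> real"
  assumes \<phi>: "bounded_linear \<phi>" and K: "\<And>x. x \<in> K \<Longrightarrow> \<phi> x = 1" "\<And>x. x \<in> K \<Longrightarrow> norm x \<le> c" "K \<noteq> {}"
    and P: "P \<subseteq> K" and "0 < \<delta>"
    and conv: "\<And>x \<eta>. x \<in> K \<Longrightarrow> (0::real) < \<eta> \<Longrightarrow>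
      \<exists>S. broken_line K S \<and> len S = 1 \<and> disp S = x \<and> 1 - \<eta> \<le> len_in P S"
    and split: "\<And>x. x \<in> P \<Longrightarrow> \<exists>y\<in>K. \<exists>z\<in>K. \<exists>\<sigma>. 0 \<le> \<sigma> \<and> \<sigma> \<le> 1 \<and>
      x = \<sigma> *\<^sub>R y + (1 - \<sigma>) *\<^sub>R z \<and> \<delta> \<le> norm (\<sigma> *\<^sub>R y - \<sigma> *\<^sub>R x)"
  shows "admits_thick_family TYPE('x) TYPE('x)"
proof -
  interpret \<phi>: bounded_linear \<phi> by fact
  \<comment> \<open>The detour goes along \<open>y\<close> and then along \<open>z\<close>, each
    replaced by a line that is almost entirely in \<open>P\<close>. At time \<open>\<sigma>\<close>
    it has the displacement \<open>\<sigma> *\<^sub>R y\<close> whatever the replacement, so the gap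
    \<open>\<delta>\<close> persists.\<close>
  have sub: "\<exists>S \<sigma>. broken_line K S \<and> len S = 1 \<and> disp S = x \<and> 0 \<le> \<sigma> \<and> \<sigma> \<le> 1 \<and>
      \<delta> \<le> norm (walk S \<sigma> - \<sigma> *\<^sub>R x) \<and> 1 - \<eta> \<le> len_in P S" if x: "x \<in> P" and \<eta>: "(0::real) < \<eta>" for x \<eta>
  proof -
    obtain y z \<sigma> where yz: "y \<in> K" "z \<in> K" "0 \<le> \<sigma>" "\<sigma> \<le> 1" "x = \<sigma> *\<^sub>R y + (1 - \<sigma>) *\<^sub>R z"
      "\<delta> \<le> norm (\<sigma> *\<^sub>R y - \<sigma> *\<^sub>R x)" using split[OF x] by blast
    obtain Y where Y: "broken_line K Y" "len Y = 1" "disp Y = y" "1 - \<eta> \<le> len_in P Y" using conv[OF yz(1) \<eta>] by blast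
    obtain Z where Z: "broken_line K Z" "len Z = 1" "disp Z = z" "1 - \<eta> \<le> len_in P Z" using conv[OF yz(2) \<eta>] by blast
    let ?S = "scale \<sigma> Y @ scale (1 - \<sigma>) Z"
    have bl: "broken_line K (scale \<sigma> Y)" "broken_line K (scale (1 - \<sigma>) Z)"
      using Y Z yz by (auto intro: broken_line_scale)
    have "walk ?S \<sigma> = \<sigma> *\<^sub>R y" using walk_end[OF bl(1), of \<sigma>] walk_nonpos[OF bl(2), of 0] Y by simp
    moreover have "\<sigma> * (1 - \<eta>) + (1 - \<sigma>) * (1 - \<eta>) \<le> \<sigma> * len_in P Y + (1 - \<sigma>) * len_in P Z"
      using yz Y Z by (intro add_mono mult_left_mono) auto
    ultimately show ?thesis using bl Y Z yz
      by (intro exI[of _ ?S] exI[of _ \<sigma>]) (auto simp: algebra_simps)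
  qed
  obtain y0 where y0: "y0 \<in> K" using K(3) by blast
  have "c > 0" using K(1,2)[OF y0] \<phi>.zero by (smt (verit) norm_le_zero_iff zero_neq_one)
  \<comment> \<open>Lines have speed at most \<open>c\<close>, so with this factor the norm term of
    \<open>d\<close> never exceeds the elapsed time, and \<open>\<phi>\<close> alone determines
    distances along a line.\<close>
  define h where "h = 1 / c"
  have h: "0 < h" using \<open>0 < c\<close> by (simp add: h_def)
  define d where "d x y = max \<bar>\<phi> (x - y)\<bar> (h * norm (x - y))" for x y
  have d_norm: "h * norm (x - y) \<le> d x y" for x y by (simp add: d_def)
  have ms: "Metric_space UNIV d"
  proof
    show "0 \<le> d x y" for x y using d_norm[of x y] h by (smt (verit) mult_nonneg_nonneg norm_ge_zero)
    show "d x y = d y x" for x y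
      using \<phi>.diff[of x y] \<phi>.diff[of y x] by (simp add: d_def norm_minus_commute abs_minus_commute)
    show "(d x y = 0) = (x = y)" for x y
    proof
      assume "d x y = 0"
      then have "h * norm (x - y) \<le> 0" using d_norm[of x y] by simp
      then show "x = y" using h by (simp add: mult_le_0_iff)
    qed (use \<phi>.zero in \<open>simp add: d_def\<close>)
    show "d x z \<le> d x y + d y z" for x y z
    proof -
      have "\<phi> (x - z) = \<phi> (x - y) + \<phi> (y - z)" by (simp flip: \<phi>.add)
      moreover have "h * norm (x - z) \<le> h * norm (x - y) + h * norm (y - z)"
        using norm_triangle_ineq[of "x - y" "y - z"] h by (simp flip: distrib_left)
      ultimately show ?thesis unfolding d_def by linarith
    qed
  qed
  interpret Metric_space UNIV d by (rule ms)
  have geo: "d (walk L s) (walk L t) = \<bar>s - t\<bar>"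
    if L: "broken_line K L" "len L = 1" and st: "s \<in> {0..1}" "t \<in> {0..1}" for L s t
  proof -
    have main: "d (walk L t) (walk L s) = t - s" if "s \<in> {0..1}" "t \<in> {0..1}" "s \<le> t" for s t
    proof -
      have "\<phi> (walk L t - walk L s) = t - s"
        using functional_walk[OF \<phi>.linear K(1) L(1)] that L(2) by (simp add: \<phi>.diff clamp_def)
      moreover have "norm (walk L t - walk L s) \<le> c * (t - s)"
        using norm_walk_diff[OF K(2) L(1) that(3)] that L(2) by (simp add: clamp_def)
      then have "h * norm (walk L t - walk L s) \<le> t - s" using \<open>0 < c\<close> by (simp add: h_def field_simps)
      ultimately show ?thesis using that by (simp add: d_def)
    qed
    show ?thesis
      using main[OF st] main[OF st(2,1)] commute[of "walk L s" "walk L t"] by (cases "s \<le> t") auto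
  qed
  \<comment> \<open>The inequality must be strict to leave room for later losses. Each unit of time
    in \<open>P\<close> contributes at least \<open>h * \<delta>\<close> to the deviation, hence the
    constant \<open>h * \<delta> / 2\<close> below.\<close>
  define T where "T = {walk L | L. broken_line K L \<and> len L = 1 \<and> disp L = y0 \<and> 1/2 < len_in P L}"
  obtain L0 where L0: "broken_line K L0" "len L0 = 1" "disp L0 = y0" "1 - 1/4 \<le> len_in P L0"
    using conv[OF y0, of "1/4"] by auto
  have L0T: "walk L0 \<in> T" using L0 by (auto simp: T_def)
  have end1: "walk L 0 = 0" "walk L 1 = disp L" if "broken_line K L" "len L = 1" for L
    using walk_nonpos[OF that(1), of 0] walk_end[OF that(1), of 1] that(2) by auto
  have duv: "d 0 y0 = 1" using geo[OF L0(1,2), of 0 1] end1[OF L0(1,2)] L0(3) by simp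
  have "thick_family UNIV d 0 y0 T"
    unfolding thick_family_def duv
  proof (intro conjI ballI exI[of _ "h * \<delta> / 2"] allI impI)
    show "0 < h * \<delta> / 2" using h \<open>0 < \<delta>\<close> by simp
    show "uv_geodesic UNIV d 0 y0 g" if "g \<in> T" for g
      using that geo end1 unfolding uv_geodesic_def duv T_def by auto
    fix g n and r :: "nat \<Rightarrow> 'x"
    assume g: "g \<in> T" and r: "\<forall>i\<in>{1..n}. r i \<in> g ` {0..1}"
    obtain L1 where L1: "broken_line K L1" "len L1 = 1" "disp L1 = y0" "1/2 < len_in P L1" "g = walk L1"
      using g by (auto simp: T_def)
    have "\<forall>i. \<exists>t. i \<in> {1..n} \<longrightarrow> t \<in> {0..1} \<and> r i = g t" using r by (metis imageE)
    then obtain t where t: "\<And>i. i \<in> {1..n} \<Longrightarrow> t i \<in> {0..1} \<and> r i = g (t i)" by metis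
    have "L1 \<noteq> []" using L1(2) by auto
    moreover have "t ` {1..n} \<subseteq> {0..len L1}" using t by (simp add: image_subset_iff L1(2))
    ultimately obtain L where L: "broken_line K L" "walk L = g" "len L = 1" "disp L = y0"
      "1/2 < len_in P L" "t ` {1..n} \<subseteq> breaks L" "L \<noteq> []"
      using insert_breaks[OF _ L1(1), of "t ` {1..n}" P] L1 by auto
    \<comment> \<open>Half of the surplus over 1/2: the refinement loses at most
      \<open>\<eta>\<close> of the time in \<open>P\<close> and so keeps more than 1/2.\<close>
    define \<eta> where "\<eta> = (len_in P L - 1/2) / 2"
    have \<eta>: "0 < \<eta>" using L(5) by (simp add: \<eta>_def)
    define Q where "Q x S \<sigma> \<longleftrightarrow> broken_line K S \<and> len S = 1 \<and> disp S = x \<and> 0 \<le> \<sigma> \<and> \<sigma> \<le> 1 \<and>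
      \<delta> \<le> norm (walk S \<sigma> - \<sigma> *\<^sub>R x) \<and> 1 - \<eta> \<le> len_in P S" for x S \<sigma>
    have "\<exists>S \<sigma>. Q x S \<sigma>" if "x \<in> P" for x using sub[OF that \<eta>] by (simp add: Q_def)
    then obtain S \<sigma> where "\<And>x. x \<in> P \<Longrightarrow> Q x (S x) (\<sigma> x)" by metis
    then have S: "x \<in> P \<Longrightarrow> broken_line K (S x) \<and> len (S x) = 1 \<and> disp (S x) = x \<and> 0 \<le> \<sigma> x \<and> \<sigma> x \<le> 1 \<and>
      \<delta> \<le> norm (walk (S x) (\<sigma> x) - \<sigma> x *\<^sub>R x) \<and> 1 - \<eta> \<le> len_in P (S x)" for x
      by (simp add: Q_def)
    \<comment> \<open>Segments outside \<open>P\<close> stay as they are. There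
      \<open>\<sigma>'\<close> is 0, so the comparison point is the start of the segment and the
      deviation is 0.\<close>
    define \<rho> where "\<rho> x = (if x \<in> P then S x else [(1, x)])" for x
    define \<sigma>' where "\<sigma>' x = (if x \<in> P then \<sigma> x else 0)" for x
    have \<rho>: "unit_lines K \<rho>"
      using S by (auto simp: \<rho>_def unit_lines_def)
    have \<sigma>': "0 \<le> \<sigma>' x" "\<sigma>' x \<le> 1" for x using S by (auto simp: \<sigma>'_def)
    define L' where "L' = refine \<rho> L"
    note r' = refine_measures[OF \<rho> L(1), folded L'_def]
    have "(1 - \<eta>) * len_in P L \<le> len_in P L'"
      unfolding L'_def using S by (intro len_in_refine[OF _ _ L(1)]) (auto simp: \<rho>_def)
    moreover have "len_in P L \<le> 1" using len_in_bounds[OF L(1), of P] L(3) by simp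
    then have "\<eta> * len_in P L \<le> \<eta>" using \<eta> by (simp add: mult_left_le)
    then have "1/2 < (1 - \<eta>) * len_in P L" using L(5) \<eta>_def left_diff_distrib[of 1 \<eta> "len_in P L"] by argo
    ultimately have L'T: "walk L' \<in> T" using r' L unfolding T_def by auto
    define m where "m = length L"
    define q where "q i = len (take i L)" for i
    \<comment> \<open>Segments of \<open>L\<close> are numbered from 0 and run from
      \<open>q i\<close> to \<open>q (i + 1)\<close>, so the comparison point of segment
      \<open>i\<close> is \<open>s (i + 1)\<close>. The value at \<open>m + 1\<close> is a dummy at
      the common end point.\<close>
    define s where "s i = (if i = m + 1 then 1 else q (i - 1) + fst (L ! (i - 1)) * \<sigma>' (snd (L ! (i - 1))))" for i
    have step: "q (Suc i) = q i + fst (L ! i)" "0 \<le> fst (L ! i)" "snd (L ! i) \<in> K" if "i < m" for i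
    proof -
      have "L ! i \<in> set L" using that by (simp add: m_def)
      then show "0 \<le> fst (L ! i)" "snd (L ! i) \<in> K" using L(1) by (auto simp: broken_line_def)
      show "q (Suc i) = q i + fst (L ! i)"
        using that by (cases "L ! i") (simp add: q_def m_def take_Suc_conv_app_nth)
    qed
    have qm: "q m = 1" using L(3) by (simp add: q_def m_def)
    have s_eq: "s (Suc i) = q i + fst (L ! i) * \<sigma>' (snd (L ! i))" if "i < m" for i
      using that by (simp add: s_def)
    have s_low: "q i \<le> s (Suc i)" if "i \<le> m" for i
    proof (cases "i = m")
      case True
      then show ?thesis using qm by (simp add: s_def)
    next
      case False
      then show ?thesis using that step(2)[of i] \<sigma>' by (simp add: s_eq)
    qed
    have s_up: "s (Suc i) \<le> q (Suc i)" if "i < m" for i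
      using step[OF that] s_eq[OF that] \<sigma>'(2) by (simp add: mult_left_le)
    have dev: "h * (\<delta> * (if snd (L ! i) \<in> P then fst (L ! i) else 0)) \<le> d (g (s (Suc i))) (walk L' (s (Suc i)))"
      if "i < m" for i
    proof (cases "snd (L ! i) \<in> P")
      case False
      then show ?thesis by (simp add: nonneg)
    next
      case True
      have "walk L' (s (Suc i)) - g (s (Suc i)) = fst (L ! i) *\<^sub>R (walk (\<rho> (snd (L ! i))) (\<sigma>' (snd (L ! i))) - \<sigma>' (snd (L ! i)) *\<^sub>R snd (L ! i))"
        unfolding L'_def s_eq[OF that] L(2)[symmetric] q_def
        using that by (intro walk_refine_deviation[OF \<rho> L(1)] \<sigma>') (auto simp: m_def)
      then have "norm (g (s (Suc i)) - walk L' (s (Suc i))) = fst (L ! i) * norm (walk (S (snd (L ! i))) (\<sigma> (snd (L ! i))) - \<sigma> (snd (L ! i)) *\<^sub>R snd (L ! i))"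
        using True step(2)[OF that] by (subst norm_minus_commute) (simp add: \<rho>_def \<sigma>'_def)
      moreover have "fst (L ! i) * \<delta> \<le> fst (L ! i) * norm (walk (S (snd (L ! i))) (\<sigma> (snd (L ! i))) - \<sigma> (snd (L ! i)) *\<^sub>R snd (L ! i))"
        using S[OF True] step(2)[OF that] by (intro mult_left_mono) auto
      ultimately have "h * (\<delta> * fst (L ! i)) \<le> h * norm (g (s (Suc i)) - walk L' (s (Suc i)))"
        using h by (simp add: mult.commute)
      with True show ?thesis using d_norm[of "g (s (Suc i))" "walk L' (s (Suc i))"] by simp
    qed
    have "h * \<delta> / 2 \<le> h * \<delta> * len_in P L" using h \<open>0 < \<delta>\<close> L(5) by simp
    also have "\<dots> = (\<Sum>i<m. h * (\<delta> * (if snd (L ! i) \<in> P then fst (L ! i) else 0)))"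
      by (simp add: len_in_sum m_def sum_distrib_left mult.assoc)
    also have "\<dots> \<le> (\<Sum>i<m. d (g (s (Suc i))) (walk L' (s (Suc i))))" by (intro sum_mono dev) auto
    also have "\<dots> \<le> (\<Sum>i<Suc m. d (g (s (Suc i))) (walk L' (s (Suc i))))" by (simp add: nonneg)
    also have "\<dots> = (\<Sum>i=1..m+1. d (g (s i)) (walk L' (s i)))"
      by (rule sum.reindex_bij_witness[of _ "\<lambda>i. i - 1" Suc]) auto
    finally have big: "h * \<delta> / 2 \<le> (\<Sum>i=1..m+1. d (g (s i)) (walk L' (s i)))" .
    have neq: "walk L' \<noteq> g"
    proof
      assume "walk L' = g"
      then have "h * \<delta> / 2 \<le> 0" using big by simp
      then show False using h \<open>0 < \<delta>\<close> by (simp add: mult_le_0_iff)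
    qed
    have gq: "g (q i) = walk L' (q i)" for i
      using walk_refine_take[OF \<rho> L(1), of i] unfolding q_def L'_def L(2)[symmetric] by simp
    have tq: "t ` {1..n} \<subseteq> q ` {1..m}" using L(6) unfolding breaks_eq q_def m_def .
    have tr: "\<forall>i\<in>{1..n}. t i \<in> {0..1} \<and> r i = g (t i) \<and> r i = walk L' (t i)"
      using t tq gq by (metis (no_types, lifting) image_iff image_subset_iff)
    have s1: "0 \<le> s 1" "s (m + 1) \<le> 1" using s_low[of 0] by (simp_all add: q_def s_def)
    have sq: "\<forall>i\<in>{1..m}. s i \<le> q i \<and> q i \<le> s (i + 1)"
    proof
      fix i assume "i \<in> {1..m}"
      then obtain j where "i = Suc j" "j < m" by (cases i) auto
      then show "s i \<le> q i \<and> q i \<le> s (i + 1)" using s_up[of j] s_low[of i] by simp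
    qed
    have "\<exists>(m::nat) (q::nat \<Rightarrow> real) (s::nat \<Rightarrow> real). t ` {1..n} \<subseteq> q ` {1..m} \<and> 0 \<le> s 1 \<and> (\<forall>i\<in>{1..m}. s i \<le> q i \<and> q i \<le> s (i + 1)) \<and>
        s (m + 1) \<le> 1 \<and> (\<forall>i\<in>{1..m}. g (q i) = walk L' (q i)) \<and>
        h * \<delta> / 2 \<le> (\<Sum>i = 1..m + 1. d (g (s i)) (walk L' (s i)))"
      by (rule exI[of _ m], rule exI[of _ q], rule exI[of _ s]) (intro conjI tq s1 sq big ballI gq)
    then show "\<exists>g'\<in>T. g' \<noteq> g \<and> (\<exists>t. (\<forall>i\<in>{1..n}. t i \<in> {0..1} \<and> r i = g (t i) \<and> r i = g' (t i)) \<and>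
        (\<exists>(m::nat) (q::nat \<Rightarrow> real) (s::nat \<Rightarrow> real). t ` {1..n} \<subseteq> q ` {1..m} \<and> 0 \<le> s 1 \<and> (\<forall>i\<in>{1..m}. s i \<le> q i \<and> q i \<le> s (i + 1)) \<and>
          s (m + 1) \<le> 1 \<and> (\<forall>i\<in>{1..m}. g (q i) = g' (q i)) \<and> h * \<delta> / 2 \<le> (\<Sum>i = 1..m + 1. d (g (s i)) (g' (s i)))))"
      by (intro bexI[OF _ L'T] conjI[OF neq] exI[of _ t] conjI[OF tr])
  qed
  moreover have "bilipschitz_embedding (\<Union>g\<in>T. g ` {0..d 0 y0}) d id"
  proof -
    obtain B where B: "0 < B" "\<And>x. norm (\<phi> x) \<le> norm x * B" using \<phi>.pos_bounded by blast
    have "1 / (B + h) * d a b \<le> norm (a - b)" "norm (a - b) \<le> 1 / h * d a b" for a b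
    proof -
      have "d a b \<le> (B + h) * norm (a - b)"
        using B(2)[of "a - b"] B(1) h by (auto simp: d_def algebra_simps add_increasing add_increasing2)
      then show "1 / (B + h) * d a b \<le> norm (a - b)" using B(1) h by (simp add: field_simps)
      show "norm (a - b) \<le> 1 / h * d a b" using d_norm[of a b] h by (simp add: field_simps)
    qed
    then show ?thesis unfolding bilipschitz_embedding_def using B(1) h
      by (intro exI[of _ "1 / (B + h)"] exI[of _ "1 / h"]) (auto simp: frac_le)
  qed
  ultimately show ?thesis
    unfolding admits_thick_family_def using ms L0T by blast
qed

theorem not_radon_nikodym_imp_thick_family:
  assumes "\<not> radon_nikodym_property TYPE('w) TYPE('x::banach)"
  shows "admits_thick_family TYPE('x) TYPE('x)"
proof (rule not_radon_nikodym_imp_splitting_measure[OF assms])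
  fix M :: "'w measure" and G :: "'w set \<Rightarrow> 'x" and A \<phi> c \<delta>
  assume ac: "ac_vector_measure M G" and A: "A \<in> sets M" "0 < measure M A" and \<phi>: "bounded_linear \<phi>" and "0 < \<delta>"
    and \<phi>G: "\<And>D. D \<in> sets M \<Longrightarrow> \<phi> (G D) = measure M D"
    and bound: "\<And>D. D \<in> sets M \<Longrightarrow> D \<subseteq> A \<Longrightarrow> norm (G D) \<le> c * measure M D"
    and spl: "\<And>C. C \<in> sets M \<Longrightarrow> C \<subseteq> A \<Longrightarrow> 0 < measure M C \<Longrightarrow>
      \<exists>E\<in>sets M. E \<subseteq> C \<and> 0 < measure M E \<and> (\<exists>F\<in>sets M. F \<subseteq> E \<and>
        \<delta> * measure M E \<le> norm (G F - (measure M F / measure M E) *\<^sub>R G E))"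
  interpret ac_vector_measure M G by fact
  interpret \<phi>: bounded_linear \<phi> by fact
  define avg where "avg C = G C /\<^sub>R measure M C" for C
  define splits where "splits E \<longleftrightarrow> (\<exists>F\<in>sets M. F \<subseteq> E \<and>
    \<delta> * measure M E \<le> norm (G F - (measure M F / measure M E) *\<^sub>R G E))" for E
  define K where "K = avg ` {C \<in> sets M. C \<subseteq> A \<and> 0 < measure M C}"
  define P where "P = avg ` {C \<in> sets M. C \<subseteq> A \<and> 0 < measure M C \<and> splits C}"
  have avg: "measure M C *\<^sub>R avg C = G C" if "0 < measure M C" for C
    using that by (simp add: avg_def)
  have K\<phi>: "\<phi> x = 1" if "x \<in> K" for x
    using that \<phi>G unfolding K_def avg_def by (auto simp: \<phi>.scaleR)
  have Kn: "norm x \<le> c" if "x \<in> K" for x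
    using that bound unfolding K_def avg_def by (auto simp: field_simps)
  have Kne: "K \<noteq> {}" using A unfolding K_def by auto
  have PK: "P \<subseteq> K" unfolding P_def K_def by auto
  show ?thesis
  proof (rule broken_lines_admit_thick_family[OF \<phi> K\<phi> Kn Kne PK \<open>0 < \<delta>\<close>])
    fix x and \<eta> :: real assume x: "x \<in> K" and \<eta>: "0 < \<eta>"
    then obtain C where C: "C \<in> sets M" "C \<subseteq> A" "0 < measure M C" "x = avg C" unfolding K_def by blast
    have step: "\<exists>D\<in>sets M. D \<subseteq> C' \<and> 0 < measure M D \<and> splits D"
      if "C' \<in> sets M" "C' \<subseteq> C" "0 < measure M C'" for C'
      using spl[of C'] that C(2) unfolding splits_def by blast
    obtain D where D: "\<And>i. D i \<in> sets M" "disjoint_family D" "\<And>i. D i \<subseteq> C"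
      "\<And>i::nat. D i = {} \<or> 0 < measure M (D i) \<and> splits (D i)" "measure M (C - (\<Union>i. D i)) = 0"
      using exhaustion[OF C(1) step] by blast
    interpret m: ac_vector_measure M "measure M" by (rule ac_vector_measure_measure)
    have "(\<lambda>i. measure M (D i)) sums measure M C" by (intro m.sums_exhaustion C D)
    then have "(\<lambda>n. \<Sum>i<n. measure M (D i)) \<longlonglongrightarrow> measure M C" by (simp add: sums_def)
    moreover have "(1 - \<eta>) * measure M C < measure M C" using \<eta> C(3) by simp
    ultimately have "eventually (\<lambda>n. (1 - \<eta>) * measure M C < (\<Sum>i<n. measure M (D i))) sequentially"
      by (rule order_tendstoD(1))
    then obtain n where n: "(1 - \<eta>) * measure M C < (\<Sum>i<n. measure M (D i))"
      unfolding eventually_sequentially by blast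
    define R where "R = C - (\<Union>i<n. D i)"
    have Rm: "R \<in> sets M" "R \<subseteq> C" using C(1) D(1) by (auto simp: R_def)
    \<comment> \<open>Null sets need some direction in \<open>K\<close>; their segments have
      duration 0, and \<open>G\<close> vanishes on them, so the default \<open>x\<close> is
      harmless.\<close>
    define dir where "dir E = (if 0 < measure M E then avg E else x)" for E
    have dirG: "measure M E *\<^sub>R dir E = G E" if "E \<in> sets M" for E
    proof (cases "0 < measure M E")
      case False
      then have "measure M E = 0" using measure_nonneg[of M E] by linarith
      then show ?thesis using null[OF that] by simp
    qed (simp add: dir_def avg)
    have frac: "(measure M E / measure M C) *\<^sub>R dir E = G E /\<^sub>R measure M C" if "E \<in> sets M" for E
    proof -
      have "(measure M E / measure M C) *\<^sub>R dir E = (measure M E *\<^sub>R dir E) /\<^sub>R measure M C"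
        by (simp add: divide_inverse mult.commute)
      then show ?thesis by (simp only: dirG[OF that])
    qed
    have dirK: "dir E \<in> K" if "E \<in> sets M" "E \<subseteq> C" for E
      using that x C(2) unfolding dir_def K_def by auto
    define piece where "piece E = (measure M E / measure M C, dir E)" for E
    define S where "S = map (piece \<circ> D) [0..<n] @ [piece R]"
    have len_D: "len (map (piece \<circ> D) [0..<k]) = (\<Sum>i<k. measure M (D i)) / measure M C" for k
      by (induction k) (simp_all add: piece_def add_divide_distrib)
    have disp_D: "disp (map (piece \<circ> D) [0..<k]) = (\<Sum>i<k. G (D i)) /\<^sub>R measure M C" for k
    proof (induction k)
      case (Suc k)
      then show ?case using frac[OF D(1)[of k]] by (simp add: piece_def scaleR_add_right)
    qed simp
    have len_in_D: "(\<Sum>i<k. measure M (D i)) / measure M C \<le> len_in P (map (piece \<circ> D) [0..<k])" for k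
    proof (induction k)
      case (Suc k)
      have "measure M (D k) / measure M C \<le> len_in P [piece (D k)]"
      proof (cases "D k = {}")
        case False
        then have "dir (D k) \<in> P" using D(1,3,4)[of k] C(2) unfolding dir_def P_def by auto
        then show ?thesis by (simp add: piece_def)
      qed (simp add: piece_def)
      then show ?case using Suc by (simp add: add_divide_distrib)
    qed simp
    have dis: "disjoint_family_on D {..<n}" using D(2) by (auto simp: disjoint_family_on_def)
    have Um: "(\<Union>i<n. D i) \<in> sets M" "(\<Union>i<n. D i) \<subseteq> C" using D(1,3) by auto
    have mR: "measure M R = measure M C - (\<Sum>i<n. measure M (D i))"
      unfolding R_def m.Diff[OF C(1) Um] using D(1) dis by (subst m.UN_finite) auto
    have GR: "G R = G C - (\<Sum>i<n. G (D i))"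
      unfolding R_def Diff[OF C(1) Um] using D(1) dis by (subst UN_finite) auto
    have "broken_line K S"
      using dirK D(1,3) Rm by (auto simp: broken_line_def S_def piece_def)
    moreover have "len S = 1"
      using C(3) by (simp add: S_def len_D piece_def mR flip: add_divide_distrib)
    moreover have "disp S = x"
      using frac[OF Rm(1)] by (simp add: S_def disp_D piece_def GR C(4) avg_def flip: scaleR_add_right)
    moreover have "1 - \<eta> \<le> len_in P S"
    proof -
      have "1 - \<eta> \<le> (\<Sum>i<n. measure M (D i)) / measure M C" using n C(3) by (simp add: field_simps)
      also have "\<dots> \<le> len_in P (map (piece \<circ> D) [0..<n])" by (rule len_in_D)
      also have "\<dots> \<le> len_in P S" by (simp add: S_def piece_def)
      finally show ?thesis .
    qed
    ultimately show "\<exists>S. broken_line K S \<and> len S = 1 \<and> disp S = x \<and> 1 - \<eta> \<le> len_in P S" by blast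
  next
    fix x assume "x \<in> P"
    then obtain E where E: "E \<in> sets M" "E \<subseteq> A" "0 < measure M E" "splits E" "x = avg E" unfolding P_def by blast
    then obtain F where F: "F \<in> sets M" "F \<subseteq> E"
      "\<delta> * measure M E \<le> norm (G F - (measure M F / measure M E) *\<^sub>R G E)" unfolding splits_def by blast
    have pos: "0 < \<delta> * measure M E" using \<open>0 < \<delta>\<close> E(3) by simp
    \<comment> \<open>If \<open>F\<close> or \<open>E - F\<close> were null, then \<open>G F\<close>
      would be the fraction \<open>measure M F / measure M E\<close> of \<open>G E\<close>, contrary
      to the gap. So both parts have averages in \<open>K\<close>.\<close>
    have "measure M F \<noteq> 0" using F(3) pos null[OF F(1)] by auto
    then have F0: "0 < measure M F" using measure_nonneg[of M F] by linarith
    have mD: "measure M (E - F) = measure M E - measure M F" using finite_measure_Diff[OF E(1) F(1,2)] .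
    have "measure M (E - F) \<noteq> 0"
    proof
      assume 0: "measure M (E - F) = 0"
      then have "G F = G E" using Diff[OF E(1) F(1,2)] null[of "E - F"] E(1) F(1) by simp
      moreover have "measure M F = measure M E" using 0 mD by simp
      ultimately show False using F(3) pos E(3) by simp
    qed
    then have D0: "0 < measure M (E - F)" using measure_nonneg[of M "E - F"] by linarith
    define \<sigma> where "\<sigma> = measure M F / measure M E"
    have \<sigma>F: "\<sigma> *\<^sub>R avg F = G F /\<^sub>R measure M E" using F0 by (simp add: \<sigma>_def avg_def divide_inverse)
    have "1 - \<sigma> = measure M (E - F) / measure M E" using E(3) by (simp add: \<sigma>_def mD field_simps)
    then have \<sigma>D: "(1 - \<sigma>) *\<^sub>R avg (E - F) = G (E - F) /\<^sub>R measure M E" using D0 by (simp add: avg_def divide_inverse)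
    have "x = \<sigma> *\<^sub>R avg F + (1 - \<sigma>) *\<^sub>R avg (E - F)"
      unfolding \<sigma>F \<sigma>D by (simp add: E(5) avg_def Diff[OF E(1) F(1,2)] flip: scaleR_add_right)
    moreover have "\<delta> \<le> norm (\<sigma> *\<^sub>R avg F - \<sigma> *\<^sub>R x)"
    proof -
      have "\<sigma> *\<^sub>R avg F - \<sigma> *\<^sub>R x = (G F - (measure M F / measure M E) *\<^sub>R G E) /\<^sub>R measure M E"
        unfolding \<sigma>F by (simp add: E(5) avg_def \<sigma>_def scaleR_diff_right mult.commute)
      then have "norm (\<sigma> *\<^sub>R avg F - \<sigma> *\<^sub>R x) = norm (G F - (measure M F / measure M E) *\<^sub>R G E) / measure M E"
        using E(3) by (simp add: divide_inverse mult.commute)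
      then show ?thesis using F(3) by (simp only: pos_le_divide_eq[OF E(3)])
    qed
    moreover have "0 \<le> \<sigma>" "\<sigma> \<le> 1" using finite_measure_mono[OF F(2) E(1)] E(3) by (auto simp: \<sigma>_def)
    moreover have "avg F \<in> K" using F F0 E(2) by (auto simp: K_def)
    moreover have "avg (E - F) \<in> K" using F(1) E(1,2) D0 by (auto simp: K_def)
    ultimately show "\<exists>y\<in>K. \<exists>z\<in>K. \<exists>\<sigma>. 0 \<le> \<sigma> \<and> \<sigma> \<le> 1 \<and>
      x = \<sigma> *\<^sub>R y + (1 - \<sigma>) *\<^sub>R z \<and> \<delta> \<le> norm (\<sigma> *\<^sub>R y - \<sigma> *\<^sub>R x)" by blast
  qed
qed


section \<open>Conditional expectations along interval partitions\<close>

definition ivl :: "real \<times> real \<Rightarrow> real set" where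
  "ivl c = {fst c<..snd c}"

definition cells :: "real set \<Rightarrow> (real \<times> real) set" where
  "cells P = {(a, b). a \<in> P \<and> b \<in> P \<and> a < b \<and> P \<inter> {a<..<b} = {}}"

lemma finite_cells: "finite P \<Longrightarrow> finite (cells P)"
  by (rule finite_subset[of _ "P \<times> P"]) (auto simp: cells_def)

lemma cells_disjoint: "disjoint_family_on ivl (cells P)"
  unfolding disjoint_family_on_def
proof (intro ballI impI)
  fix c d assume c: "c \<in> cells P" and d: "d \<in> cells P" and ne: "c \<noteq> d"
  obtain a b a' b' where eq: "c = (a, b)" "d = (a', b')" by (cases c, cases d)
  have "a < b" "a' < b'" "a' \<notin> {a<..<b}" "b' \<notin> {a<..<b}" "a \<notin> {a'<..<b'}" "b \<notin> {a'<..<b'}"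
    using c d unfolding eq cells_def by auto
  moreover have "a \<noteq> a' \<or> b \<noteq> b'" using ne eq by auto
  ultimately have "b \<le> a' \<or> b' \<le> a" by auto
  then show "ivl c \<inter> ivl d = {}" by (auto simp: ivl_def eq)
qed

text \<open>Telescoping, by induction on the number of points in \<open>{a<..b}\<close>: the last
  cell, from the predecessor of \<open>b\<close> to \<open>b\<close>, is split off.\<close>

lemma sum_cells_additive:
  fixes F :: "real \<Rightarrow> real \<Rightarrow> 'a::ab_group_add"
  assumes P: "finite P" and F: "\<And>a b c. \<lbrakk>a \<in> P; b \<in> P; c \<in> P; a \<le> b; b \<le> c\<rbrakk> \<Longrightarrow> F a c = F a b + F b c"
    and "a \<in> P" "b \<in> P" "a \<le> b"
  shows "(\<Sum>c\<in>{c\<in>cells P. a \<le> fst c \<and> snd c \<le> b}. F (fst c) (snd c)) = F a b"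
  using assms(4,5)
proof (induction "card (P \<inter> {a<..b})" arbitrary: b rule: less_induct)
  case less
  show ?case
  proof (cases "a = b")
    case True
    then have E: "{c\<in>cells P. a \<le> fst c \<and> snd c \<le> b} = {}" by (auto simp: cells_def)
    show ?thesis unfolding E using True F[of a a a] assms(3) by simp
  next
    case False
    define c where "c = Max (P \<inter> {a..<b})"
    have fin: "finite (P \<inter> {a..<b})" and ne: "P \<inter> {a..<b} \<noteq> {}"
      using P assms(3) False less.prems by auto
    have c: "c \<in> P" "a \<le> c" "c < b" using Max_in[OF fin ne] by (auto simp: c_def)
    have gap: "x \<le> c" if "x \<in> P" "x < b" for x
      using that c(2) Max_ge[OF fin, of x] by (cases "a \<le> x") (auto simp: c_def)
    have "b \<in> P \<inter> {a<..b}" "b \<notin> P \<inter> {a<..c}" using c less.prems by auto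
    moreover have "P \<inter> {a<..c} \<subseteq> P \<inter> {a<..b}" using c by auto
    ultimately have "P \<inter> {a<..c} \<subset> P \<inter> {a<..b}" by blast
    then have "card (P \<inter> {a<..c}) < card (P \<inter> {a<..b})" using P by (intro psubset_card_mono) auto
    then have IH: "(\<Sum>c\<in>{d\<in>cells P. a \<le> fst d \<and> snd d \<le> c}. F (fst c) (snd c)) = F a c"
      using less.hyps c by blast
    have eq: "{d\<in>cells P. a \<le> fst d \<and> snd d \<le> b} = insert (c, b) {d\<in>cells P. a \<le> fst d \<and> snd d \<le> c}"
    proof (intro equalityI subsetI)
      fix d assume d: "d \<in> {d\<in>cells P. a \<le> fst d \<and> snd d \<le> b}"
      obtain x y where xy: "d = (x, y)" by (cases d)
      have *: "x \<in> P" "y \<in> P" "x < y" "P \<inter> {x<..<y} = {}" "a \<le> x" "y \<le> b"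
        using d by (auto simp: xy cells_def)
      show "d \<in> insert (c, b) {d\<in>cells P. a \<le> fst d \<and> snd d \<le> c}"
      proof (cases "y = b")
        case True
        have "x \<le> c" using gap * by auto
        moreover have "\<not> x < c" using *(4) c True by auto
        ultimately show ?thesis using True xy by simp
      next
        case False
        then have "y \<le> c" using gap * by auto
        then show ?thesis using d xy by simp
      qed
    next
      fix d assume "d \<in> insert (c, b) {d\<in>cells P. a \<le> fst d \<and> snd d \<le> c}"
      then show "d \<in> {d\<in>cells P. a \<le> fst d \<and> snd d \<le> b}"
        using c less.prems gap by (auto simp: cells_def) force
    qed
    have "(c, b) \<notin> {d\<in>cells P. a \<le> fst d \<and> snd d \<le> c}" using c by auto
    then show ?thesis using IH F[OF assms(3) c(1) less.prems(1) c(2) less_imp_le[OF c(3)]] finite_cells[OF P] by (simp add: eq add.commute)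
  qed
qed

text \<open>Carries setwise convergence over to countable unions, where the partial unions
  approximate uniformly in the index.\<close>

lemma convergent_uniform_approximation:
  fixes x :: "nat \<Rightarrow> 'a::banach"
  assumes "\<And>e. 0 < e \<Longrightarrow> \<exists>y. convergent y \<and> (\<forall>k. norm (x k - y k) \<le> e)"
  shows "convergent x"
proof (rule Cauchy_convergent, rule CauchyI)
  fix e :: real assume "0 < e"
  then obtain y where y: "convergent y" "\<And>k. norm (x k - y k) \<le> e / 4" using assms[of "e / 4"] by auto
  obtain N where N: "\<And>m n. m \<ge> N \<Longrightarrow> n \<ge> N \<Longrightarrow> norm (y m - y n) < e / 4"
    using CauchyD[OF convergent_Cauchy[OF y(1)], of "e / 4"] \<open>0 < e\<close> by auto
  have "norm (x m - x n) < e" if "m \<ge> N" "n \<ge> N" for m n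
  proof -
    have "norm (x m - x n) \<le> norm (x m - y n) + norm (x n - y n)"
      using norm_triangle_ineq4[of "x m - y n" "x n - y n"] by simp
    moreover have "norm (x m - y n) \<le> norm (x m - y m) + norm (y m - y n)"
      using norm_triangle_ineq[of "x m - y m" "y m - y n"] by simp
    ultimately show ?thesis using y(2)[of m] y(2)[of n] N[OF that] \<open>0 < e\<close> by linarith
  qed
  then show "\<exists>N. \<forall>m\<ge>N. \<forall>n\<ge>N. norm (x m - x n) < e" by blast
qed

lemma cell_subset_iff:
  assumes "c \<in> cells P"
  shows "ivl c \<subseteq> {a<..b} \<longleftrightarrow> a \<le> fst c \<and> snd c \<le> b"
proof
  assume sub: "ivl c \<subseteq> {a<..b}"
  have lt: "fst c < snd c" using assms by (auto simp: cells_def)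
  then have "snd c \<in> ivl c" by (simp add: ivl_def)
  moreover have "a \<le> fst c"
  proof (rule ccontr)
    assume "\<not> a \<le> fst c"
    then have "min a (snd c) \<in> ivl c" using lt by (simp add: ivl_def min_def)
    then show False using sub by fastforce
  qed
  ultimately show "a \<le> fst c \<and> snd c \<le> b" using sub by auto
qed (auto simp: ivl_def)

text \<open>The sigma-algebra is generated by the partition intervals and can be much smaller than
  the Borel sets. Precisely because it is generated by them, every integrable function on this space
  is approximated by functions constant on the cells of one partition.\<close>

locale interval_partitions = finite_measure M for M :: "real measure" +
  fixes P :: "nat \<Rightarrow> real set" and D :: real
  assumes finite_P: "finite (P k)" and P_mono: "j \<le> k \<Longrightarrow> P j \<subseteq> P k"
    and P_ends: "0 \<in> P 0" "D \<in> P 0" and P_bounds: "P k \<subseteq> {0..D}"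
    and space_M: "space M = {0<..D}"
    and sets_M: "sets M = sigma_sets {0<..D} {{a<..b} | a b. a \<in> (\<Union>k. P k) \<and> b \<in> (\<Union>k. P k)}"
    and measure_interval: "\<lbrakk>a \<in> P k; b \<in> P k; a \<le> b\<rbrakk> \<Longrightarrow> measure M {a<..b} = b - a"
begin

lemma interval_sets: "a \<in> P k \<Longrightarrow> b \<in> P k \<Longrightarrow> {a<..b} \<in> sets M"
  unfolding sets_M by (intro sigma_sets.Basic) blast

lemma common_index: "a \<in> (\<Union>k. P k) \<Longrightarrow> b \<in> (\<Union>k. P k) \<Longrightarrow> \<exists>k. a \<in> P k \<and> b \<in> P k"
proof -
  assume "a \<in> (\<Union>k. P k)" "b \<in> (\<Union>k. P k)"
  then obtain i j where "a \<in> P i" "b \<in> P j" by blast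
  then show ?thesis using P_mono[of i "max i j"] P_mono[of j "max i j"] by (intro exI[of _ "max i j"]) auto
qed

lemma cells_sets: "c \<in> cells (P k) \<Longrightarrow> ivl c \<in> sets M"
  using interval_sets by (auto simp: cells_def ivl_def)

lemma measure_ivl: "c \<in> cells (P k) \<Longrightarrow> measure M (ivl c) = snd c - fst c"
  using measure_interval by (auto simp: cells_def ivl_def)

lemma cell_pos: "c \<in> cells P' \<Longrightarrow> 0 < snd c - fst c"
  by (auto simp: cells_def)

text \<open>Dynkin's pi-lambda theorem for half-open intervals. As the partitions increase, the two
  end points of a generator belong to a common \<open>P k\<close>.\<close>

lemma sets_induct [consumes 1, case_names interval empty complement union]:
  assumes "A \<in> sets M"
    and "\<And>a b k. a \<in> P k \<Longrightarrow> b \<in> P k \<Longrightarrow> a \<le> b \<Longrightarrow> Q {a<..b}"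
    and "Q {}"
    and "\<And>A. A \<in> sets M \<Longrightarrow> Q A \<Longrightarrow> Q ({0<..D} - A)"
    and "\<And>A::nat \<Rightarrow> real set. disjoint_family A \<Longrightarrow> (\<And>i. A i \<in> sets M) \<Longrightarrow> (\<And>i. Q (A i)) \<Longrightarrow> Q (\<Union>i. A i)"
  shows "Q A"
proof -
  let ?G = "{{a<..b} | a b. a \<in> (\<Union>k. P k) \<and> b \<in> (\<Union>k. P k)}"
  have st: "Int_stable ?G"
  proof (rule Int_stableI)
    fix A B assume "A \<in> ?G" "B \<in> ?G"
    then obtain a b a' b' where "A = {a<..b}" "B = {a'<..b'}" "a \<in> (\<Union>k. P k)" "b \<in> (\<Union>k. P k)"
      "a' \<in> (\<Union>k. P k)" "b' \<in> (\<Union>k. P k)" by blast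
    moreover then have "A \<inter> B = {max a a'<..min b b'}" by auto
    ultimately show "A \<inter> B \<in> ?G" unfolding max_def min_def by auto
  qed
  have closed: "?G \<subseteq> Pow {0<..D}"
  proof
    fix A assume "A \<in> ?G"
    then obtain a b k l where "A = {a<..b}" "a \<in> P k" "b \<in> P l" by blast
    moreover from this have "a \<in> {0..D}" "b \<in> {0..D}" using P_bounds by blast+
    ultimately show "A \<in> Pow {0<..D}" by auto
  qed
  have "A \<in> sigma_sets {0<..D} ?G" using assms(1) by (simp add: sets_M)
  from st closed this show ?thesis
  proof (induction rule: sigma_sets_induct_disjoint)
    case (basic A)
    then obtain a b where ab: "A = {a<..b}" "a \<in> (\<Union>k. P k)" "b \<in> (\<Union>k. P k)" by blast
    then obtain k where "a \<in> P k" "b \<in> P k" using common_index by blast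
    then show ?case using assms(2)[of a k b] assms(3) ab(1) by (cases "a \<le> b") auto
  next
    case empty
    show ?case by fact
  next
    case (compl A)
    then show ?case using assms(4) by (simp add: sets_M)
  next
    case (union A)
    then show ?case using assms(5)[of A] by (auto simp: sets_M)
  qed
qed

text \<open>\<open>proj k \<nu>\<close> replaces \<open>\<nu>\<close> by the set function which has the same values on the cells of the
  \<open>k\<close>-th partition and constant density on each of them.\<close>

definition proj :: "nat \<Rightarrow> (real set \<Rightarrow> 'x::real_normed_vector) \<Rightarrow> real set \<Rightarrow> 'x" where
  "proj k \<nu> J = (\<Sum>c\<in>cells (P k). (measure M (J \<inter> ivl c) / (snd c - fst c)) *\<^sub>R \<nu> (ivl c))"

lemma sum_measure_cells_le:
  assumes "finite_measure \<rho>" "sets \<rho> = sets M" "A \<in> sets M"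
  shows "(\<Sum>c\<in>cells (P k). measure \<rho> (A \<inter> ivl c)) \<le> measure \<rho> A"
proof -
  interpret \<rho>: finite_measure \<rho> by fact
  have "(\<Sum>c\<in>cells (P k). measure \<rho> (A \<inter> ivl c)) = measure \<rho> (\<Union>c\<in>cells (P k). A \<inter> ivl c)"
  proof (rule \<rho>.finite_measure_finite_Union[symmetric])
    show "finite (cells (P k))" by (rule finite_cells[OF finite_P])
    show "(\<lambda>c. A \<inter> ivl c) ` cells (P k) \<subseteq> sets \<rho>"
      unfolding assms(2) by (intro image_subsetI sets.Int assms(3) cells_sets)
    show "disjoint_family_on (\<lambda>c. A \<inter> ivl c) (cells (P k))"
      using cells_disjoint[of "P k"] unfolding disjoint_family_on_def by blast
  qed
  also have "\<dots> \<le> measure \<rho> A" using assms by (intro \<rho>.finite_measure_mono) auto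
  finally show ?thesis .
qed

lemma sum_cells_subinterval:
  fixes F :: "real \<Rightarrow> real \<Rightarrow> 'a::ab_group_add"
  assumes ab: "a \<in> P k" "b \<in> P k" "a \<le> b"
    and add: "\<And>x y z. \<lbrakk>x \<in> P k; y \<in> P k; z \<in> P k; x \<le> y; y \<le> z\<rbrakk> \<Longrightarrow> F x z = F x y + F y z"
  shows "(\<Sum>c\<in>cells (P k). if ivl c \<subseteq> {a<..b} then F (fst c) (snd c) else 0) = F a b"
proof -
  have "{c\<in>cells (P k). a \<le> fst c \<and> snd c \<le> b} = {c\<in>cells (P k). ivl c \<subseteq> {a<..b}}"
    using cell_subset_iff by blast
  then show ?thesis
    using sum_cells_additive[where F = F, OF finite_P add ab] finite_cells[OF finite_P]
    by (simp add: sum.inter_filter[symmetric])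
qed

lemma cell_interval_cases:
  assumes "a \<in> P k" "b \<in> P k" "c \<in> cells (P k)"
  shows "ivl c \<inter> {a<..b} = (if ivl c \<subseteq> {a<..b} then ivl c else {})"
proof -
  obtain x y where c: "c = (x, y)" by (cases c)
  have "x < y" "a \<notin> {x<..<y}" "b \<notin> {x<..<y}" using assms by (auto simp: c cells_def)
  then show ?thesis by (auto simp: ivl_def c)
qed

lemma measure_inter_interval:
  assumes ab: "a \<in> P k" "b \<in> P k" "a \<le> b" and J: "J \<in> sets M"
  shows "(\<Sum>c\<in>cells (P k). if ivl c \<subseteq> {a<..b} then measure M (J \<inter> ivl c) else 0) = measure M (J \<inter> {a<..b})"
  unfolding ivl_def
proof (rule sum_cells_subinterval[where F = "\<lambda>x y. measure M (J \<inter> {x<..y})", OF ab, unfolded ivl_def])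
  fix x y z assume xyz: "x \<in> P k" "y \<in> P k" "z \<in> P k" "x \<le> y" "y \<le> z"
  have "J \<inter> {x<..z} = (J \<inter> {x<..y}) \<union> (J \<inter> {y<..z})" using xyz(4,5) by auto
  then show "measure M (J \<inter> {x<..z}) = measure M (J \<inter> {x<..y}) + measure M (J \<inter> {y<..z})"
    using J interval_sets[OF xyz(1,2)] interval_sets[OF xyz(2,3)] by (simp add: finite_measure_Union disjoint_iff)
qed

lemma measure_remainder_small:
  assumes B: "disjoint_family B" "\<And>i::nat. B i \<in> sets M" and "0 < e"
  obtains N where "\<And>n. n \<ge> N \<Longrightarrow> C * measure M ((\<Union>i. B i) - (\<Union>i<n. B i)) < e"
proof -
  have eq: "measure M ((\<Union>i. B i) - (\<Union>i<n. B i)) = measure M (\<Union>i. B i) - (\<Sum>i<n. measure M (B i))" for n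
  proof -
    have "measure M ((\<Union>i. B i) - (\<Union>i<n. B i)) = measure M (\<Union>i. B i) - measure M (\<Union>i<n. B i)"
      using B(2) by (intro finite_measure_Diff) auto
    also have "measure M (\<Union>i<n. B i) = (\<Sum>i<n. measure M (B i))"
      using B by (intro finite_measure_finite_Union) (auto simp: disjoint_family_on_def)
    finally show ?thesis .
  qed
  have "(\<lambda>n. C * (measure M (\<Union>i. B i) - (\<Sum>i<n. measure M (B i)))) \<longlonglongrightarrow> C * (measure M (\<Union>i. B i) - measure M (\<Union>i. B i))"
    using finite_measure_UNION[of B] B by (intro tendsto_intros) (auto simp: sums_def)
  then have "eventually (\<lambda>n. C * (measure M (\<Union>i. B i) - (\<Sum>i<n. measure M (B i))) < e) sequentially"
    using \<open>0 < e\<close> by (intro order_tendstoD(2)) auto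
  then show thesis using that eq unfolding eventually_sequentially by auto
qed

section \<open>Convergence of conditional expectations in variation\<close>

definition disjoint_pieces :: "nat \<Rightarrow> (nat \<Rightarrow> real set) \<Rightarrow> bool" where
  "disjoint_pieces m J \<longleftrightarrow> (\<forall>i<m. J i \<in> sets M) \<and> disjoint_family_on J {..<m}"

text \<open>Convergence of \<open>proj k \<nu>\<close> to \<open>\<nu>\<close> in total variation,
  since \<open>K\<close> is uniform in the disjoint family. For a measure with a density this
  expresses convergence in mean of the conditional expectations without mentioning the
  density.\<close>

definition regular :: "(real set \<Rightarrow> 'x::real_normed_vector) \<Rightarrow> bool" where
  "regular \<nu> \<longleftrightarrow> (\<forall>e>0. \<exists>K. \<forall>k\<ge>K. \<forall>m J. disjoint_pieces m J \<longrightarrow>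
    (\<Sum>i<m. norm (\<nu> (J i) - proj k \<nu> (J i))) \<le> e)"

lemma regular_zero: "regular (\<lambda>A. 0)"
  by (simp add: regular_def proj_def)

lemma regular_add:
  assumes "regular \<nu>" "regular \<mu>"
  shows "regular (\<lambda>A. \<nu> A + \<mu> A)"
  unfolding regular_def
proof (intro allI impI)
  fix e :: real assume "0 < e"
  then have "0 < e / 2" by simp
  obtain K1 where K1: "\<And>k m J. k \<ge> K1 \<Longrightarrow> disjoint_pieces m J \<Longrightarrow>
    (\<Sum>i<m. norm (\<nu> (J i) - proj k \<nu> (J i))) \<le> e / 2"
    using assms(1) \<open>0 < e / 2\<close> unfolding regular_def by blast
  obtain K2 where K2: "\<And>k m J. k \<ge> K2 \<Longrightarrow> disjoint_pieces m J \<Longrightarrow>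
    (\<Sum>i<m. norm (\<mu> (J i) - proj k \<mu> (J i))) \<le> e / 2"
    using assms(2) \<open>0 < e / 2\<close> unfolding regular_def by blast
  show "\<exists>K. \<forall>k\<ge>K. \<forall>m J. disjoint_pieces m J \<longrightarrow>
    (\<Sum>i<m. norm (\<nu> (J i) + \<mu> (J i) - proj k (\<lambda>A. \<nu> A + \<mu> A) (J i))) \<le> e"
  proof (intro exI[of _ "max K1 K2"] allI impI)
    fix k m J assume k: "max K1 K2 \<le> k" and J: "disjoint_pieces m J"
    have p: "proj k (\<lambda>A. \<nu> A + \<mu> A) A = proj k \<nu> A + proj k \<mu> A" for A
      by (simp add: proj_def scaleR_add_right sum.distrib)
    have "(\<Sum>i<m. norm (\<nu> (J i) + \<mu> (J i) - proj k (\<lambda>A. \<nu> A + \<mu> A) (J i))) \<le>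
        (\<Sum>i<m. norm (\<nu> (J i) - proj k \<nu> (J i)) + norm (\<mu> (J i) - proj k \<mu> (J i)))"
    proof (rule sum_mono)
      fix i
      have eq: "\<nu> (J i) + \<mu> (J i) - proj k (\<lambda>A. \<nu> A + \<mu> A) (J i) = (\<nu> (J i) - proj k \<nu> (J i)) + (\<mu> (J i) - proj k \<mu> (J i))"
        by (simp add: p)
      show "norm (\<nu> (J i) + \<mu> (J i) - proj k (\<lambda>A. \<nu> A + \<mu> A) (J i)) \<le>
          norm (\<nu> (J i) - proj k \<nu> (J i)) + norm (\<mu> (J i) - proj k \<mu> (J i))"
        unfolding eq by (rule norm_triangle_ineq)
    qed
    also have "\<dots> \<le> e / 2 + e / 2"
      unfolding sum.distrib using K1[OF _ J, of k] K2[OF _ J, of k] k by (intro add_mono) auto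
    finally show "(\<Sum>i<m. norm (\<nu> (J i) + \<mu> (J i) - proj k (\<lambda>A. \<nu> A + \<mu> A) (J i))) \<le> e" by simp
  qed
qed

lemma regular_sum: "finite I \<Longrightarrow> (\<And>i. i \<in> I \<Longrightarrow> regular (\<nu> i)) \<Longrightarrow> regular (\<lambda>A. \<Sum>i\<in>I. \<nu> i A)"
  by (induction I rule: finite_induct) (auto intro: regular_zero regular_add)

text \<open>Passing to \<open>proj k\<close> does not increase variation: that of
  \<open>proj k \<mu> - proj k \<nu>\<close> is at most the sum of \<open>\<rho>\<close> over the
  cells, hence at most the total mass of \<open>\<rho>\<close>. The three thirds of \<open>e\<close>
  pay for \<open>\<nu> - \<mu>\<close>, for the regularity of \<open>\<mu>\<close>, and for this
  difference.\<close>

lemma regular_limit: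
  assumes approx: "\<And>e. 0 < e \<Longrightarrow> \<exists>\<mu> \<rho>. regular \<mu> \<and> finite_measure \<rho> \<and> sets \<rho> = sets M \<and>
      measure \<rho> (space M) \<le> e \<and> (\<forall>A\<in>sets M. norm (\<nu> A - \<mu> A) \<le> measure \<rho> A)"
  shows "regular \<nu>"
  unfolding regular_def
proof (intro allI impI)
  fix e :: real assume "0 < e"
  then have e3: "0 < e / 3" by simp
  then obtain \<mu> \<rho> where \<mu>: "regular \<mu>" and \<rho>: "finite_measure \<rho>" "sets \<rho> = sets M" "measure \<rho> (space M) \<le> e / 3"
    and le: "\<And>A. A \<in> sets M \<Longrightarrow> norm (\<nu> A - \<mu> A) \<le> measure \<rho> A"
    using approx[OF e3] by blast
  interpret \<rho>: finite_measure \<rho> by fact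
  have sp: "space \<rho> = space M" using sets_eq_imp_space_eq[OF \<rho>(2)] .
  obtain K where K: "\<And>k m J. k \<ge> K \<Longrightarrow> disjoint_pieces m J \<Longrightarrow>
    (\<Sum>i<m. norm (\<mu> (J i) - proj k \<mu> (J i))) \<le> e / 3"
    using \<mu> e3 unfolding regular_def by blast
  show "\<exists>K. \<forall>k\<ge>K. \<forall>m J. disjoint_pieces m J \<longrightarrow>
    (\<Sum>i<m. norm (\<nu> (J i) - proj k \<nu> (J i))) \<le> e"
  proof (intro exI[of _ K] allI impI)
    fix k m J assume k: "K \<le> k" and pieces: "disjoint_pieces m J"
    then have J: "\<forall>i<m. J i \<in> sets M" "disjoint_family_on J {..<m}" by (simp_all add: disjoint_pieces_def)
    have "(\<Sum>i<m. norm (\<nu> (J i) - \<mu> (J i))) \<le> (\<Sum>i<m. measure \<rho> (J i))"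
      using le J by (intro sum_mono) auto
    also have "\<dots> = measure \<rho> (\<Union>i<m. J i)"
      using J \<rho>(2) by (intro \<rho>.finite_measure_finite_Union[symmetric]) auto
    also have "\<dots> \<le> e / 3" using \<rho>.bounded_measure[of "\<Union>i<m. J i"] \<rho>(3) sp by simp
    finally have 1: "(\<Sum>i<m. norm (\<nu> (J i) - \<mu> (J i))) \<le> e / 3" .
    have "(\<Sum>i<m. norm (proj k \<mu> (J i) - proj k \<nu> (J i))) \<le>
        (\<Sum>i<m. \<Sum>c\<in>cells (P k). measure M (J i \<inter> ivl c) / (snd c - fst c) * measure \<rho> (ivl c))"
    proof (rule sum_mono)
      fix i
      have "proj k \<mu> (J i) - proj k \<nu> (J i) =
          (\<Sum>c\<in>cells (P k). (measure M (J i \<inter> ivl c) / (snd c - fst c)) *\<^sub>R (\<mu> (ivl c) - \<nu> (ivl c)))"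
        by (simp add: proj_def sum_subtractf scaleR_diff_right)
      also have "norm \<dots> \<le> (\<Sum>c\<in>cells (P k). measure M (J i \<inter> ivl c) / (snd c - fst c) * measure \<rho> (ivl c))"
      proof (rule order_trans[OF norm_sum], rule sum_mono)
        fix c assume c: "c \<in> cells (P k)"
        have "norm (\<mu> (ivl c) - \<nu> (ivl c)) \<le> measure \<rho> (ivl c)"
          using le[OF cells_sets[OF c]] by (simp add: norm_minus_commute)
        then show "norm ((measure M (J i \<inter> ivl c) / (snd c - fst c)) *\<^sub>R (\<mu> (ivl c) - \<nu> (ivl c))) \<le>
            measure M (J i \<inter> ivl c) / (snd c - fst c) * measure \<rho> (ivl c)"
          using cell_pos[OF c] by (simp add: divide_right_mono mult_left_mono)
      qed
      finally show "norm (proj k \<mu> (J i) - proj k \<nu> (J i)) \<le>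
        (\<Sum>c\<in>cells (P k). measure M (J i \<inter> ivl c) / (snd c - fst c) * measure \<rho> (ivl c))" .
    qed
    also have "\<dots> = (\<Sum>c\<in>cells (P k). (\<Sum>i<m. measure M (J i \<inter> ivl c)) / (snd c - fst c) * measure \<rho> (ivl c))"
      by (subst sum.swap) (simp add: sum_distrib_right sum_divide_distrib)
    also have "\<dots> \<le> (\<Sum>c\<in>cells (P k). measure \<rho> (ivl c))"
    proof (rule sum_mono)
      fix c assume c: "c \<in> cells (P k)"
      have "(\<Sum>i<m. measure M (J i \<inter> ivl c)) = measure M (\<Union>i<m. J i \<inter> ivl c)"
        using J cells_sets[OF c] by (intro finite_measure_finite_Union[symmetric]) (auto simp: disjoint_family_on_def)
      also have "\<dots> \<le> measure M (ivl c)" using cells_sets[OF c] by (intro finite_measure_mono) auto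
      also have "\<dots> = snd c - fst c" by (rule measure_ivl[OF c])
      finally have "(\<Sum>i<m. measure M (J i \<inter> ivl c)) / (snd c - fst c) \<le> 1" using cell_pos[OF c] by simp
      then show "(\<Sum>i<m. measure M (J i \<inter> ivl c)) / (snd c - fst c) * measure \<rho> (ivl c) \<le> measure \<rho> (ivl c)"
        using cell_pos[OF c] by (intro mult_left_le_one_le divide_nonneg_pos sum_nonneg) auto
    qed
    also have "\<dots> = (\<Sum>c\<in>cells (P k). measure \<rho> (space M \<inter> ivl c))"
      using cells_sets sets.sets_into_space by (intro sum.cong) (auto intro!: arg_cong[of _ _ "measure \<rho>"])
    also have "\<dots> \<le> e / 3" using sum_measure_cells_le[OF \<rho>(1,2) sets.top, of k] \<rho>(3) by linarith
    finally have 2: "(\<Sum>i<m. norm (proj k \<mu> (J i) - proj k \<nu> (J i))) \<le> e / 3" .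
    have "(\<Sum>i<m. norm (\<nu> (J i) - proj k \<nu> (J i))) \<le> (\<Sum>i<m. norm (\<nu> (J i) - \<mu> (J i)) +
        norm (\<mu> (J i) - proj k \<mu> (J i)) + norm (proj k \<mu> (J i) - proj k \<nu> (J i)))"
    proof (rule sum_mono)
      fix i
      have "norm (\<nu> (J i) - proj k \<nu> (J i)) \<le> norm (\<nu> (J i) - proj k \<mu> (J i)) + norm (proj k \<mu> (J i) - proj k \<nu> (J i))"
        using norm_triangle_ineq[of "\<nu> (J i) - proj k \<mu> (J i)" "proj k \<mu> (J i) - proj k \<nu> (J i)"] by simp
      moreover have "norm (\<nu> (J i) - proj k \<mu> (J i)) \<le> norm (\<nu> (J i) - \<mu> (J i)) + norm (\<mu> (J i) - proj k \<mu> (J i))"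
        using norm_triangle_ineq[of "\<nu> (J i) - \<mu> (J i)" "\<mu> (J i) - proj k \<mu> (J i)"] by simp
      ultimately show "norm (\<nu> (J i) - proj k \<nu> (J i)) \<le> norm (\<nu> (J i) - \<mu> (J i)) +
        norm (\<mu> (J i) - proj k \<mu> (J i)) + norm (proj k \<mu> (J i) - proj k \<nu> (J i))" by linarith
    qed
    also have "\<dots> \<le> e" unfolding sum.distrib using 1 2 K[OF k pieces] by linarith
    finally show "(\<Sum>i<m. norm (\<nu> (J i) - proj k \<nu> (J i))) \<le> e" .
  qed
qed

text \<open>The case of \<open>regular_limit\<close> with error measure 0.\<close>

lemma regular_cong:
  assumes "regular \<mu>" "\<And>A. A \<in> sets M \<Longrightarrow> \<nu> A = \<mu> A"
  shows "regular \<nu>"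
proof (rule regular_limit)
  have "finite_measure (null_measure M)" by (rule finite_measureI) simp
  then show "\<exists>\<mu> \<rho>. regular \<mu> \<and> finite_measure \<rho> \<and> sets \<rho> = sets M \<and> measure \<rho> (space M) \<le> e \<and>
      (\<forall>A\<in>sets M. norm (\<nu> A - \<mu> A) \<le> measure \<rho> A)" if "0 < e" for e
    using assms that by (intro exI[of _ \<mu>] exI[of _ "null_measure M"]) (auto simp: measure_def)
qed

text \<open>From stage \<open>j\<close> on, every cell lies inside or outside the interval, so the
  projection reproduces the measure exactly.\<close>

lemma regular_interval:
  assumes ab: "a \<in> P j" "b \<in> P j" "a \<le> b"
  shows "regular (\<lambda>A. measure M (A \<inter> {a<..b}) *\<^sub>R y)"
  unfolding regular_def
proof (intro allI impI exI[of _ j])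
  fix e :: real and k m J assume "0 < e" and k: "j \<le> k" and "disjoint_pieces m J"
  then have J: "\<forall>i<m. J i \<in> sets M" by (simp add: disjoint_pieces_def)
  have ab': "a \<in> P k" "b \<in> P k" using ab P_mono[OF k] by auto
  have "measure M (J i \<inter> {a<..b}) *\<^sub>R y = proj k (\<lambda>A. measure M (A \<inter> {a<..b}) *\<^sub>R y) (J i)" if "i < m" for i
  proof -
    have "proj k (\<lambda>A. measure M (A \<inter> {a<..b}) *\<^sub>R y) (J i) =
        (\<Sum>c\<in>cells (P k). (if ivl c \<subseteq> {a<..b} then measure M (J i \<inter> ivl c) else 0) *\<^sub>R y)"
      unfolding proj_def
    proof (rule sum.cong[OF refl])
      fix c assume c: "c \<in> cells (P k)"
      show "(measure M (J i \<inter> ivl c) / (snd c - fst c)) *\<^sub>R measure M (ivl c \<inter> {a<..b}) *\<^sub>R y =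
          (if ivl c \<subseteq> {a<..b} then measure M (J i \<inter> ivl c) else 0) *\<^sub>R y"
        using cell_interval_cases[OF ab' c] measure_ivl[OF c] cell_pos[OF c] by auto
    qed
    then show ?thesis using measure_inter_interval[OF ab' ab(3)] J that by (simp flip: scaleR_sum_left)
  qed
  then show "(\<Sum>i<m. norm (measure M (J i \<inter> {a<..b}) *\<^sub>R y -
      proj k (\<lambda>A. measure M (A \<inter> {a<..b}) *\<^sub>R y) (J i))) \<le> e"
    using \<open>0 < e\<close> by simp
qed

text \<open>The sets \<open>B\<close> with this property contain the intervals and form a Dynkin
  system. The vector \<open>y\<close> is generalised in the induction because complements use the
  claim for \<open>- y\<close>.\<close>

lemma regular_measurable_set:
  assumes "B \<in> sets M"
  shows "regular (\<lambda>A. measure M (A \<inter> B) *\<^sub>R (y::'x::real_normed_vector))"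
  using assms
proof (induction B arbitrary: y rule: sets_induct)
  case (interval a b k)
  then show ?case by (rule regular_interval)
next
  case empty
  show ?case by (simp add: regular_zero)
next
  case (complement B)
  have "0 \<le> D" using P_ends P_bounds[of 0] by auto
  have "regular (\<lambda>A. measure M (A \<inter> {0<..D}) *\<^sub>R y + measure M (A \<inter> B) *\<^sub>R (- y))"
    by (rule regular_add[OF regular_interval[OF P_ends \<open>0 \<le> D\<close>] complement(2)])
  then show ?case
  proof (rule regular_cong)
    fix A assume A: "A \<in> sets M"
    have "A \<inter> ({0<..D} - B) = A - A \<inter> B" "A \<inter> {0<..D} = A"
      using sets.sets_into_space[OF A] by (auto simp: space_M)
    then show "measure M (A \<inter> ({0<..D} - B)) *\<^sub>R y = measure M (A \<inter> {0<..D}) *\<^sub>R y + measure M (A \<inter> B) *\<^sub>R (- y)"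
      using finite_measure_Diff[OF A, of "A \<inter> B"] A complement(1) by (auto simp: scaleR_diff_left)
  qed
next
  case (union B)
  show ?case
  proof (rule regular_limit)
    fix e :: real assume e: "0 < e"
    obtain n where n: "norm y * measure M ((\<Union>i. B i) - (\<Union>i<n. B i)) < e"
      using measure_remainder_small[OF union(1,2) e, of "norm y"] by blast
    define R where "R = (\<Union>i. B i) - (\<Union>i<n. B i)"
    have Rm: "R \<in> sets M" using union(2) by (auto simp: R_def)
    have dis: "disjoint_family_on B {..<n}" using union(1) by (auto simp: disjoint_family_on_def)
    have mR: "measure M R * norm y < e" using n by (simp add: R_def mult.commute)
    \<comment> \<open>The error of the partial union is
      \<open>measure M (A \<inter> R) *\<^sub>R y\<close>, whose norm is the value of this scalar
      measure at \<open>A\<close>.\<close>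
    define \<rho> where "\<rho> = density M (\<lambda>x. ennreal (norm y) * indicator R x)"
    have e\<rho>: "emeasure \<rho> A = ennreal (measure M (A \<inter> R) * norm y)" if A: "A \<in> sets M" for A
    proof -
      have "emeasure \<rho> A = (\<integral>\<^sup>+x. ennreal (norm y) * indicator R x * indicator A x \<partial>M)"
        unfolding \<rho>_def using A Rm by (intro emeasure_density) auto
      also have "\<dots> = (\<integral>\<^sup>+x. ennreal (norm y) * indicator (A \<inter> R) x \<partial>M)"
        by (intro nn_integral_cong) (auto split: split_indicator)
      also have "\<dots> = ennreal (norm y) * emeasure M (A \<inter> R)" using A Rm by (intro nn_integral_cmult_indicator) auto
      finally show ?thesis by (simp add: emeasure_eq_measure ennreal_mult mult.commute)
    qed
    then have m\<rho>: "measure \<rho> A = measure M (A \<inter> R) * norm y" if "A \<in> sets M" for A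
      using that by (simp add: measure_def)
    have "finite_measure \<rho>"
      by (rule finite_measureI) (use e\<rho>[OF sets.top] in \<open>simp add: \<rho>_def\<close>)
    moreover have "sets \<rho> = sets M" by (simp add: \<rho>_def)
    moreover have "measure \<rho> (space M) \<le> e"
      using m\<rho>[OF sets.top] mR sets.sets_into_space[OF Rm] by (simp add: Int_absorb1)
    moreover have "regular (\<lambda>A. \<Sum>i<n. measure M (A \<inter> B i) *\<^sub>R y)"
      using union(3) by (intro regular_sum) auto
    moreover have "norm (measure M (A \<inter> (\<Union>i. B i)) *\<^sub>R y - (\<Sum>i<n. measure M (A \<inter> B i) *\<^sub>R y)) \<le> measure \<rho> A"
      if A: "A \<in> sets M" for A
    proof -
      have "measure M (A \<inter> (\<Union>i. B i)) = measure M ((\<Union>i<n. A \<inter> B i) \<union> (A \<inter> R))"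
        by (intro arg_cong[of _ _ "measure M"]) (auto simp: R_def)
      also have "\<dots> = measure M (\<Union>i<n. A \<inter> B i) + measure M (A \<inter> R)"
        using A union(2) Rm by (intro finite_measure_Union) (auto simp: R_def)
      also have "measure M (\<Union>i<n. A \<inter> B i) = (\<Sum>i<n. measure M (A \<inter> B i))"
        using A union(2) dis by (intro finite_measure_finite_Union) (auto simp: disjoint_family_on_def)
      finally have "measure M (A \<inter> (\<Union>i. B i)) *\<^sub>R y - (\<Sum>i<n. measure M (A \<inter> B i) *\<^sub>R y) = measure M (A \<inter> R) *\<^sub>R y"
        by (simp add: scaleR_add_left scaleR_sum_left)
      then show ?thesis using m\<rho>[OF A] by simp
    qed
    ultimately show "\<exists>\<mu> \<rho>. regular \<mu> \<and> finite_measure \<rho> \<and> sets \<rho> = sets M \<and> measure \<rho> (space M) \<le> e \<and>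
        (\<forall>A\<in>sets M. norm (measure M (A \<inter> (\<Union>i. B i)) *\<^sub>R y - \<mu> A) \<le> measure \<rho> A)"
      by blast
  qed
qed

text \<open>\<open>F\<close> is approximated in mean by a simple function \<open>s\<close>. The
  indefinite integral of \<open>s\<close> is a finite sum of regular measures, and the measure with
  density \<open>norm (F z - s z)\<close> dominates the error as in
  \<open>regular_limit\<close>.\<close>

theorem regular_bochner_integral:
  fixes F :: "real \<Rightarrow> 'x::real_normed_vector"
  assumes F: "\<And>A. A \<in> sets M \<Longrightarrow> bochner_integral_is M (\<lambda>z. indicator A z *\<^sub>R F z) (G A)"
  shows "regular G"
proof (rule regular_limit)
  fix e :: real assume e: "0 < e"
  have cong: "indicator (space M) z *\<^sub>R F z = F z" if "z \<in> space M" for z using that by simp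
  obtain t where Fm0: "(\<lambda>z. indicator (space M) z *\<^sub>R F z) \<in> borel_measurable M"
    and t: "\<And>i. simple_bochner_integrable M (t i)"
    and t00: "(\<lambda>i. \<integral>\<^sup>+z. norm (indicator (space M) z *\<^sub>R F z - t i z) \<partial>M) \<longlonglongrightarrow> 0"
    using F[OF sets.top] unfolding bochner_integral_is_def by blast
  have Fm: "F \<in> borel_measurable M"
    using Fm0 by (rule measurable_cong[THEN iffD1, rotated]) (rule cong)
  have "(\<integral>\<^sup>+z. norm (indicator (space M) z *\<^sub>R F z - t i z) \<partial>M) = (\<integral>\<^sup>+z. norm (F z - t i z) \<partial>M)" for i
    by (intro nn_integral_cong) (simp only: cong)
  then have t0: "(\<lambda>i. \<integral>\<^sup>+z. norm (F z - t i z) \<partial>M) \<longlonglongrightarrow> 0" using t00 by simp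
  have "eventually (\<lambda>i. (\<integral>\<^sup>+z. norm (F z - t i z) \<partial>M) < ennreal e) sequentially"
    using t0 e by (intro order_tendstoD(2)) auto
  then obtain i where i: "(\<integral>\<^sup>+z. norm (F z - t i z) \<partial>M) < ennreal e"
    unfolding eventually_sequentially by blast
  define s where "s = t i"
  have sf: "simple_function M s" using t[of i] by (auto simp: s_def elim: simple_bochner_integrable.cases)
  have wm[measurable]: "(\<lambda>z. norm (F z - s z)) \<in> borel_measurable M"
    by (rule borel_measurable_norm_diff_simple[OF Fm sf])
  define B where "B v = {z \<in> space M. s z = v}" for v
  have fin: "finite (s ` space M)" using sf by (simp add: simple_function_def)
  have Bm: "B v \<in> sets M" for v
    using simple_functionD(2)[OF sf, of "{v}"] by (simp add: B_def vimage_def Int_def conj_commute)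
  define \<rho> where "\<rho> = density M (\<lambda>z. ennreal (norm (F z - s z)))"
  have e\<rho>: "emeasure \<rho> A = (\<integral>\<^sup>+z. ennreal (norm (F z - s z)) * indicator A z \<partial>M)" if "A \<in> sets M" for A
    unfolding \<rho>_def using that by (intro emeasure_density) auto
  have total: "emeasure \<rho> (space M) < ennreal e"
  proof -
    have "emeasure \<rho> (space M) = (\<integral>\<^sup>+z. norm (F z - s z) \<partial>M)"
      using e\<rho>[OF sets.top] by (simp cong: nn_integral_cong)
    then show ?thesis using i by (simp add: s_def)
  qed
  have fm: "finite_measure \<rho>"
    by (rule finite_measureI) (use total in \<open>auto simp: \<rho>_def\<close>)
  interpret \<rho>: finite_measure \<rho> by fact
  have "measure \<rho> (space M) \<le> e"
    using total e by (simp add: \<rho>.emeasure_eq_measure ennreal_less_iff)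
  moreover have "regular (\<lambda>A. \<Sum>v\<in>s ` space M. measure M (A \<inter> B v) *\<^sub>R v)"
    using fin Bm by (intro regular_sum regular_measurable_set)
  moreover have "norm (G A - (\<Sum>v\<in>s ` space M. measure M (A \<inter> B v) *\<^sub>R v)) \<le> measure \<rho> A" if A: "A \<in> sets M" for A
  proof -
    let ?s = "\<lambda>z. \<Sum>v\<in>s ` space M. indicator (A \<inter> B v) z *\<^sub>R v"
    have sb: "simple_bochner_integrable M ?s"
      "simple_bochner_integral M ?s = (\<Sum>v\<in>s ` space M. measure M (A \<inter> B v) *\<^sub>R v)"
      using simple_bochner_indicator_sum[OF fin, of "\<lambda>v. A \<inter> B v" "\<lambda>v. v"] A Bm by auto
    have s_eq: "?s z = indicator A z *\<^sub>R s z" if "z \<in> space M" for z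
    proof -
      have "?s z = (\<Sum>v\<in>s ` space M. if v = s z then indicator A z *\<^sub>R v else 0)"
        using that by (intro sum.cong) (auto simp: B_def indicator_def)
      also have "\<dots> = indicator A z *\<^sub>R s z" using fin that by simp
      finally show ?thesis .
    qed
    have "ennreal (norm (G A - (\<Sum>v\<in>s ` space M. measure M (A \<inter> B v) *\<^sub>R v))) \<le>
        (\<integral>\<^sup>+z. norm (indicator A z *\<^sub>R F z - ?s z) \<partial>M)"
      using bochner_integral_is_dist_simple[OF F[OF A] sb(1)] unfolding sb(2) .
    also have "\<dots> = (\<integral>\<^sup>+z. ennreal (norm (F z - s z)) * indicator A z \<partial>M)"
      by (intro nn_integral_cong, simp only: s_eq) (auto split: split_indicator)
    also have "\<dots> = emeasure \<rho> A" using e\<rho>[OF A] by simp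
    finally show ?thesis by (simp add: \<rho>.emeasure_eq_measure)
  qed
  moreover have "sets \<rho> = sets M" by (simp add: \<rho>_def)
  ultimately show "\<exists>\<mu> \<rho>. regular \<mu> \<and> finite_measure \<rho> \<and> sets \<rho> = sets M \<and>
      measure \<rho> (space M) \<le> e \<and> (\<forall>A\<in>sets M. norm (G A - \<mu> A) \<le> measure \<rho> A)"
    using fm by blast
qed

end


section \<open>Vector measures from thick families\<close>

context interval_partitions
begin

text \<open>This will be \<open>proj k G\<close> for the measure \<open>G\<close> constructed below,
  written with the increments of \<open>h\<close> because \<open>G\<close> does not yet
  exist.\<close>

definition interpolated :: "(nat \<Rightarrow> real \<Rightarrow> 'x::real_normed_vector) \<Rightarrow> nat \<Rightarrow> real set \<Rightarrow> 'x" where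
  "interpolated h k J = (\<Sum>c\<in>cells (P k). (measure M (J \<inter> ivl c) / (snd c - fst c)) *\<^sub>R (h k (snd c) - h k (fst c)))"

lemma interpolated_interval:
  assumes ab: "a \<in> P k" "b \<in> P k" "a \<le> b"
  shows "interpolated h k {a<..b} = h k b - h k a"
proof -
  have "interpolated h k {a<..b} = (\<Sum>c\<in>cells (P k). if ivl c \<subseteq> {a<..b} then h k (snd c) - h k (fst c) else 0)"
    unfolding interpolated_def
  proof (rule sum.cong[OF refl])
    fix c assume c: "c \<in> cells (P k)"
    show "(measure M ({a<..b} \<inter> ivl c) / (snd c - fst c)) *\<^sub>R (h k (snd c) - h k (fst c)) =
        (if ivl c \<subseteq> {a<..b} then h k (snd c) - h k (fst c) else 0)"
      using cell_interval_cases[OF ab(1,2) c] measure_ivl[OF c] cell_pos[OF c] by (simp add: Int_commute)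
  qed
  also have "\<dots> = h k b - h k a"
    using sum_cells_subinterval[OF ab, of "\<lambda>x y. h k y - h k x"] by simp
  finally show ?thesis .
qed

lemma interpolated_bound:
  assumes lip: "\<And>a b. a \<in> P k \<Longrightarrow> b \<in> P k \<Longrightarrow> a \<le> b \<Longrightarrow> norm (h k b - h k a) \<le> C * (b - a)"
    and "0 \<le> C" and A: "A \<in> sets M"
  shows "norm (interpolated h k A) \<le> C * measure M A"
proof -
  have "norm (interpolated h k A) \<le> (\<Sum>c\<in>cells (P k). C * measure M (A \<inter> ivl c))"
    unfolding interpolated_def
  proof (rule order_trans[OF norm_sum], rule sum_mono)
    fix c assume c: "c \<in> cells (P k)"
    have "norm (h k (snd c) - h k (fst c)) \<le> C * (snd c - fst c)"
      using c by (intro lip) (auto simp: cells_def)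
    then have "measure M (A \<inter> ivl c) / (snd c - fst c) * norm (h k (snd c) - h k (fst c)) \<le>
        measure M (A \<inter> ivl c) / (snd c - fst c) * (C * (snd c - fst c))"
      using cell_pos[OF c] by (intro mult_left_mono) auto
    then show "norm ((measure M (A \<inter> ivl c) / (snd c - fst c)) *\<^sub>R (h k (snd c) - h k (fst c))) \<le> C * measure M (A \<inter> ivl c)"
      using cell_pos[OF c] by (simp add: mult.commute)
  qed
  also have "\<dots> \<le> C * measure M A"
    unfolding sum_distrib_left[symmetric]
    using sum_measure_cells_le[OF finite_measure_axioms refl A] \<open>0 \<le> C\<close> by (intro mult_left_mono)
  finally show ?thesis .
qed

lemma interpolated_ac_vector_measure: "ac_vector_measure M (interpolated h k)"
proof
  show "vector_measure M (interpolated h k)"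
    unfolding vector_measure_def interpolated_def
  proof (intro allI impI sums_sum sums_scaleR_left sums_divide)
    fix A :: "nat \<Rightarrow> real set" and c assume A: "range A \<subseteq> sets M" "disjoint_family A" and c: "c \<in> cells (P k)"
    have "(\<lambda>i. measure M (A i \<inter> ivl c)) sums measure M (\<Union>i. A i \<inter> ivl c)"
    proof (rule finite_measure_UNION)
      show "range (\<lambda>i. A i \<inter> ivl c) \<subseteq> sets M" using A(1) cells_sets[OF c] by blast
      show "disjoint_family (\<lambda>i. A i \<inter> ivl c)" using A(2) unfolding disjoint_family_on_def by blast
    qed
    then show "(\<lambda>i. measure M (A i \<inter> ivl c)) sums measure M (\<Union> (range A) \<inter> ivl c)" by simp
  qed
  fix A assume A: "A \<in> sets M" "measure M A = 0"
  have "measure M (A \<inter> ivl c) = 0" if "c \<in> cells (P k)" for c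
    using finite_measure_mono[of "A \<inter> ivl c" A] A measure_nonneg[of M "A \<inter> ivl c"] by simp
  then show "interpolated h k A = 0" by (simp add: interpolated_def)
qed

text \<open>\<open>G\<close> is the setwise limit of the interpolations. On a partition interval
  they are eventually constant by consistency; the common bound \<open>C * measure M A\<close>
  carries convergence to all measurable sets. The same bound for \<open>G\<close> gives countable
  additivity, bounded variation and continuity.\<close>

theorem lipschitz_vector_measure:
  fixes h :: "nat \<Rightarrow> real \<Rightarrow> 'x::banach"
  assumes lip: "\<And>k a b. a \<in> P k \<Longrightarrow> b \<in> P k \<Longrightarrow> a \<le> b \<Longrightarrow> norm (h k b - h k a) \<le> C * (b - a)"
    and "0 \<le> C" and consistent: "\<And>j k a. j \<le> k \<Longrightarrow> a \<in> P j \<Longrightarrow> h k a = h j a"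
  obtains G where "vector_measure M G" "bounded_variation M G" "continuous_wrt M G"
    "\<And>k a b. a \<in> P k \<Longrightarrow> b \<in> P k \<Longrightarrow> a \<le> b \<Longrightarrow> G {a<..b} = h k b - h k a"
proof -
  let ?I = "interpolated h"
  have bound: "norm (?I k A) \<le> C * measure M A" if "A \<in> sets M" for k A
    by (rule interpolated_bound[OF _ \<open>0 \<le> C\<close> that]) (rule lip)
  have I_interval: "?I k {a<..b} = h j b - h j a" if "a \<in> P j" "b \<in> P j" "a \<le> b" "j \<le> k" for a b j k
    using interpolated_interval[of a k b h] P_mono[OF that(4)] consistent[OF that(4)] that by auto
  interpret I: ac_vector_measure M "?I k" for k by (rule interpolated_ac_vector_measure)
  have split: "?I k (\<Union>i. B i) = (\<Sum>i<n. ?I k (B i)) + ?I k ((\<Union>i. B i) - (\<Union>i<n. B i))"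
    if B: "disjoint_family B" "\<And>i::nat. B i \<in> sets M" for B k n
  proof -
    have "?I k ((\<Union>i. B i) - (\<Union>i<n. B i)) = ?I k (\<Union>i. B i) - ?I k (\<Union>i<n. B i)"
      using B(2) by (intro I.Diff) auto
    moreover have "?I k (\<Union>i<n. B i) = (\<Sum>i<n. ?I k (B i))"
      using B by (intro I.UN_finite) (auto simp: disjoint_family_on_def)
    ultimately show ?thesis by simp
  qed
  have conv: "convergent (\<lambda>k. ?I k A)" if "A \<in> sets M" for A
    using that
  proof (induction A rule: sets_induct)
    case (interval a b j)
    have "(\<lambda>k. ?I k {a<..b}) \<longlonglongrightarrow> h j b - h j a"
      by (rule tendsto_eventually) (use I_interval[OF interval] in \<open>auto simp: eventually_sequentially\<close>)
    then show ?case by (auto simp: convergent_def)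
  next
    case empty
    show ?case by (simp add: I.empty convergent_const)
  next
    case (complement A)
    have "0 \<le> D" using P_ends P_bounds[of 0] by auto
    have "(\<lambda>k. ?I k {0<..D}) \<longlonglongrightarrow> h 0 D - h 0 0"
      by (rule tendsto_eventually) (use I_interval[OF P_ends \<open>0 \<le> D\<close>] in \<open>auto simp: eventually_sequentially\<close>)
    then have "convergent (\<lambda>k. ?I k {0<..D} - ?I k A)"
      using complement(2) by (intro convergent_diff) (auto simp: convergent_def)
    moreover have "?I k ({0<..D} - A) = ?I k {0<..D} - ?I k A" for k
      using I.Diff[of "{0<..D}" A k] sets.sets_into_space[OF complement(1)] complement(1) sets.top[of M]
      by (simp add: space_M)
    ultimately show ?case by simp
  next
    case (union B)
    show ?case
    proof (rule convergent_uniform_approximation)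
      fix e :: real assume "0 < e"
      then obtain n where n: "C * measure M ((\<Union>i. B i) - (\<Union>i<n. B i)) < e"
        using measure_remainder_small[OF union(1,2), of e C] by blast
      have Rm: "(\<Union>i. B i) - (\<Union>i<n. B i) \<in> sets M" using union(2) by auto
      have "norm (?I k (\<Union>i. B i) - (\<Sum>i<n. ?I k (B i))) \<le> e" for k
        using split[OF union(1,2), of k n] bound[OF Rm, of k] n by simp
      moreover have "convergent (\<lambda>k. \<Sum>i<n. ?I k (B i))" using union(3) by (intro convergent_sum) auto
      ultimately show "\<exists>y. convergent y \<and> (\<forall>k. norm (?I k (\<Union>i. B i) - y k) \<le> e)"
        by (intro exI[of _ "\<lambda>k. \<Sum>i<n. ?I k (B i)"]) simp
    qed
  qed
  define G where "G A = lim (\<lambda>k. ?I k A)" for A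
  have lim: "(\<lambda>k. ?I k A) \<longlonglongrightarrow> G A" if "A \<in> sets M" for A
    using conv[OF that] by (simp add: G_def convergent_LIMSEQ_iff)
  have G_bound: "norm (G A) \<le> C * measure M A" if A: "A \<in> sets M" for A
    by (rule LIMSEQ_le_const2[OF tendsto_norm[OF lim[OF A]]]) (use bound[OF A] in blast)
  have G_interval: "G {a<..b} = h k b - h k a" if "a \<in> P k" "b \<in> P k" "a \<le> b" for k a b
  proof -
    have "(\<lambda>l. ?I l {a<..b}) \<longlonglongrightarrow> h k b - h k a"
      by (rule tendsto_eventually) (use I_interval[OF that] in \<open>auto simp: eventually_sequentially\<close>)
    then show ?thesis using lim[OF interval_sets[OF that(1,2)]] LIMSEQ_unique by blast
  qed
  have vm: "vector_measure M G"
    unfolding vector_measure_def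
  proof (intro allI impI)
    fix B :: "nat \<Rightarrow> real set" assume "range B \<subseteq> sets M" and dis: "disjoint_family B"
    then have Bm: "\<And>i. B i \<in> sets M" by blast
    have G_split: "G (\<Union>i. B i) = (\<Sum>i<n. G (B i)) + G ((\<Union>i. B i) - (\<Union>i<n. B i))" for n
    proof (rule LIMSEQ_unique)
      show "(\<lambda>k. ?I k (\<Union>i. B i)) \<longlonglongrightarrow> G (\<Union>i. B i)" using Bm by (intro lim) auto
      show "(\<lambda>k. ?I k (\<Union>i. B i)) \<longlonglongrightarrow> (\<Sum>i<n. G (B i)) + G ((\<Union>i. B i) - (\<Union>i<n. B i))"
        unfolding split[OF dis Bm, of _ n] using Bm by (intro tendsto_add tendsto_sum lim) auto
    qed
    show "(\<lambda>i. G (B i)) sums G (\<Union>i. B i)"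
      unfolding sums_def
    proof (rule LIMSEQ_I)
      fix e :: real assume "0 < e"
      then obtain N where N: "\<And>n. n \<ge> N \<Longrightarrow> C * measure M ((\<Union>i. B i) - (\<Union>i<n. B i)) < e"
        using measure_remainder_small[OF dis Bm, of e C] by blast
      have "norm ((\<Sum>i<n. G (B i)) - G (\<Union>i. B i)) < e" if "n \<ge> N" for n
      proof -
        have Rm: "(\<Union>i. B i) - (\<Union>i<n. B i) \<in> sets M" using Bm by auto
        have "norm ((\<Sum>i<n. G (B i)) - G (\<Union>i. B i)) = norm (G ((\<Union>i. B i) - (\<Union>i<n. B i)))"
          by (subst G_split[of n]) simp
        then show ?thesis using G_bound[OF Rm] N[OF that] by linarith
      qed
      then show "\<exists>N. \<forall>n\<ge>N. norm ((\<Sum>i<n. G (B i)) - G (\<Union>i. B i)) < e" by blast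
    qed
  qed
  have bv: "bounded_variation M G"
    unfolding bounded_variation_def
  proof (intro exI[of _ "C * measure M (space M)"] allI impI)
    fix Q :: "real set set" assume Q: "finite Q" "Q \<subseteq> sets M" "partition_on (space M) Q"
    have "(\<Sum>A\<in>Q. norm (G A)) \<le> (\<Sum>A\<in>Q. C * measure M A)" using G_bound Q(2) by (intro sum_mono) auto
    also have "\<dots> = C * measure M (\<Union>A\<in>Q. A)"
    proof -
      have "disjoint_family_on (\<lambda>A. A) Q"
        using partition_onD2[OF Q(3)] by (auto simp: disjoint_family_on_def disjoint_def)
      then show ?thesis using Q by (subst finite_measure_finite_Union) (auto simp: sum_distrib_left)
    qed
    also have "\<dots> \<le> C * measure M (space M)" using \<open>0 \<le> C\<close> by (intro mult_left_mono bounded_measure) auto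
    finally show "(\<Sum>A\<in>Q. norm (G A)) \<le> C * measure M (space M)" .
  qed
  have cw: "continuous_wrt M G"
    unfolding continuous_wrt_def
  proof (intro allI impI)
    fix e :: real assume "0 < e"
    have "norm (G A) < e" if A: "A \<in> sets M" "measure M A < e / (C + 1)" for A
    proof -
      have "norm (G A) \<le> C * measure M A" by (rule G_bound[OF A(1)])
      also have "\<dots> \<le> (C + 1) * measure M A" by (simp add: distrib_right)
      finally show ?thesis using A(2) \<open>0 \<le> C\<close> by (simp add: field_simps)
    qed
    then show "\<exists>d>0. \<forall>A\<in>sets M. measure M A < d \<longrightarrow> norm (G A) < e"
      using \<open>0 < e\<close> \<open>0 \<le> C\<close> by (intro exI[of _ "e / (C + 1)"]) auto
  qed
  show thesis by (rule that[OF vm bv cw]) (rule G_interval)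
qed

end

text \<open>Lebesgue measure on \<open>{0<..D}\<close> is restricted to the coarser sigma-algebra by
  taking its image under the identity.\<close>

lemma interval_partitions_exist:
  assumes "\<And>k. finite (P k)" "\<And>k. P k \<subseteq> P (Suc k)" "0 \<in> P 0" "D \<in> P 0" "\<And>k. P k \<subseteq> {0..D}"
  obtains M where "interval_partitions M P D" "\<And>A. A \<in> sets M \<Longrightarrow> measure M A = measure lborel A"
proof -
  let ?G = "{{a<..b} | a b. a \<in> (\<Union>k. P k) \<and> b \<in> (\<Union>k. P k)}"
  have "0 \<le> D" using assms(3,4) assms(5)[of 0] by auto
  have closed: "?G \<subseteq> Pow {0<..D}"
  proof
    fix A assume "A \<in> ?G"
    then obtain a b k l where "A = {a<..b}" "a \<in> P k" "b \<in> P l" by blast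
    moreover from this have "a \<in> {0..D}" "b \<in> {0..D}" using assms(5) by blast+
    ultimately show "A \<in> Pow {0<..D}" by auto
  qed
  define L where "L = restrict_space lborel {0<..D}"
  define M where "M = distr L (sigma {0<..D} ?G) (\<lambda>x. x)"
  have id: "(\<lambda>x. x) \<in> measurable L (sigma {0<..D} ?G)"
  proof (rule measurable_measure_of[OF closed])
    show "(\<lambda>x. x) \<in> space L \<rightarrow> {0<..D}" by (auto simp: L_def space_restrict_space)
    fix A assume A: "A \<in> ?G"
    then have "A \<in> sets borel" "A \<subseteq> {0<..D}" using closed by auto
    then show "(\<lambda>x. x) -` A \<inter> space L \<in> sets L"
      by (auto simp: L_def space_restrict_space sets_restrict_space_iff Int_absorb2 Int_absorb1)
  qed
  have sL: "finite_measure L"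
    by (rule finite_measureI) (simp add: L_def space_restrict_space emeasure_restrict_space emeasure_lborel_Ioc[OF \<open>0 \<le> D\<close>])
  have fm: "finite_measure M" unfolding M_def by (rule finite_measure.finite_measure_distr[OF sL id])
  have sp: "space M = {0<..D}" unfolding M_def space_distr by (rule space_measure_of[OF closed])
  have st: "sets M = sigma_sets {0<..D} ?G" unfolding M_def sets_distr by (rule sets_measure_of[OF closed])
  have eq: "measure M A = measure lborel A" if A: "A \<in> sets M" for A
  proof -
    have sub: "A \<subseteq> {0<..D}" using sets.sets_into_space[OF A] sp by simp
    have "A \<in> sets (sigma {0<..D} ?G)" using A by (simp add: M_def)
    then have "emeasure M A = emeasure L ((\<lambda>x. x) -` A \<inter> space L)"
      unfolding M_def by (rule emeasure_distr[OF id])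
    also have "(\<lambda>x. x) -` A \<inter> space L = A" using sub by (auto simp: L_def space_restrict_space)
    also have "emeasure L A = emeasure lborel A" unfolding L_def using sub by (intro emeasure_restrict_space) auto
    finally show ?thesis by (simp add: measure_def)
  qed
  have mono: "P j \<subseteq> P k" if "j \<le> k" for j k by (rule lift_Suc_mono_le[where f = P, OF assms(2) that])
  have "measure M {a<..b} = b - a" if "a \<in> P k" "b \<in> P k" "a \<le> b" for a b k
  proof -
    have "{a<..b} \<in> sets M" unfolding st using that by (intro sigma_sets.Basic) blast
    then show ?thesis using eq that(3) by simp
  qed
  then have "interval_partitions M P D"
    using fm assms mono sp st by (simp add: interval_partitions_def interval_partitions_axioms_def)
  then show thesis using eq by (rule that)
qed

section \<open>Deviation from interpolations along a thick family\<close>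

text \<open>The counterpart of \<open>interpolated\<close> with Lebesgue measure and a single
  partition: it is needed to choose the partitions, before the measure space on them is
  available.\<close>

definition interpolation :: "real set \<Rightarrow> (real \<Rightarrow> 'x::real_normed_vector) \<Rightarrow> real set \<Rightarrow> 'x" where
  "interpolation P h J = (\<Sum>c\<in>cells P. (measure lborel (J \<inter> ivl c) / (snd c - fst c)) *\<^sub>R (h (snd c) - h (fst c)))"

lemma interpolation_cong: "(\<And>p. p \<in> P \<Longrightarrow> h p = h' p) \<Longrightarrow> interpolation P h = interpolation P h'"
  unfolding interpolation_def[abs_def] by (intro ext sum.cong) (auto simp: cells_def)

definition deviates :: "real \<Rightarrow> real set \<Rightarrow> (real \<Rightarrow> 'x::real_normed_vector) \<Rightarrow> real set \<Rightarrow> (real \<Rightarrow> 'x) \<Rightarrow> bool" where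
  "deviates \<gamma> P h P' h' \<longleftrightarrow> (\<exists>(m::nat) a b. (\<forall>i<m. a i \<in> P' \<and> b i \<in> P' \<and> a i \<le> b i) \<and>
    disjoint_family_on (\<lambda>i. {a i<..b i}) {..<m} \<and>
    \<gamma> \<le> (\<Sum>i<m. norm (h' (b i) - h' (a i) - interpolation P h {a i<..b i})))"

text \<open>The innermost condition of \<open>thick_family\<close>, separated so that its nested
  existential statements can be opened one layer at a time.\<close>

definition companion :: "('m \<Rightarrow> 'm \<Rightarrow> real) \<Rightarrow> real \<Rightarrow> real \<Rightarrow> (real \<Rightarrow> 'm) \<Rightarrow> (real \<Rightarrow> 'm) \<Rightarrow> nat \<Rightarrow> (nat \<Rightarrow> 'm) \<Rightarrow> bool" where
  "companion d D \<alpha> g g' n r \<longleftrightarrow> (\<exists>t::nat \<Rightarrow> real.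
    (\<forall>i\<in>{1..n}. t i \<in> {0..D} \<and> r i = g (t i) \<and> r i = g' (t i)) \<and>
    (\<exists>(m::nat) (q::nat \<Rightarrow> real) (s::nat \<Rightarrow> real).
       t ` {1..n} \<subseteq> q ` {1..m} \<and>
       0 \<le> s 1 \<and> (\<forall>i\<in>{1..m}. s i \<le> q i \<and> q i \<le> s (i + 1)) \<and> s (m + 1) \<le> D \<and>
       (\<forall>i\<in>{1..m}. g (q i) = g' (q i)) \<and>
       (\<Sum>i=1..m+1. d (g (s i)) (g' (s i))) \<ge> \<alpha>))"

lemma thick_family_iff:
  "thick_family M d u v T \<longleftrightarrow> (\<forall>g\<in>T. uv_geodesic M d u v g) \<and>
    (\<exists>\<alpha>>0. \<forall>g\<in>T. \<forall>(n::nat) (r::nat \<Rightarrow> 'm). (\<forall>i\<in>{1..n}. r i \<in> g ` {0..d u v}) \<longrightarrow>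
      (\<exists>g'\<in>T. g' \<noteq> g \<and> companion d (d u v) \<alpha> g g' n r))"
  unfolding thick_family_def companion_def ..

text \<open>The two geodesics have the same interpolation with respect to \<open>P\<close>, so they cannot both be
  close to it.\<close>

lemma thick_family_deviates:
  fixes f :: "'m \<Rightarrow> 'x::real_normed_vector"
  assumes ms: "Metric_space M d" and geo: "\<And>g. g \<in> T \<Longrightarrow> uv_geodesic M d u v g"
    and \<alpha>: "\<And>g n r. g \<in> T \<Longrightarrow> \<forall>i\<in>{1..n}. r i \<in> g ` {0..d u v} \<Longrightarrow>
        \<exists>g'\<in>T. g' \<noteq> g \<and> companion d (d u v) \<alpha> g g' n r"
    and "0 < c" and f: "\<And>a b. a \<in> (\<Union>g\<in>T. g ` {0..d u v}) \<Longrightarrow> b \<in> (\<Union>g\<in>T. g ` {0..d u v}) \<Longrightarrow> c * d a b \<le> norm (f a - f b)"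
    and g: "g \<in> T" and P: "finite P" "P \<subseteq> {0..d u v}"
  shows "\<exists>g'\<in>T. \<exists>P'. finite P' \<and> P \<subseteq> P' \<and> P' \<subseteq> {0..d u v} \<and> (\<forall>p\<in>P. g' p = g p) \<and>
    deviates (c * \<alpha> / 2) P (f \<circ> g) P' (f \<circ> g')"
proof -
  interpret Metric_space M d by fact
  obtain e where e: "bij_betw e {1..card P} P" using ex_bij_betw_nat_finite_1[OF P(1)] by blast
  then have eP: "e ` {1..card P} = P" by (simp add: bij_betw_def)
  have "\<forall>i\<in>{1..card P}. (g \<circ> e) i \<in> g ` {0..d u v}" using eP P(2) by auto
  from \<alpha>[OF g this] obtain g' where g': "g' \<in> T" and comp: "companion d (d u v) \<alpha> g g' (card P) (g \<circ> e)"
    by blast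
  obtain t :: "nat \<Rightarrow> real" and m :: nat and q s :: "nat \<Rightarrow> real" where t0: "\<forall>i\<in>{1..card P}. t i \<in> {0..d u v} \<and> (g \<circ> e) i = g (t i) \<and> (g \<circ> e) i = g' (t i)"
    and tq: "t ` {1..card P} \<subseteq> q ` {1..m}"
    and s1: "0 \<le> s 1" and sq0: "\<forall>i\<in>{1..m}. s i \<le> q i \<and> q i \<le> s (i + 1)" and sm: "s (m + 1) \<le> d u v"
    and gq0: "\<forall>i\<in>{1..m}. g (q i) = g' (q i)"
    and big: "\<alpha> \<le> (\<Sum>i=1..m+1. d (g (s i)) (g' (s i)))"
    using comp unfolding companion_def by (elim exE conjE) (rule that)
  have t: "t i \<in> {0..d u v} \<and> g (e i) = g (t i) \<and> g (e i) = g' (t i)" if "i \<in> {1..card P}" for i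
    using bspec[OF t0 that] unfolding comp_def .
  have sq: "s i \<le> q i \<and> q i \<le> s (i + 1)" and gq: "g (q i) = g' (q i)" if "i \<in> {1..m}" for i
    using bspec[OF sq0 that] bspec[OF gq0 that] by blast+
  have gg: "uv_geodesic M d u v g" "uv_geodesic M d u v g'" using geo g g' by auto
  \<comment> \<open>Geodesics are injective, so the parameter of a prescribed point is determined
    and agreement of points becomes agreement at the parameters in \<open>P\<close>.\<close>
  have te: "t i = e i" if i: "i \<in> {1..card P}" for i
  proof -
    have ei: "e i \<in> {0..d u v}" using eP P(2) i by blast
    have gM: "g (e i) \<in> M" using gg(1) ei unfolding uv_geodesic_def by blast
    have "d (g (e i)) (g (t i)) = \<bar>e i - t i\<bar>" using gg(1) ei t[OF i] unfolding uv_geodesic_def by blast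
    moreover have "d (g (e i)) (g (t i)) = 0" using t[OF i] gM by simp
    ultimately show ?thesis by simp
  qed
  have agree: "g' p = g p" if p: "p \<in> P" for p
  proof -
    obtain i where i: "i \<in> {1..card P}" "p = e i" using p eP by blast
    then show ?thesis using t[OF i(1)] te[OF i(1)] by simp
  qed
  \<comment> \<open>The intervals lead from an agreement point \<open>q i\<close> to the next
    comparison point \<open>s (i + 1)\<close>; the first one starts at 0, where both geodesics are
    at \<open>u\<close>.\<close>
  define a where "a i = (if i = 0 then 0 else q i)" for i :: nat
  define b where "b i = s (Suc i)" for i
  have ab: "a i \<le> b i" if "i \<le> m" for i using that s1 sq[of i] by (auto simp: a_def b_def)
  have ba: "b i \<le> a (Suc i)" if "i < m" for i using that sq[of "Suc i"] by (auto simp: a_def b_def)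
  have ba_less: "b i \<le> a j" if "i < j" "j \<le> m" for i j
    using that
  proof (induction j)
    case (Suc j)
    show ?case
    proof (cases "i = j")
      case True
      then show ?thesis using ba[of j] Suc.prems by simp
    next
      case False
      then have "b i \<le> a j" using Suc by simp
      then show ?thesis using ab[of j] ba[of j] Suc.prems by simp
    qed
  qed simp
  have lo: "0 \<le> a i" if "i \<le> m" for i
  proof (cases "i = 0")
    case False
    then have "b 0 \<le> a i" using ba_less[of 0 i] that by simp
    then show ?thesis using s1 by (simp add: b_def)
  qed (simp add: a_def)
  have up: "b i \<le> d u v" if "i \<le> m" for i
  proof (cases "i = m")
    case False
    then have "b i \<le> a m" using ba_less[of i m] that by simp
    then show ?thesis using ab[of m] sm by (simp add: b_def)
  qed (use sm in \<open>simp add: b_def\<close>)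
  have bnd: "a i \<in> {0..d u v}" "b i \<in> {0..d u v}" if "i \<le> m" for i
    using lo[OF that] up[OF that] ab[OF that] by auto
  define P' where "P' = P \<union> a ` {..m} \<union> b ` {..m}"
  have P': "finite P'" "P \<subseteq> P'" "P' \<subseteq> {0..d u v}" using P bnd by (auto simp: P'_def)
  have ga: "g (a i) = g' (a i)" if "i \<le> m" for i
    using gq[of i] gg that by (cases "i = 0") (auto simp: a_def uv_geodesic_def)
  have dis: "disjoint_family_on (\<lambda>i. {a i<..b i}) {..<Suc m}"
    unfolding disjoint_family_on_def
  proof (intro ballI impI)
    fix i j assume "i \<in> {..<Suc m}" "j \<in> {..<Suc m}" "i \<noteq> j"
    then have "b i \<le> a j \<or> b j \<le> a i" using ba_less[of i j] ba_less[of j i] by (cases "i < j") auto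
    then show "{a i<..b i} \<inter> {a j<..b j} = {}" by auto
  qed
  let ?W = "\<lambda>g i. norm ((f \<circ> g) (b i) - (f \<circ> g) (a i) - interpolation P (f \<circ> g) {a i<..b i})"
  have int: "interpolation P (f \<circ> g') = interpolation P (f \<circ> g)"
    using agree by (intro interpolation_cong) simp
  \<comment> \<open>The curves agree at \<open>a i\<close>, so the difference of their images at
    \<open>b i\<close> is the difference of their deviations from the common interpolation.\<close>
  have "c * d (g (b i)) (g' (b i)) \<le> ?W g i + ?W g' i" if "i < Suc m" for i
  proof -
    have mem: "g (b i) \<in> (\<Union>g\<in>T. g ` {0..d u v})" "g' (b i) \<in> (\<Union>g\<in>T. g ` {0..d u v})"
      by (intro UN_I[OF g] UN_I[OF g'] imageI bnd(2) less_Suc_eq_le[THEN iffD1, OF that])+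
    let ?x = "f (g (b i)) - f (g (a i)) - interpolation P (f \<circ> g) {a i<..b i}"
    let ?y = "f (g' (b i)) - f (g' (a i)) - interpolation P (f \<circ> g') {a i<..b i}"
    have eq: "f (g (b i)) - f (g' (b i)) = ?x - ?y" using ga[of i] that by (simp add: int)
    have "norm (f (g (b i)) - f (g' (b i))) \<le> norm ?x + norm ?y"
      unfolding eq by (rule norm_triangle_ineq4)
    then show ?thesis using f[OF mem] unfolding o_apply by linarith
  qed
  then have "(\<Sum>i<Suc m. c * d (g (b i)) (g' (b i))) \<le> (\<Sum>i<Suc m. ?W g i + ?W g' i)"
    by (intro sum_mono) auto
  moreover have "(\<Sum>i=1..m+1. d (g (s i)) (g' (s i))) = (\<Sum>i<Suc m. d (g (b i)) (g' (b i)))"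
    unfolding b_def by (rule sum.reindex_bij_witness[of _ Suc "\<lambda>i. i - 1"]) auto
  moreover have "c * \<alpha> \<le> c * (\<Sum>i=1..m+1. d (g (s i)) (g' (s i)))" using big \<open>0 < c\<close> by simp
  ultimately have "c * \<alpha> \<le> (\<Sum>i<Suc m. ?W g i) + (\<Sum>i<Suc m. ?W g' i)"
    by (simp only: sum_distrib_left[symmetric] sum.distrib[symmetric])
  then have "c * \<alpha> / 2 \<le> (\<Sum>i<Suc m. ?W g i) \<or> c * \<alpha> / 2 \<le> (\<Sum>i<Suc m. ?W g' i)" by linarith
  \<comment> \<open>The better of the two is kept. It may be \<open>g\<close> itself, in which case
    only the set of parameters grows.\<close>
  then obtain g'' where g'': "g'' \<in> T" "\<And>p. p \<in> P \<Longrightarrow> g'' p = g p" "c * \<alpha> / 2 \<le> (\<Sum>i<Suc m. ?W g'' i)"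
    using g g' agree by blast
  have "interpolation P (f \<circ> g'') = interpolation P (f \<circ> g)"
    using g''(2) by (intro interpolation_cong) simp
  then have "deviates (c * \<alpha> / 2) P (f \<circ> g) P' (f \<circ> g'')"
    unfolding deviates_def using g''(3) dis ab
    by (intro exI[of _ "Suc m"] exI[of _ a] exI[of _ b] conjI) (auto simp: P'_def simp del: sum.lessThan_Suc)
  then show ?thesis using g'' P' by (intro bexI[OF _ g''(1)] exI[of _ P']) auto
qed

theorem thick_family_imp_not_radon_nikodym:
  assumes "admits_thick_family TYPE('m) TYPE('x::banach)"
  shows "\<not> radon_nikodym_property TYPE(real) TYPE('x)"
proof
  assume rnp: "radon_nikodym_property TYPE(real) TYPE('x)"
  obtain M0 :: "'m set" and d u v T and f :: "'m \<Rightarrow> 'x"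
    where ms: "Metric_space M0 d" and u: "u \<in> M0" "v \<in> M0" and T: "T \<noteq> {}" and tf: "thick_family M0 d u v T"
      and bl: "bilipschitz_embedding (\<Union>g\<in>T. g ` {0..d u v}) d f"
    using assms unfolding admits_thick_family_def by blast
  interpret Metric_space M0 d by fact
  define D where "D = d u v"
  have "0 \<le> D" by (simp add: D_def)
  have geo: "\<And>g. g \<in> T \<Longrightarrow> uv_geodesic M0 d u v g" using tf by (simp add: thick_family_def)
  obtain \<alpha> where "0 < \<alpha>" and \<alpha>: "\<And>g n r. g \<in> T \<Longrightarrow> \<forall>i\<in>{1..n}. r i \<in> g ` {0..d u v} \<Longrightarrow>
        \<exists>g'\<in>T. g' \<noteq> g \<and> companion d (d u v) \<alpha> g g' n r"
    using tf unfolding thick_family_iff by blast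
  obtain c C where "0 < c" "c \<le> C"
    and cC: "\<forall>a\<in>(\<Union>g\<in>T. g ` {0..d u v}). \<forall>b\<in>(\<Union>g\<in>T. g ` {0..d u v}).
      c * d a b \<le> norm (f a - f b) \<and> norm (f a - f b) \<le> C * d a b"
    using bl unfolding bilipschitz_embedding_def by (elim exE conjE) (rule that)
  have lower: "c * d a b \<le> norm (f a - f b)" and upper: "norm (f a - f b) \<le> C * d a b"
    if "a \<in> (\<Union>g\<in>T. g ` {0..d u v})" "b \<in> (\<Union>g\<in>T. g ` {0..d u v})" for a b
    using bspec[OF bspec[OF cC that(1)] that(2)] by simp_all
  define \<gamma> where "\<gamma> = c * \<alpha> / 2"
  have "0 < \<gamma>" using \<open>0 < c\<close> \<open>0 < \<alpha>\<close> by (simp add: \<gamma>_def)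
  have "0 \<le> C" using \<open>0 < c\<close> \<open>c \<le> C\<close> by simp
  define ok where "ok X \<longleftrightarrow> fst X \<in> T \<and> finite (snd X) \<and> {0, D} \<subseteq> snd X \<and> snd X \<subseteq> {0..D}" for X
  define next_ok where "next_ok X Y \<longleftrightarrow> snd X \<subseteq> snd Y \<and> (\<forall>p\<in>snd X. fst Y p = fst X p) \<and>
    deviates \<gamma> (snd X) (f \<circ> fst X) (snd Y) (f \<circ> fst Y)" for X Y
  \<comment> \<open>A stage is a geodesic together with a finite set of parameters. Later geodesics
    keep the values at the parameters already chosen, which makes the increments consistent.\<close>
  have "\<exists>X. \<forall>n. ok (X n) \<and> next_ok (X n) (X (Suc n))"
  proof (rule dependent_nat_choice)
    obtain g where "g \<in> T" using T by blast
    then show "\<exists>X. ok X" using \<open>0 \<le> D\<close> by (intro exI[of _ "(g, {0, D})"]) (auto simp: ok_def)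
  next
    fix X and n :: nat assume X: "ok X"
    then obtain g' P' where "g' \<in> T" "finite P'" "snd X \<subseteq> P'" "P' \<subseteq> {0..d u v}" "\<forall>p\<in>snd X. g' p = fst X p"
      "deviates (c * \<alpha> / 2) (snd X) (f \<circ> fst X) P' (f \<circ> g')"
      using thick_family_deviates[OF ms geo \<alpha> \<open>0 < c\<close> lower, of "fst X" "snd X"]
      unfolding ok_def D_def by blast
    then show "\<exists>Y. ok Y \<and> next_ok X Y"
      using X by (intro exI[of _ "(g', P')"]) (auto simp: ok_def next_ok_def \<gamma>_def D_def)
  qed
  then obtain X where X: "\<And>n. ok (X n)" "\<And>n. next_ok (X n) (X (Suc n))" by blast
  define P where "P n = snd (X n)" for n
  define h where "h n = f \<circ> fst (X n)" for n
  have P: "\<And>k. finite (P k)" "\<And>k. P k \<subseteq> P (Suc k)" "0 \<in> P 0" "D \<in> P 0" "\<And>k. P k \<subseteq> {0..D}"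
    using X unfolding ok_def next_ok_def P_def by auto
  obtain M where ip: "interval_partitions M P D" and leb: "\<And>A. A \<in> sets M \<Longrightarrow> measure M A = measure lborel A"
    using interval_partitions_exist[of P D] P by blast
  interpret ip: interval_partitions M P D by (rule ip)
  have lip: "norm (h k b - h k a) \<le> C * (b - a)" if "a \<in> P k" "b \<in> P k" "a \<le> b" for k a b
  proof -
    have gT: "fst (X k) \<in> T" using X(1) by (simp add: ok_def)
    have ab: "a \<in> {0..d u v}" "b \<in> {0..d u v}" using that P(5)[of k] by (auto simp: D_def)
    have "d (fst (X k) b) (fst (X k) a) = \<bar>b - a\<bar>" using geo[OF gT] ab unfolding uv_geodesic_def by blast
    moreover have "norm (f (fst (X k) b) - f (fst (X k) a)) \<le> C * d (fst (X k) b) (fst (X k) a)"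
      by (intro upper UN_I[OF gT] imageI ab)
    ultimately show ?thesis using that(3) by (simp add: h_def)
  qed
  have cons: "h k a = h j a" if "j \<le> k" "a \<in> P j" for j k a
    using that(1)
  proof (induction k rule: dec_induct)
    case (step k)
    have "a \<in> P k" using ip.P_mono[OF step(1)] that(2) by blast
    then have "h (Suc k) a = h k a" using X(2)[of k] by (simp add: next_ok_def P_def h_def)
    then show ?case using step by simp
  qed simp
  obtain G where G: "vector_measure M G" "bounded_variation M G" "continuous_wrt M G"
    and G_int: "\<And>k a b. a \<in> P k \<Longrightarrow> b \<in> P k \<Longrightarrow> a \<le> b \<Longrightarrow> G {a<..b} = h k b - h k a"
    using ip.lipschitz_vector_measure[of h C] lip \<open>0 \<le> C\<close> cons by blast
  obtain F where F: "\<And>A. A \<in> sets M \<Longrightarrow> bochner_integral_is M (\<lambda>z. indicator A z *\<^sub>R F z) (G A)"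
    using rnp ip.finite_measure_axioms G unfolding radon_nikodym_property_def by blast
  have "ip.regular G" by (rule ip.regular_bochner_integral[OF F])
  then have "\<exists>K. \<forall>k\<ge>K. \<forall>m J. ip.disjoint_pieces m J \<longrightarrow>
      (\<Sum>i<m. norm (G (J i) - ip.proj k G (J i))) \<le> \<gamma> / 2"
    using half_gt_zero[OF \<open>0 < \<gamma>\<close>] unfolding ip.regular_def by (elim allE impE)
  then obtain k where "\<forall>k'\<ge>k. \<forall>m J. ip.disjoint_pieces m J \<longrightarrow>
      (\<Sum>i<m. norm (G (J i) - ip.proj k' G (J i))) \<le> \<gamma> / 2"
    by (elim exE) (rule that)
  from this[rule_format, OF order_refl]
  have k: "(\<Sum>i<m. norm (G (J i) - ip.proj k G (J i))) \<le> \<gamma> / 2"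
    if "ip.disjoint_pieces m J" for m J
    using that by simp
  \<comment> \<open>Stage \<open>k\<close> is within \<open>\<gamma> / 2\<close> of \<open>G\<close>
    in variation. The deviating intervals have end points in \<open>P (Suc k)\<close> and need not
    be unions of cells of stage \<open>k\<close>, but they are measurable, and on them
    \<open>G\<close> deviates from \<open>proj k G\<close> by \<open>\<gamma>\<close>.\<close>
  obtain m and a b :: "nat \<Rightarrow> real" where ab: "\<And>i. i < m \<Longrightarrow> a i \<in> P (Suc k) \<and> b i \<in> P (Suc k) \<and> a i \<le> b i"
    and dis: "disjoint_family_on (\<lambda>i. {a i<..b i}) {..<m}"
    and dev: "\<gamma> \<le> (\<Sum>i<m. norm (h (Suc k) (b i) - h (Suc k) (a i) - interpolation (P k) (h k) {a i<..b i}))"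
    using X(2)[of k] unfolding next_ok_def deviates_def P_def[symmetric] h_def[symmetric] by blast
  have J: "{a i<..b i} \<in> sets M" if "i < m" for i using ab[OF that] ip.interval_sets by blast
  have "interpolation (P k) (h k) {a i<..b i} = ip.proj k G {a i<..b i}" if "i < m" for i
    unfolding interpolation_def ip.proj_def
  proof (rule sum.cong[OF refl])
    fix c assume c: "c \<in> cells (P k)"
    have "measure M ({a i<..b i} \<inter> ivl c) = measure lborel ({a i<..b i} \<inter> ivl c)"
      using J[OF that] ip.cells_sets[OF c] by (intro leb) auto
    moreover have "G (ivl c) = h k (snd c) - h k (fst c)"
      using c unfolding ivl_def by (intro G_int) (auto simp: cells_def)
    ultimately show "(measure lborel ({a i<..b i} \<inter> ivl c) / (snd c - fst c)) *\<^sub>R (h k (snd c) - h k (fst c)) =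
        (measure M ({a i<..b i} \<inter> ivl c) / (snd c - fst c)) *\<^sub>R G (ivl c)" by simp
  qed
  moreover have "G {a i<..b i} = h (Suc k) (b i) - h (Suc k) (a i)" if "i < m" for i
    using G_int ab[OF that] by blast
  ultimately have "(\<Sum>i<m. norm (h (Suc k) (b i) - h (Suc k) (a i) - interpolation (P k) (h k) {a i<..b i})) =
      (\<Sum>i<m. norm (G {a i<..b i} - ip.proj k G {a i<..b i}))"
    by (intro sum.cong) auto
  then have "\<gamma> \<le> \<gamma> / 2" using dev k[of m "\<lambda>i. {a i<..b i}"] J dis by (simp add: ip.disjoint_pieces_def)
  then show False using \<open>0 < \<gamma>\<close> by simp
qed

text \<open>The two implications form a cycle through fixed types: measure spaces on any type lead
  to a thick family in the Banach space itself, and thick families on any type lead to a measure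
  space on the reals. Both transfer statements follow by going around it.\<close>

theorem corollary1p5:
  shows "(\<not> radon_nikodym_property TYPE(real) TYPE('x::banach) \<longleftrightarrow>
            admits_thick_family TYPE('x) TYPE('x)) \<and>
         (radon_nikodym_property TYPE(real) TYPE('x) \<longrightarrow>
            radon_nikodym_property TYPE('w) TYPE('x)) \<and>
         (admits_thick_family TYPE('m) TYPE('x) \<longrightarrow>
            admits_thick_family TYPE('x) TYPE('x))"
  using not_radon_nikodym_imp_thick_family[where 'w = real and 'x = 'x]
    not_radon_nikodym_imp_thick_family[where 'w = 'w and 'x = 'x]
    thick_family_imp_not_radon_nikodym[where 'm = 'x and 'x = 'x]
    thick_family_imp_not_radon_nikodym[where 'm = 'm and 'x = 'x] by blast

end
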